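(* Let $x_0\in\mathrm{int}(P)$ and $\gamma\in(0,1)$. Let $$\epsilon:=\min\left\{\frac{\lambda_0^2\rho_0^2}{2m^2},\ \frac{\lambda_0^2r_0^2}{8m^2L_{\mathrm{ctr}}^2},\ \frac{\lambda_0^2(1-q_0)^2}{2m^2L_0^2L_{\mathrm{ctr}}^2},\ \frac{\lambda_0^2(1-q_0)^2\log(1/\gamma)^2}{32m^2L_0^2L_{\mathrm{ctr}}^2},\ \frac{\lambda_0^2\log(1/\gamma)^2}{32m^2L_{\mathrm{vol}}^2}\right\},$$ $$N_\gamma:=\left\lceil\frac{\log^+\bigl(2\delta_v(x_0)/\log(1/\gamma)\bigr)}{\log(1/q_0)}\right\rceil,\qquad \eta:=\min\{1,\exp(\epsilon/2)-1\}.$$ If this instance-dependent tolerance and iteration budget are supplied, the (inexact) polarity process produces a $\gamma$-maximal ellipsoid of $P$ using $$\mathcal O\left((N_\gamma+1)\,mn^2\left(\frac n\eta+\log\log m\right)\right)$$ arithmetic operations when the barycentric coordinate descent (BCD) method is used to solve each dual MinCE problem, or at most $$\mathcal O\left((N_\gamma+1)\,m^{3.5}\log\left(\frac m\eta\right)\right)$$ arithmetic operations when each dual MinCE problem is solved by a pre-rounding procedure followed by the path-following Newton method.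
   Context: $P=\{x\in\mathbb R^n: a_i^\top x\le 1,\ i=1,\dots,m\}$ is a full-dimensional (bounded) polytope. For $c\in\mathbb R^n$ and $Q$ symmetric positive definite, $\mathcal E(c,Q)=\{y:(y-c)^\top Q(y-c)\le 1\}$, with normalized volume $\mathrm{Vol}(\mathcal E(c,Q))=\det(Q)^{-1/2}$ (same conventions in $\mathbb R^{n+1}$). $S^\circ=\{y: y^\top s\le1\ \forall s\in S\}$. $\mathrm{MinCE}(K)$ is the unique minimum-volume ellipsoid containing $K$; $\mathrm{MaxIE}(P)$ is the unique maximum-volume ellipsoid contained in $P$, with center $x^*$. An ellipsoid $\mathcal E\subseteq P$ is $\gamma$-maximal if $\mathrm{Vol}(\mathcal E)\ge\gamma\mathrm{Vol}(\mathrm{MaxIE}(P))$. For $x\in\mathrm{int}(P)$: $v(x)=\log\mathrm{Vol}(\mathrm{MinCE}((P-x)^\circ))$, $\delta_v(x)=v(x)-v(x^* )$. $\log^+(t)=\max\{0,\log t\}$ for $t>0$, $\log^+(0)=0$. Lifted problem at $x\in\mathrm{int}(P)$: with $\tilde a_i(x)=a_i/(1-a_i^\top x)$ and $h_i(x)=(\tilde a_i(x)^\top,1)^\top$, minimize $-\log\det\mathcal Q$ over symmetric positive definite $\mathcal Q\in\mathbb R^{(n+1)\times(n+1)}$ subject to $h_i(x)^\top\mathcal Qh_i(x)\le1$ for all $i\in[m]$. Its unique optimizer is $\mathcal Q(x)=\begin{bmatrix} G(x) & z(x) \\ z(x)^\top & s(x) \end{bmatrix}$. Put $\beta(x)=1-s(x)+z(x)^\top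 G(x)^{-1}z(x)$, $$\mathcal K(x)=x+\frac{z(x)}{1-s(x)},\quad E(x)=(1-s(x))\Bigl(G(x)^{-1}-\frac{G(x)^{-1}z(x)z(x)^\top G(x)^{-1}}{\beta(x)}\Bigr).$$ For any feasible $\widehat{\mathcal Q}(x)$ with blocks $\widehat G(x),\widehat z(x),\widehat s(x)$ define $\widehat\beta(x),\widehat{\mathcal K}(x),\widehat E(x)$ by the same formulas with hats. Inexact polarity process with tolerance $\epsilon$: for $k=0,1,\dots$ an oracle returns a feasible point $\widehat{\mathcal Q}(x_k)$ of the lifted problem at $x_k$ with $-\log\det\widehat{\mathcal Q}(x_k)\le-\log\det\mathcal Q(x_k)+\epsilon$; set $x_{k+1}=\widehat{\mathcal K}(x_k)$, $E_{k+1}=\widehat E(x_k)$; the ellipsoid produced is $\mathcal E(x_{k+1},E_{k+1})$. Inner solvers. The dual MinCE problem at $x$ is: maximize $\log\det\sum_{j=1}^{2m}y_jp_j(x)p_j(x)^\top$ over the standard simplex $\{y\in\mathbb R^{2m}_+:\sum_jy_j=1\}$, where $p_1(x),\dots,p_{2m}(x)$ enumerate $\pm h_1(x),\dots,\pm h_m(x)$. Known results of Khachiyan (Rounding of polytopes in the real number model of computation, 1996), used as given: for $\eta\in(0,1]$, a feasible $\widehat{\mathcal Q}(x)$ of the lifted problem with $\mathrm{Vol}(\mathcal E(\mathbf 0,\widehat{\mathcal Q}(x)))\le(1+\eta)\mathrm{Vol}(\mathcal E(\mathbf 0,\mathcal Q(x)))$ can be obtained by solving this dual problem using either $\mathcal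 O(mn^2(n/\eta+\log\log m))$ arithmetic operations by his barycentric coordinate descent (BCD) method, or $\mathcal O(m^{3.5}\log(m/\eta))$ arithmetic operations by pre-rounding followed by a path-following Newton method (real-number model). Constants (depending on $P$ and $x_0$). Let $\mathcal L=\{x\in\mathrm{int}(P):v(x)\le v(x_0)+1\}$, which is compact. - $q_0\in(0,1)$ is such that $\delta_v(\mathcal K(x))\le q_0\delta_v(x)$ for all $x\in\mathcal L$ (such $q_0$ exists). - $\lambda_0=\min_{x\in\mathcal L}\lambda_{\min}\bigl(\sum_{i=1}^mh_i(x)h_i(x)^\top\bigr)>0$. - $\theta_0,\mu_0,\sigma_0,\beta_0$ are the (positive) minima over $x\in\mathcal L$ of $\lambda_{\min}(\mathcal Q(x))$, $\lambda_{\min}(G(x))$, $1-s(x)$, $\beta(x)$, respectively. $\rho_0>0$ is such that for all $x\in\mathcal L$ and all feasible $\widehat{\mathcal Q}(x)$ with $\|\widehat{\mathcal Q}(x)-\mathcal Q(x)\|_F\le\rho_0$: $\lambda_{\min}(\widehat{\mathcal Q}(x))\ge\theta_0/2$, $\lambda_{\min}(\widehat G(x))\ge\mu_0/2$, $1-\widehat s(x)\ge\sigma_0/2$, $\widehat\beta(x)\ge\beta_0/2$; and $L_{\mathrm{ctr}},L_{\mathrm{vol}}>0$ are such that for all such $x,\widehat{\mathcal Q}(x)$: $\|\widehat{\mathcal K}(x)-\mathcal K(x)\|\le L_{\mathrm{ctr}}\|\widehat{\mathcal Q}(x)-\mathcal Q(x)\|_F$ and $|\log\mathrm{Vol}(\mathcal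 E(\widehat{\mathcal K}(x),\widehat E(x)))-\log\mathrm{Vol}(\mathcal E(\mathcal K(x),E(x)))|\le L_{\mathrm{vol}}\|\widehat{\mathcal Q}(x)-\mathcal Q(x)\|_F$ (such constants exist). - $r_0=\mathrm{dist}(\mathcal K(\mathcal L),\partial P)>0$, $\mathcal V_0=\{y\in\mathbb R^n:\mathrm{dist}(y,\mathcal K(\mathcal L))\le r_0/2\}$, $L_0=\max_{y\in\mathcal V_0}\|\nabla\delta_v(y)\|\in(0,\infty)$. *)

theory Defs
  imports "HOL-Analysis.Analysis"
begin

section \<open>Ellipsoids and polytopes\<close>

definition posdef :: "real^'k^'k \<Rightarrow> bool" where
  "posdef Q \<longleftrightarrow> transpose Q = Q \<and> (\<forall>x. x \<noteq> 0 \<longrightarrow> 0 < x \<bullet> (Q *v x))"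

definition outer :: "real^'k \<Rightarrow> real^'k \<Rightarrow> real^'k^'k" where
  "outer u w = (\<chi> i j. u $ i * w $ j)"

definition ellipsoid :: "real^'k \<Rightarrow> real^'k^'k \<Rightarrow> (real^'k) set" where
  "ellipsoid c Q = {y. (y - c) \<bullet> (Q *v (y - c)) \<le> 1}"

text \<open>Normalized volume of \<open>ellipsoid c Q\<close>, as a function of the matrix only.\<close>

definition vol :: "real^'k^'k \<Rightarrow> real" where
  "vol Q = det Q powr (- 1 / 2)"

text \<open>Both extremal ellipsoids are represented by their pair (centre, matrix); a positive definite
  matrix and a centre are determined by the ellipsoid.\<close>

definition MinCE :: "(real^'k) set \<Rightarrow> (real^'k) \<times> (real^'k^'k)" where
  "MinCE K = (THE (c, Q). posdef Q \<and> K \<subseteq> ellipsoid c Q \<and>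
     (\<forall>c' Q'. posdef Q' \<and> K \<subseteq> ellipsoid c' Q' \<longrightarrow> vol Q \<le> vol Q'))"

definition MaxIE :: "(real^'k) set \<Rightarrow> (real^'k) \<times> (real^'k^'k)" where
  "MaxIE K = (THE (c, Q). posdef Q \<and> ellipsoid c Q \<subseteq> K \<and>
     (\<forall>c' Q'. posdef Q' \<and> ellipsoid c' Q' \<subseteq> K \<longrightarrow> vol Q' \<le> vol Q))"

definition polar :: "(real^'k) set \<Rightarrow> (real^'k) set" where
  "polar S = {y. \<forall>s\<in>S. y \<bullet> s \<le> 1}"

text \<open>\<open>'n\<close> indexes the coordinates (dimension \<open>CARD('n)\<close>), \<open>'m\<close> the inequalities
  (\<open>CARD('m)\<close> of them).\<close>

definition polytope_of :: "('m::finite \<Rightarrow> real^'n) \<Rightarrow> (real^'n) set" where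
  "polytope_of a = {x. \<forall>i. a i \<bullet> x \<le> 1}"

definition full_dim_polytope :: "('m::finite \<Rightarrow> real^'n) \<Rightarrow> bool" where
  "full_dim_polytope a \<longleftrightarrow> bounded (polytope_of a) \<and> interior (polytope_of a) \<noteq> {}"

definition gamma_maximal ::
    "('m::finite \<Rightarrow> real^'n) \<Rightarrow> real \<Rightarrow> real^'n \<Rightarrow> real^'n^'n \<Rightarrow> bool" where
  "gamma_maximal a \<gamma> c E \<longleftrightarrow> posdef E \<and> ellipsoid c E \<subseteq> polytope_of a \<and>
     \<gamma> * vol (snd (MaxIE (polytope_of a))) \<le> vol E"

definition pot :: "('m::finite \<Rightarrow> real^'n) \<Rightarrow> real^'n \<Rightarrow> real" where
  "pot a x = ln (vol (snd (MinCE (polar ((\<lambda>p. p - x) ` polytope_of a)))))"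

definition delta :: "('m::finite \<Rightarrow> real^'n) \<Rightarrow> real^'n \<Rightarrow> real" where
  "delta a x = pot a x - pot a (fst (MaxIE (polytope_of a)))"

definition level_set :: "('m::finite \<Rightarrow> real^'n) \<Rightarrow> real^'n \<Rightarrow> (real^'n) set" where
  "level_set a x0 = {x \<in> interior (polytope_of a). pot a x \<le> pot a x0 + 1}"


section \<open>The lifted problem\<close>

text \<open>The lifted space is indexed by \<open>'n option\<close>; \<open>None\<close> is the additional last coordinate.\<close>

definition lift_pt :: "('m::finite \<Rightarrow> real^'n) \<Rightarrow> real^'n \<Rightarrow> 'm \<Rightarrow> real^('n::finite option)" where
  "lift_pt a x i = (\<chi> j. case j of None \<Rightarrow> 1 | Some k \<Rightarrow> a i $ k / (1 - a i \<bullet> x))"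

definition lifted_feasible ::
    "('m::finite \<Rightarrow> real^'n) \<Rightarrow> real^'n \<Rightarrow> real^('n::finite option)^('n option) \<Rightarrow> bool" where
  "lifted_feasible a x Q \<longleftrightarrow>
     posdef Q \<and> (\<forall>i. lift_pt a x i \<bullet> (Q *v lift_pt a x i) \<le> 1)"

definition lifted_opt ::
    "('m::finite \<Rightarrow> real^'n) \<Rightarrow> real^'n \<Rightarrow> real^('n::finite option)^('n option)" where
  "lifted_opt a x = (THE Q. lifted_feasible a x Q \<and>
     (\<forall>Q'. lifted_feasible a x Q' \<longrightarrow> - ln (det Q) \<le> - ln (det Q')))"

definition G_block :: "real^('n::finite option)^('n option) \<Rightarrow> real^'n^'n" where
  "G_block Q = (\<chi> i j. Q $ Some i $ Some j)"

definition z_block :: "real^('n::finite option)^('n option) \<Rightarrow> real^'n" where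
  "z_block Q = (\<chi> i. Q $ Some i $ None)"

definition s_block :: "real^('n::finite option)^('n option) \<Rightarrow> real" where
  "s_block Q = Q $ None $ None"

definition beta :: "real^('n::finite option)^('n option) \<Rightarrow> real" where
  "beta Q = 1 - s_block Q + z_block Q \<bullet> (matrix_inv (G_block Q) *v z_block Q)"

text \<open>\<open>\<K>(x)\<close> and \<open>E(x)\<close> are \<open>new_center x Q\<close> and \<open>new_shape Q\<close> at \<open>Q = lifted_opt a x\<close>; their
  hatted versions are obtained from any other feasible \<open>Q\<close>.\<close>

definition new_center :: "real^'n \<Rightarrow> real^('n::finite option)^('n option) \<Rightarrow> real^'n" where
  "new_center x Q = x + (1 / (1 - s_block Q)) *\<^sub>R z_block Q"

definition new_shape :: "real^('n::finite option)^('n option) \<Rightarrow> real^'n^'n" where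
  "new_shape Q =
     (let Gi = matrix_inv (G_block Q); z = z_block Q in
      (1 - s_block Q) *\<^sub>R
        (Gi - (1 / beta Q) *\<^sub>R (Gi ** outer z z ** Gi)))"

definition polarity_map :: "('m::finite \<Rightarrow> real^'n) \<Rightarrow> real^'n \<Rightarrow> real^'n" where
  "polarity_map a x = new_center x (lifted_opt a x)"

text \<open>Steps \<open>k = 0, \<dots>, N\<close> of the inexact polarity process; they produce the ellipsoid with
  centre \<open>xs (N + 1)\<close> and matrix \<open>new_shape (Qs N)\<close>.\<close>

definition inexact_polarity_run ::
    "('m::finite \<Rightarrow> real^'n) \<Rightarrow> real^'n \<Rightarrow> real \<Rightarrow> nat \<Rightarrow>
     (nat \<Rightarrow> real^'n) \<Rightarrow> (nat \<Rightarrow> real^('n::finite option)^('n option)) \<Rightarrow> bool" where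
  "inexact_polarity_run a x0 \<epsilon> N xs Qs \<longleftrightarrow>
     xs 0 = x0 \<and>
     (\<forall>k\<le>N. lifted_feasible a (xs k) (Qs k) \<and>
            - ln (det (Qs k)) \<le> - ln (det (lifted_opt a (xs k))) + \<epsilon> \<and>
            xs (Suc k) = new_center (xs k) (Qs k))"


section \<open>The instance-dependent constants\<close>

definition is_min_on :: "('a \<Rightarrow> real) \<Rightarrow> 'a set \<Rightarrow> real \<Rightarrow> bool" where
  "is_min_on f S c \<longleftrightarrow> c \<in> f ` S \<and> (\<forall>x\<in>S. c \<le> f x)"

definition is_max_on :: "('a \<Rightarrow> real) \<Rightarrow> 'a set \<Rightarrow> real \<Rightarrow> bool" where
  "is_max_on f S c \<longleftrightarrow> c \<in> f ` S \<and> (\<forall>x\<in>S. f x \<le> c)"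

text \<open>Smallest eigenvalue; used for symmetric matrices only, whose set of real eigenvalues is
  finite and nonempty.\<close>

definition lambda_min :: "real^'k^'k \<Rightarrow> real" where
  "lambda_min A = Min {l. \<exists>v. v \<noteq> 0 \<and> A *v v = l *\<^sub>R v}"

definition lift_gram :: "('m::finite \<Rightarrow> real^'n) \<Rightarrow> real^'n \<Rightarrow> real^('n::finite option)^('n option)" where
  "lift_gram a x = (\<Sum>i\<in>UNIV. outer (lift_pt a x i) (lift_pt a x i))"

text \<open>The norm of \<open>real^'k^'k\<close> is the Frobenius norm.\<close>

locale polarity_constants =
  fixes a :: "'m::finite \<Rightarrow> real^'n" and x0 :: "real^'n"
    and q0 lam0 theta0 mu0 sigma0 beta0 rho0 Lctr Lvol r0 L0 :: real
  assumes polytope: "full_dim_polytope a"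
    and x0_interior: "x0 \<in> interior (polytope_of a)"
    and q0_range: "0 < q0" "q0 < 1"
    and q0_contraction:
      "\<And>x. x \<in> level_set a x0 \<Longrightarrow> delta a (polarity_map a x) \<le> q0 * delta a x"
    and lam0_pos: "0 < lam0"
    and lam0_min: "is_min_on (\<lambda>x. lambda_min (lift_gram a x)) (level_set a x0) lam0"
    and theta0_pos: "0 < theta0"
    and theta0_min: "is_min_on (\<lambda>x. lambda_min (lifted_opt a x)) (level_set a x0) theta0"
    and mu0_pos: "0 < mu0"
    and mu0_min: "is_min_on (\<lambda>x. lambda_min (G_block (lifted_opt a x))) (level_set a x0) mu0"
    and sigma0_pos: "0 < sigma0"
    and sigma0_min: "is_min_on (\<lambda>x. 1 - s_block (lifted_opt a x)) (level_set a x0) sigma0"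
    and beta0_pos: "0 < beta0"
    and beta0_min: "is_min_on (\<lambda>x. beta (lifted_opt a x)) (level_set a x0) beta0"
    and rho0_pos: "0 < rho0"
    and rho0_margin:
      "\<And>x Q. x \<in> level_set a x0 \<Longrightarrow> lifted_feasible a x Q \<Longrightarrow>
         norm (Q - lifted_opt a x) \<le> rho0 \<Longrightarrow>
         theta0 / 2 \<le> lambda_min Q \<and> mu0 / 2 \<le> lambda_min (G_block Q) \<and>
         sigma0 / 2 \<le> 1 - s_block Q \<and> beta0 / 2 \<le> beta Q"
    and Lctr_pos: "0 < Lctr"
    and Lctr_lipschitz:
      "\<And>x Q. x \<in> level_set a x0 \<Longrightarrow> lifted_feasible a x Q \<Longrightarrow>
         norm (Q - lifted_opt a x) \<le> rho0 \<Longrightarrow>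
         norm (new_center x Q - polarity_map a x) \<le> Lctr * norm (Q - lifted_opt a x)"
    and Lvol_pos: "0 < Lvol"
    and Lvol_lipschitz:
      "\<And>x Q. x \<in> level_set a x0 \<Longrightarrow> lifted_feasible a x Q \<Longrightarrow>
         norm (Q - lifted_opt a x) \<le> rho0 \<Longrightarrow>
         \<bar>ln (vol (new_shape Q)) - ln (vol (new_shape (lifted_opt a x)))\<bar>
           \<le> Lvol * norm (Q - lifted_opt a x)"
    and r0_pos: "0 < r0"
    and r0_dist: "r0 = setdist (polarity_map a ` level_set a x0) (frontier (polytope_of a))"
    and L0_pos: "0 < L0"
    and L0_max:
      "\<exists>grad. (\<forall>y\<in>{y. infdist y (polarity_map a ` level_set a x0) \<le> r0 / 2}.
                 GDERIV (delta a) y :> grad y) \<and>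
              is_max_on (\<lambda>y. norm (grad y))
                {y. infdist y (polarity_map a ` level_set a x0) \<le> r0 / 2} L0"

definition log_plus :: "real \<Rightarrow> real" where
  "log_plus t = (if 0 < t then max 0 (ln t) else 0)"

definition tolerance ::
    "real \<Rightarrow> real \<Rightarrow> real \<Rightarrow> real \<Rightarrow> real \<Rightarrow> real \<Rightarrow> real \<Rightarrow> real \<Rightarrow> real \<Rightarrow> real" where
  "tolerance m \<gamma> q0 lam0 rho0 Lctr Lvol r0 L0 = Min {
     lam0\<^sup>2 * rho0\<^sup>2 / (2 * m\<^sup>2),
     lam0\<^sup>2 * r0\<^sup>2 / (8 * m\<^sup>2 * Lctr\<^sup>2),
     lam0\<^sup>2 * (1 - q0)\<^sup>2 / (2 * m\<^sup>2 * L0\<^sup>2 * Lctr\<^sup>2),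
     lam0\<^sup>2 * (1 - q0)\<^sup>2 * (ln (1 / \<gamma>))\<^sup>2 / (32 * m\<^sup>2 * L0\<^sup>2 * Lctr\<^sup>2),
     lam0\<^sup>2 * (ln (1 / \<gamma>))\<^sup>2 / (32 * m\<^sup>2 * Lvol\<^sup>2)}"

definition budget :: "real \<Rightarrow> real \<Rightarrow> real \<Rightarrow> nat" where
  "budget \<gamma> q0 d = nat \<lceil>log_plus (2 * d / ln (1 / \<gamma>)) / ln (1 / q0)\<rceil>"

definition solver_accuracy :: "real \<Rightarrow> real" where
  "solver_accuracy \<epsilon> = min 1 (exp (\<epsilon> / 2) - 1)"


section \<open>Arithmetic operations in the real-number model\<close>

text \<open>Algebraic computation trees: real input variables indexed by \<open>'i\<close>, real outputs indexed by
  \<open>'o\<close>. \<open>Tmp k\<close> is the result of the \<open>k\<close>-th arithmetic operation on the current path. Every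
  arithmetic operation and every comparison costs one unit; real literals are free, as usual for this
  model. Division is total, with \<open>x / 0 = 0\<close>.\<close>

datatype aop = Add | Sub | Mul | Div

datatype 'i operand = In 'i | Tmp nat | Lit real

datatype ('i, 'o) prog =
    Halt "'o \<Rightarrow> 'i operand"
  | Arith aop "'i operand" "'i operand" "('i, 'o) prog"
  | IfLe "'i operand" "'i operand" "('i, 'o) prog" "('i, 'o) prog"

fun apply_aop :: "aop \<Rightarrow> real \<Rightarrow> real \<Rightarrow> real" where
  "apply_aop Add x y = x + y"
| "apply_aop Sub x y = x - y"
| "apply_aop Mul x y = x * y"
| "apply_aop Div x y = x / y"

fun fetch :: "('i \<Rightarrow> real) \<Rightarrow> real list \<Rightarrow> 'i operand \<Rightarrow> real" where
  "fetch \<sigma> ts (In i) = \<sigma> i"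
| "fetch \<sigma> ts (Tmp k) = (if k < length ts then ts ! k else 0)"
| "fetch \<sigma> ts (Lit c) = c"

primrec exec :: "('i, 'o) prog \<Rightarrow> ('i \<Rightarrow> real) \<Rightarrow> real list \<Rightarrow> ('o \<Rightarrow> real) \<times> nat" where
  "exec (Halt out) \<sigma> ts = ((\<lambda>j. fetch \<sigma> ts (out j)), 0)"
| "exec (Arith f u w p) \<sigma> ts =
     (case exec p \<sigma> (ts @ [apply_aop f (fetch \<sigma> ts u) (fetch \<sigma> ts w)]) of
        (r, t) \<Rightarrow> (r, Suc t))"
| "exec (IfLe u w p q) \<sigma> ts =
     (case (if fetch \<sigma> ts u \<le> fetch \<sigma> ts w then exec p \<sigma> ts else exec q \<sigma> ts) of
        (r, t) \<Rightarrow> (r, Suc t))"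

definition prog_result :: "('i, 'o) prog \<Rightarrow> ('i \<Rightarrow> real) \<Rightarrow> 'o \<Rightarrow> real" where
  "prog_result p \<sigma> = fst (exec p \<sigma> [])"

definition op_count :: "('i, 'o) prog \<Rightarrow> ('i \<Rightarrow> real) \<Rightarrow> nat" where
  "op_count p \<sigma> = snd (exec p \<sigma> [])"

text \<open>An inner solver reads the coordinates of the points \<open>h_i(x)\<close> (which also determine the data
  \<open>\<plusminus>h_i(x)\<close> of the dual problem) and writes the entries of a lifted matrix.\<close>

type_synonym ('m, 'n) solver = "('m \<times> 'n option, 'n option \<times> 'n option) prog"

definition solver_input ::
    "('m::finite \<Rightarrow> real^'n) \<Rightarrow> real^'n \<Rightarrow> 'm \<times> 'n option \<Rightarrow> real" where
  "solver_input a x = (\<lambda>(i, j). lift_pt a x i $ j)"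

definition solver_point ::
    "('m::finite, 'n::finite) solver \<Rightarrow> ('m \<Rightarrow> real^'n) \<Rightarrow> real^'n \<Rightarrow>
     real^('n::finite option)^('n option)" where
  "solver_point S a x = (\<chi> i j. prog_result S (solver_input a x) (i, j))"

text \<open>The guarantee taken from Khachiyan's work: \<open>S \<eta>\<close> solves the lifted problem to relative volume
  accuracy \<open>\<eta>\<close> in at most \<open>B \<eta>\<close> operations. The tree may depend on \<open>\<eta>\<close>, but not on \<open>a\<close> or \<open>x\<close>.\<close>

definition khachiyan_guarantee ::
    "(real \<Rightarrow> ('m::finite, 'n::finite) solver) \<Rightarrow> (real \<Rightarrow> real) \<Rightarrow> bool" where
  "khachiyan_guarantee S B \<longleftrightarrow>
     (\<forall>(a :: 'm \<Rightarrow> real^'n) x \<eta>.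
        full_dim_polytope a \<and> x \<in> interior (polytope_of a) \<and> 0 < \<eta> \<and> \<eta> \<le> 1 \<longrightarrow>
        lifted_feasible a x (solver_point (S \<eta>) a x) \<and>
        vol (solver_point (S \<eta>) a x) \<le> (1 + \<eta>) * vol (lifted_opt a x) \<and>
        real (op_count (S \<eta>) (solver_input a x)) \<le> B \<eta>)"

definition bcd_rate :: "real \<Rightarrow> real \<Rightarrow> real \<Rightarrow> real" where
  "bcd_rate m n \<eta> = m * n\<^sup>2 * (n / \<eta> + ln (ln m))"

definition newton_rate :: "real \<Rightarrow> real \<Rightarrow> real" where
  "newton_rate m \<eta> = m powr (7 / 2) * ln (m / \<eta>)"

text \<open>A program for the whole process reads the entries of the \<open>a i\<close> and of \<open>x0\<close>, and writes the
  centre and the matrix of an ellipsoid.\<close>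

type_synonym ('m, 'n) process_prog = "('m \<times> 'n + 'n, 'n + 'n \<times> 'n) prog"

definition process_input ::
    "('m::finite \<Rightarrow> real^'n) \<Rightarrow> real^'n \<Rightarrow> 'm \<times> 'n + 'n \<Rightarrow> real" where
  "process_input a x0 = (\<lambda>v. case v of Inl (i, j) \<Rightarrow> a i $ j | Inr j \<Rightarrow> x0 $ j)"

definition process_center ::
    "('m::finite, 'n::finite) process_prog \<Rightarrow> ('m \<Rightarrow> real^'n) \<Rightarrow> real^'n \<Rightarrow> real^'n" where
  "process_center T a x0 = (\<chi> j. prog_result T (process_input a x0) (Inl j))"

definition process_shape ::
    "('m::finite, 'n::finite) process_prog \<Rightarrow> ('m \<Rightarrow> real^'n) \<Rightarrow> real^'n \<Rightarrow> real^'n^'n" where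
  "process_shape T a x0 = (\<chi> i j. prog_result T (process_input a x0) (Inr (i, j)))"

text \<open>On input \<open>(a, x0)\<close> the program \<open>T\<close> carries out steps \<open>0, \<dots>, N\<close> of the inexact polarity process
  with tolerance \<open>\<epsilon>\<close>, its oracle being the solver \<open>S\<close>, and returns the ellipsoid produced by step \<open>N\<close>,
  which is \<open>\<gamma>\<close>-maximal; this takes at most \<open>t\<close> operations, those of the solver included.\<close>

definition runs_polarity_process ::
    "('m::finite, 'n::finite) process_prog \<Rightarrow> ('m, 'n) solver \<Rightarrow>
     ('m \<Rightarrow> real^'n) \<Rightarrow> real^'n \<Rightarrow> real \<Rightarrow> nat \<Rightarrow> real \<Rightarrow> real \<Rightarrow> bool" where
  "runs_polarity_process T S a x0 \<epsilon> N \<gamma> t \<longleftrightarrow>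
     (\<exists>xs Qs. inexact_polarity_run a x0 \<epsilon> N xs Qs \<and>
              (\<forall>k\<le>N. Qs k = solver_point S a (xs k)) \<and>
              process_center T a x0 = xs (N + 1) \<and>
              process_shape T a x0 = new_shape (Qs N)) \<and>
     gamma_maximal a \<gamma> (process_center T a x0) (process_shape T a x0) \<and>
     real (op_count T (process_input a x0)) \<le> t"

end

theory Submission
  imports Defs
begin

text \<open>
  Write \<open>d\<close> for the distance of an approximate lifted solution to the exact one. Since every feasible
  matrix has trace at most \<open>m / \<lambda>\<^sub>0\<close>, the objective \<open>- log det\<close> is strongly convex on the feasible set
  with modulus \<open>(\<lambda>\<^sub>0 / m)\<^sup>2\<close>, whence \<open>d \<le> (m / \<lambda>\<^sub>0) sqrt (2 \<epsilon>)\<close>; the five terms in the definition of \<open>\<epsilon>\<close>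
  turn this into the bounds on \<open>d\<close> used below. A step then contracts \<open>\<delta>\<^sub>v\<close> by \<open>q\<^sub>0\<close> up to the additive error
  \<open>L\<^sub>0 Lctr d \<le> (1 - q\<^sub>0) min 1 (log (1/\<gamma>) / 4)\<close>, so the iterates stay in the level set and
  \<open>\<delta>\<^sub>v(x\<^sub>N) \<le> 3/4 log (1/\<gamma>)\<close>.

  The volume is controlled by two facts. The lifted optimum is the minimal ellipsoid around the polar
  body in disguise, which gives \<open>log Vol(\<E>(\<K>(x), E(x))) \<ge> - v(x)\<close>; and polarity at the centre of the
  maximal inscribed ellipsoid gives \<open>v(x\<^sup>*) \<le> - log Vol(MaxIE(P))\<close>. Hence the exact step loses at most
  \<open>\<delta>\<^sub>v(x\<^sub>N)\<close> in log-volume, and the inexact one a further \<open>Lvol d \<le> log (1/\<gamma>) / 4\<close>.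

  Outside the solver calls, a step costs \<open>O(m n\<^sup>2)\<close> operations and the one matrix inversion needed for the
  final shape costs \<open>O(n\<^sup>3)\<close>; both rates dominate \<open>m n\<^sup>2 / 2\<close> because \<open>m \<ge> n + 1\<close>.
\<close>

section \<open>Symmetric matrices\<close>

text \<open>\<open>lifted_opt\<close>, \<open>MinCE\<close> and \<open>MaxIE\<close> are definite
  descriptions and carry no information until existence and uniqueness are proved; much of the
  matrix analysis serves this purpose. Positive definiteness is an open condition, so existence is
  obtained by optimizing over a factor of the matrix, where the constraints cut out a compact set.
  Uniqueness of the lifted optimum is its stability estimate at zero gap. \<open>MinCE\<close> needs
  no optimization of its own: an ellipsoid covering the polar body and a number \<open>b\<close>
  between 0 and 1 make up a lifted matrix, whose determinant is \<open>(1 - b) b^n\<close> times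
  that of the ellipsoid. At the \<open>b\<close> of the lifted optimum both problems therefore rank
  ellipsoids alike.

  The cost claim is shaped by the machine model: computation trees have no loops, and real literals
  are free. A program must therefore be fixed before the polytope, with only the number of steps and
  the accuracy known, and be correct on every instance whose iterates stay in the interior, where
  the solver can be relied upon.\<close>

definition diag :: "('k \<Rightarrow> real) \<Rightarrow> real^'k^'k" where
  "diag d = (\<chi> i j. if i = j then d i else 0)"

section \<open>Spectral theorem for real symmetric matrices\<close>

lemma sym_dot:
  fixes A :: "real^'k^'k"
  assumes "transpose A = A" shows "x \<bullet> (A *v y) = (A *v x) \<bullet> y"
  by (metis assms dot_lmul_matrix transpose_matrix_vector)

lemma transpose_dot:
  fixes A :: "real^'k^'l"
  shows "x \<bullet> (A *v y) = (transpose A *v x) \<bullet> y"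
  by (metis dot_lmul_matrix transpose_matrix_vector)

text \<open>A maximizer \<open>v\<close> of the Rayleigh quotient on the unit sphere of
  \<open>S\<close> works: \<open>l * (x \<bullet> x) - x \<bullet> (A *v x)\<close> is nonnegative
  on \<open>S\<close> and vanishes at \<open>v\<close>, so its first-order term at \<open>v\<close>
  vanishes in every direction of \<open>S\<close>. One such direction, by invariance, is the
  residual of the eigenvalue equation itself.\<close>

lemma sym_eigenvector_in_subspace:
  fixes A :: "real^'k^'k"
  assumes sym: "transpose A = A" and S: "subspace S" and inv: "\<And>x. x \<in> S \<Longrightarrow> A *v x \<in> S"
    and nz: "S \<noteq> {0}"
  obtains v l where "v \<in> S" "norm v = 1" "A *v v = l *\<^sub>R v"
proof -
  have "0 \<in> S" using S by (rule subspace_0)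
  then obtain w where w: "w \<in> S" "w \<noteq> 0" using nz by blast
  let ?K = "S \<inter> sphere 0 1"
  have "compact ?K" using closed_subspace[OF S] by (intro closed_Int_compact) auto
  moreover have "(1 / norm w) *\<^sub>R w \<in> ?K" using w S by (auto simp: subspace_def)
  moreover have "continuous_on ?K (\<lambda>x. x \<bullet> (A *v x))" by (intro continuous_intros)
  ultimately obtain v where v: "v \<in> ?K" and max: "\<And>y. y \<in> ?K \<Longrightarrow> y \<bullet> (A *v y) \<le> v \<bullet> (A *v v)"
    using continuous_attains_sup[of ?K "\<lambda>x. x \<bullet> (A *v x)"] by blast
  define l where "l = v \<bullet> (A *v v)"
  have vv: "v \<bullet> v = 1" using v by (auto simp: norm_eq_1)
  have g: "0 \<le> l * (x \<bullet> x) - x \<bullet> (A *v x)" if "x \<in> S" for x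
  proof (cases "x = 0")
    case False
    have "(1 / norm x) *\<^sub>R x \<in> ?K" using False that S by (auto simp: subspace_def)
    from max[OF this] have "(1 / norm x)^2 * (x \<bullet> (A *v x)) \<le> l"
      by (simp add: l_def matrix_vector_mult_scaleR power2_eq_square)
    then show ?thesis using False
      by (simp add: field_simps power2_norm_eq_inner[symmetric])
  qed auto
  have orth: "l * (v \<bullet> w) - w \<bullet> (A *v v) = 0" if "w \<in> S" for w
  proof (rule ccontr)
    define b where "b = l * (v \<bullet> w) - w \<bullet> (A *v v)"
    define c where "c = l * (w \<bullet> w) - w \<bullet> (A *v w)"
    assume "l * (v \<bullet> w) - w \<bullet> (A *v v) \<noteq> 0" then have b: "b \<noteq> 0" by (simp add: b_def)
    have q: "0 \<le> t^2 * c + 2 * t * b" for t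
    proof -
      have "v + t *\<^sub>R w \<in> S" using v that S by (auto simp: subspace_def)
      from g[OF this] have "0 \<le> (l * (v\<bullet>v) - v \<bullet> (A *v v)) + t^2 * c + 2 * t * b"
        using sym_dot[OF sym, of v w]
        by (simp add: b_def c_def algebra_simps matrix_vector_right_distrib matrix_vector_mult_scaleR
          inner_commute power2_eq_square)
      then show ?thesis using vv by (simp add: l_def)
    qed
    have c0: "0 \<le> c" using g[OF that] by (simp add: c_def)
    \<comment> \<open>A nonnegative parabola through the origin has slope zero there. It is tested
      at \<open>- t\<close>; the \<open>+ 1\<close> covers the case \<open>c = 0\<close>.\<close>
    define t where "t = b / (c + 1)"
    have t: "b = t * (c + 1)" "t \<noteq> 0" using b c0 by (auto simp: t_def)
    have "0 \<le> (- t)^2 * c + 2 * (- t) * b" by (rule q)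
    also have "\<dots> = - (t^2 * (c + 2))" by (simp add: t(1) algebra_simps power2_eq_square)
    also have "\<dots> < 0" using t(2) c0 by (simp add: zero_less_mult_iff)
    finally show False by simp
  qed
  have "l *\<^sub>R v - A *v v \<in> S" using v inv S by (auto simp: subspace_def subspace_diff)
  from orth[OF this] have "(l *\<^sub>R v - A *v v) \<bullet> (l *\<^sub>R v - A *v v) = 0"
    by (simp add: algebra_simps inner_commute)
  then have "A *v v = l *\<^sub>R v" by simp
  then show thesis using that v by auto
qed

text \<open>By symmetry the orthogonal complement in \<open>S\<close> of an eigenvector is again
  invariant. Invariant subspaces instead of the whole space are what the induction on the dimension
  needs.\<close>

lemma sym_orthonormal_eigenbasis:
  fixes A :: "real^'k^'k"
  assumes sym: "transpose A = A" and S: "subspace S" and inv: "\<And>x. x \<in> S \<Longrightarrow> A *v x \<in> S"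
  shows "\<exists>B. B \<subseteq> S \<and> pairwise orthogonal B \<and> (\<forall>b\<in>B. norm b = 1 \<and> (\<exists>l. A *v b = l *\<^sub>R b)) \<and> span B = S"
  using S inv
proof (induction "dim S" arbitrary: S rule: less_induct)
  case less
  show ?case
  proof (cases "S = {0}")
    case True
    then show ?thesis by (intro exI[of _ "{}"]) auto
  next
    case False
    obtain v l where v: "v \<in> S" "norm v = 1" "A *v v = l *\<^sub>R v"
      using sym_eigenvector_in_subspace[OF sym less.prems(1) less.prems(2) False] by metis
    have vv: "v \<bullet> v = 1" using v by (simp add: norm_eq_1)
    define S' where "S' = {x \<in> S. v \<bullet> x = 0}"
    have sub': "subspace S'" using less.prems(1) unfolding S'_def
      by (auto simp: subspace_def inner_right_distrib)
    have inv': "A *v x \<in> S'" if "x \<in> S'" for x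
      using that less.prems(2) v(3) sym_dot[OF sym, of v x] by (auto simp: S'_def)
    have "v \<notin> S'" "S' \<subseteq> S" using vv by (auto simp: S'_def)
    then have "S' \<subset> S" using v by blast
    then have "dim S' < dim S"
      using less.prems(1) sub' by (intro dim_psubset) (simp add: span_eq_iff[THEN iffD2])
    from less.hyps[OF this sub' inv'] obtain B where B: "B \<subseteq> S'" "pairwise orthogonal B"
      "\<forall>b\<in>B. norm b = 1 \<and> (\<exists>l. A *v b = l *\<^sub>R b)" "span B = S'" by blast
    have "pairwise orthogonal (insert v B)" using B(1,2)
      by (auto simp: pairwise_insert S'_def orthogonal_def inner_commute)
    moreover have "span (insert v B) = S"
    proof
      show "span (insert v B) \<subseteq> S"
        using B(1) v(1) less.prems(1) by (intro span_minimal) (auto simp: S'_def)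
      show "S \<subseteq> span (insert v B)"
      proof
        fix x assume x: "x \<in> S"
        have "x - (v \<bullet> x) *\<^sub>R v \<in> S'" using x v(1) less.prems(1) vv
          by (auto simp: S'_def subspace_diff subspace_mul inner_diff_right)
        then have "x - (v \<bullet> x) *\<^sub>R v \<in> span B" using B(4) by simp
        then show "x \<in> span (insert v B)" by (auto simp: span_insert)
      qed
    qed
    ultimately show ?thesis using B v
      by (intro exI[of _ "insert v B"]) (auto simp: S'_def)
  qed
qed

lemma diag_mult_vec: "diag d *v x = (\<chi> i. d i * x $ i)"
  by (simp add: diag_def matrix_vector_mult_def vec_eq_iff if_distrib[where f="\<lambda>y. y * _"] cong: if_cong)

lemma transpose_diag [simp]: "transpose (diag d) = diag d"
  by (auto simp: diag_def transpose_def vec_eq_iff)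

lemma det_diag [simp]: "det (diag d) = (\<Prod>i\<in>UNIV. d i)"
  by (subst det_diagonal) (auto simp: diag_def)

lemma diag_mult_diag: "diag d ** diag e = diag (\<lambda>i. d i * e i)"
  by (simp add: matrix_eq matrix_vector_mul_assoc[symmetric] diag_mult_vec vec_eq_iff mult.assoc)

lemma diag_1 [simp]: "diag (\<lambda>_. 1) = mat 1"
  by (simp add: matrix_eq diag_mult_vec vec_eq_iff)

theorem spectral_decomposition:
  fixes A :: "real^'k^'k"
  assumes sym: "transpose A = A"
  obtains U :: "real^'k^'k" and d where "transpose U ** U = mat 1" "U ** transpose U = mat 1"
    "A = U ** diag d ** transpose U"
proof -
  obtain B where B: "pairwise orthogonal B" "\<forall>b\<in>B. norm b = 1 \<and> (\<exists>l. A *v b = l *\<^sub>R b)"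
    "span B = UNIV"
    using sym_orthonormal_eigenbasis[OF sym subspace_UNIV] by auto
  have ind: "independent B"
    using B by (intro pairwise_orthogonal_independent) auto
  then have fin: "finite B" by (rule independent_imp_finite)
  have "card B = CARD('k)"
    using B(3) ind by (metis dim_UNIV dim_span dim_eq_card_independent DIM_cart DIM_real mult.right_neutral)
  then obtain f where f: "bij_betw f (UNIV :: 'k set) B"
    using fin by (metis finite_same_card_bij finite_class.finite_UNIV)
  have fB: "f i \<in> B" for i using f by (auto simp: bij_betw_def)
  have inj: "f i = f j \<longleftrightarrow> i = j" for i j using f by (auto simp: bij_betw_def inj_on_def)
  have "\<exists>d. \<forall>i. A *v f i = d i *\<^sub>R f i" using B(2) fB by (intro choice) blast
  then obtain d where d: "\<And>i. A *v f i = d i *\<^sub>R f i" by blast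
  define U where "U = (\<chi> i j. f j $ i)"
  have dot: "f i \<bullet> f j = (if i = j then 1 else 0)" for i j
  proof (cases "i = j")
    case True
    then show ?thesis using B(2) fB[of i] by (simp add: norm_eq_1)
  next
    case False
    then show ?thesis using B(1) fB[of i] fB[of j] inj[of i j] by (simp add: pairwise_def orthogonal_def)
  qed
  have U1: "transpose U ** U = mat 1"
    using dot by (simp add: U_def matrix_matrix_mult_def transpose_def mat_def vec_eq_iff inner_vec_def)
  then have U2: "U ** transpose U = mat 1" by (simp add: matrix_left_right_inverse)
  have "A ** U = U ** diag d"
  proof -
    have "(A ** U) $ i $ j = (U ** diag d) $ i $ j" for i j
    proof -
      have "(A ** U) $ i $ j = (A *v f j) $ i"
        by (simp add: matrix_matrix_mult_def matrix_vector_mult_def U_def)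
      also have "\<dots> = d j * f j $ i" by (simp add: d)
      also have "\<dots> = (U ** diag d) $ i $ j"
        by (simp add: matrix_matrix_mult_def U_def diag_def if_distrib[where f="\<lambda>y. _ * y"] mult.commute cong: if_cong)
      finally show ?thesis .
    qed
    then show ?thesis by (simp add: vec_eq_iff)
  qed
  then have "A ** (U ** transpose U) = U ** diag d ** transpose U"
    by (simp add: matrix_mul_assoc)
  then have "A = U ** diag d ** transpose U" using U2 by simp
  show thesis by (rule that) fact+
qed

declare transpose_matrix_vector [simp del]

lemmas scaleR_mult_vec = scaleR_matrix_vector_assoc[symmetric]

section \<open>Positive definite matrices up to congruence\<close>

lemma prod_strict_mono_ex1:
  fixes f g :: "'a \<Rightarrow> real"
  assumes "finite A" "\<And>i. i \<in> A \<Longrightarrow> 0 < f i" "\<And>i. i \<in> A \<Longrightarrow> f i \<le> g i" "\<exists>i\<in>A. f i < g i"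
  shows "prod f A < prod g A"
proof -
  obtain i where i: "i \<in> A" "f i < g i" using assms by blast
  have "prod f A = f i * prod f (A - {i})" using assms i by (simp add: prod.remove)
  also have "\<dots> < g i * prod f (A - {i})" using assms i by (intro mult_strict_right_mono prod_pos) auto
  also have "\<dots> \<le> g i * prod g (A - {i})"
  proof (intro mult_left_mono prod_mono conjI)
    show "0 \<le> g i" using assms(2)[OF i(1)] i(2) by linarith
    show "0 \<le> f j" if "j \<in> A - {i}" for j using assms(2)[of j] that by simp
    show "f j \<le> g j" if "j \<in> A - {i}" for j using assms(3)[of j] that by simp
  qed
  also have "\<dots> = prod g A" using assms i by (simp add: prod.remove)
  finally show ?thesis .
qed

text \<open>\<open>matrix_inv\<close> is a choice among two-sided inverses; for square matrices a
  one-sided inverse already pins it down. Later inverses, those of the elimination procedure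
  included, are identified this way.\<close>

lemma matrix_inv_unique:
  fixes A B :: "real^'k^'k"
  assumes "A ** B = mat 1" shows "matrix_inv A = B"
proof -
  have BA: "B ** A = mat 1" using assms by (simp add: matrix_left_right_inverse)
  then have "\<exists>C. A ** C = mat 1 \<and> C ** A = mat 1" using assms by blast
  then have "A ** matrix_inv A = mat 1" unfolding matrix_inv_def by (rule someI2_ex) blast
  then have "B ** A ** matrix_inv A = B" by (simp add: matrix_mul_assoc[symmetric])
  then show ?thesis using BA by simp
qed

lemma invertible_matrix_inv:
  fixes A :: "real^'k^'k"
  assumes "invertible A"
  shows "A ** matrix_inv A = mat 1" "matrix_inv A ** A = mat 1"
  using assms unfolding invertible_def by (metis matrix_inv_unique)+

lemma quad_mult_transpose:
  fixes M :: "real^'l^'k"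
  shows "v \<bullet> ((M ** transpose M) *v v) = (transpose M *v v) \<bullet> (transpose M *v v)"
  by (metis matrix_vector_mul_assoc transpose_dot)

lemma quad_congruence:
  fixes M :: "real^'l^'k"
  shows "v \<bullet> ((M ** D ** transpose M) *v v) = (transpose M *v v) \<bullet> (D *v (transpose M *v v))"
  by (metis matrix_vector_mul_assoc transpose_dot)

lemma transpose_congruence:
  fixes M :: "real^'l^'k"
  shows "transpose (M ** D ** transpose M) = M ** transpose D ** transpose M"
  by (simp add: matrix_transpose_mul matrix_mul_assoc)

lemma invertible_transpose_mult_nonzero:
  fixes M :: "real^'k^'k"
  assumes "invertible M" "v \<noteq> 0" shows "transpose M *v v \<noteq> 0"
  using assms by (metis inj_matrix_vector_mult injD matrix_vector_mult_0_right transpose_invertible)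

lemma posdef_congruence_diag:
  fixes M :: "real^'k^'k"
  assumes "invertible M" "\<And>i. 0 < d i"
  shows "posdef (M ** diag d ** transpose M)"
  unfolding posdef_def
proof (intro conjI allI impI)
  show "transpose (M ** diag d ** transpose M) = M ** diag d ** transpose M"
    by (simp add: transpose_congruence)
  fix v :: "real^'k" assume "v \<noteq> 0"
  define w where "w = transpose M *v v"
  have "w \<noteq> 0" using invertible_transpose_mult_nonzero[OF assms(1) \<open>v \<noteq> 0\<close>] by (simp add: w_def)
  then obtain i where i: "w $ i \<noteq> 0" by (auto simp: vec_eq_iff)
  have "0 < (\<Sum>i\<in>UNIV. w $ i * (d i * w $ i))"
  proof (rule sum_pos2)
    show "0 < w $ i * (d i * w $ i)" using i assms(2)[of i]
      by (metis mult.commute mult.left_commute mult_pos_pos not_real_square_gt_zero)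
    show "0 \<le> w $ j * (d j * w $ j)" for j using assms(2)[of j]
      by (metis less_imp_le mult.left_commute mult_nonneg_nonneg zero_le_square)
  qed auto
  then show "0 < v \<bullet> ((M ** diag d ** transpose M) *v v)"
    unfolding quad_congruence w_def[symmetric] diag_mult_vec by (simp add: inner_vec_def)
qed

lemma posdef_mult_transpose:
  fixes M :: "real^'k^'k"
  assumes "invertible M" shows "posdef (M ** transpose M)"
  using posdef_congruence_diag[OF assms, of "\<lambda>_. 1"] by simp

lemma posdef_factor:
  fixes A :: "real^'k^'k"
  assumes "posdef A"
  obtains M :: "real^'k^'k" where "invertible M" "A = M ** transpose M"
proof -
  have "transpose A = A" using assms by (simp add: posdef_def)
  from spectral_decomposition[OF this] obtain U :: "real^'k^'k" and d
    where U: "transpose U ** U = mat 1" "U ** transpose U = mat 1"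
      "A = U ** diag d ** transpose U" .
  have d: "0 < d i" for i
  proof -
    define v where "v = U *v axis i 1"
    have w: "transpose U *v v = axis i 1" by (simp add: v_def matrix_vector_mul_assoc U)
    then have "v \<noteq> 0" by (metis axis_eq_0_iff matrix_vector_mult_0_right zero_neq_one)
    then have "0 < v \<bullet> (A *v v)" using assms by (simp add: posdef_def)
    then show ?thesis by (simp add: U(3) quad_congruence w diag_mult_vec inner_axis')
  qed
  define M where "M = U ** diag (\<lambda>i. sqrt (d i))"
  have "M ** (diag (\<lambda>i. 1 / sqrt (d i)) ** transpose U) = U ** (diag (\<lambda>i. sqrt (d i)) ** diag (\<lambda>i. 1 / sqrt (d i))) ** transpose U"
    by (simp add: M_def matrix_mul_assoc)
  also have "\<dots> = mat 1" using d by (simp add: diag_mult_diag U less_imp_neq[symmetric])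
  finally have "invertible M" unfolding invertible_right_inverse by blast
  moreover have "M ** transpose M = U ** (diag (\<lambda>i. sqrt (d i)) ** diag (\<lambda>i. sqrt (d i))) ** transpose U"
    by (simp add: M_def matrix_transpose_mul matrix_mul_assoc)
  then have "A = M ** transpose M" using d by (simp add: diag_mult_diag U(3) less_imp_le)
  ultimately show thesis by (rule that)
qed

text \<open>Whitening by a factor of \<open>A\<close> reduces the pair to the identity and a
  symmetric matrix; the eigenbasis of the latter is orthogonal and so leaves the identity alone.
  Comparing \<open>B\<close> with \<open>A\<close> becomes comparing the numbers \<open>d i\<close>
  with 1.\<close>

lemma simultaneous_diagonalization:
  fixes A B :: "real^'k^'k"
  assumes "posdef A" "transpose B = B"
  obtains M :: "real^'k^'k" and d where "invertible M" "A = M ** transpose M" "B = M ** diag d ** transpose M"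
proof -
  obtain L :: "real^'k^'k" where L: "invertible L" "A = L ** transpose L" using posdef_factor[OF assms(1)] .
  define N where "N = matrix_inv L"
  have LN: "L ** N = mat 1" "N ** L = mat 1" using invertible_matrix_inv[OF L(1)] by (auto simp: N_def)
  have LN': "transpose N ** transpose L = mat 1"
    unfolding matrix_transpose_mul[symmetric] LN by (rule transpose_mat)
  have "transpose (N ** B ** transpose N) = N ** B ** transpose N"
    by (simp add: transpose_congruence assms)
  from spectral_decomposition[OF this] obtain V :: "real^'k^'k" and d
    where V: "transpose V ** V = mat 1" "V ** transpose V = mat 1"
      "N ** B ** transpose N = V ** diag d ** transpose V" .
  have "invertible V" using V invertible_def by blast
  then have "invertible (L ** V)" using L by (intro invertible_mult)
  moreover have "(L ** V) ** transpose (L ** V) = L ** (V ** transpose V) ** transpose L"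
    by (simp add: matrix_transpose_mul matrix_mul_assoc)
  then have "A = (L ** V) ** transpose (L ** V)" by (simp add: V L(2))
  moreover have "(L ** V) ** diag d ** transpose (L ** V) = L ** (V ** diag d ** transpose V) ** transpose L"
    by (simp add: matrix_transpose_mul matrix_mul_assoc)
  then have "(L ** V) ** diag d ** transpose (L ** V) = (L ** N) ** B ** (transpose N ** transpose L)"
    by (simp only: V(3)[symmetric] matrix_mul_assoc)
  then have "B = (L ** V) ** diag d ** transpose (L ** V)" by (simp add: LN LN')
  ultimately show thesis by (rule that)
qed

lemma invertible_transpose_surj:
  fixes M :: "real^'k^'k"
  assumes "invertible M" obtains v :: "real^'k" where "transpose M *v v = w"
  using assms by (metis invertible_matrix_inv(1) matrix_vector_mul_assoc matrix_vector_mul_lid transpose_invertible)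

lemma posdef_congruence_diag_iff:
  fixes M :: "real^'k^'k"
  assumes "invertible M" "posdef (M ** diag d ** transpose M)" shows "0 < d i"
proof -
  obtain v where v: "transpose M *v v = axis i 1" using invertible_transpose_surj[OF assms(1)] .
  then have "v \<noteq> 0" by (metis axis_eq_0_iff matrix_vector_mult_0_right zero_neq_one)
  then have "0 < v \<bullet> ((M ** diag d ** transpose M) *v v)" using assms by (simp add: posdef_def)
  then show ?thesis by (simp add: quad_congruence v diag_mult_vec inner_axis')
qed

lemma posdef_invertible: "posdef A \<Longrightarrow> invertible (A :: real^'k^'k)"
  by (metis invertible_mult posdef_factor transpose_invertible)

lemma posdef_sym: "posdef A \<Longrightarrow> transpose A = A" by (simp add: posdef_def)

lemma posdef_det_pos:
  fixes A :: "real^'k^'k" assumes "posdef A" shows "0 < det A"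
proof -
  obtain M :: "real^'k^'k" where M: "invertible M" "A = M ** transpose M" using posdef_factor[OF assms] .
  then have "det A = det M ^ 2" "det M \<noteq> 0" by (auto simp: det_mul power2_eq_square invertible_det_nz)
  then show ?thesis by simp
qed

lemma posdef_matrix_inv:
  fixes A :: "real^'k^'k" assumes "posdef A"
  shows "posdef (matrix_inv A)" "A ** matrix_inv A = mat 1" "matrix_inv A ** A = mat 1"
    "det (matrix_inv A) = 1 / det A"
proof -
  show 1: "A ** matrix_inv A = mat 1" "matrix_inv A ** A = mat 1"
    using invertible_matrix_inv[OF posdef_invertible[OF assms]] by auto
  have "det A * det (matrix_inv A) = 1" by (metis 1(1) det_I det_mul)
  then show "det (matrix_inv A) = 1 / det A" using posdef_det_pos[OF assms] by (simp add: field_simps)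
  have "A ** transpose (matrix_inv A) = mat 1"
  proof -
    have "A ** transpose (matrix_inv A) = transpose (matrix_inv A ** A)"
      by (simp add: matrix_transpose_mul posdef_sym[OF assms])
    then show ?thesis by (simp add: 1)
  qed
  then have sym: "transpose (matrix_inv A) = matrix_inv A" by (metis matrix_inv_unique)
  have "0 < x \<bullet> (matrix_inv A *v x)" if "x \<noteq> 0" for x
  proof -
    define y where "y = matrix_inv A *v x"
    have x: "x = A *v y" by (simp add: y_def matrix_vector_mul_assoc 1)
    then have "y \<noteq> 0" using that by auto
    then have "0 < y \<bullet> (A *v y)" using assms by (simp add: posdef_def)
    then show ?thesis by (metis x y_def inner_commute)
  qed
  then show "posdef (matrix_inv A)" using sym by (simp add: posdef_def)
qed

text \<open>In a common congruence frame \<open>X\<close> is the identity, and the order of the two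
  forms says that every \<open>d i\<close> is at least 1; the determinants differ by the product of
  the \<open>d i\<close>.\<close>

lemma det_mono_posdef:
  fixes X Y :: "real^'k^'k"
  assumes X: "posdef X" and Y: "transpose Y = Y" and le: "\<And>v. v \<bullet> (X *v v) \<le> v \<bullet> (Y *v v)"
  shows "det X \<le> det Y" "X \<noteq> Y \<Longrightarrow> det X < det Y"
proof -
  obtain M :: "real^'k^'k" and d where M: "invertible M" "X = M ** transpose M" "Y = M ** diag d ** transpose M"
    using simultaneous_diagonalization[OF X Y] .
  have d: "1 \<le> d i" for i
  proof -
    obtain v where v: "transpose M *v v = axis i 1" using invertible_transpose_surj[OF M(1)] .
    show ?thesis using le[of v]
      by (simp add: M(2,3) quad_congruence quad_mult_transpose v diag_mult_vec inner_axis')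
  qed
  have det: "det X = det M ^ 2 * (\<Prod>i\<in>(UNIV::'k set). 1)" "det Y = det M ^ 2 * (\<Prod>i\<in>UNIV. d i)" "0 < det M ^ 2"
    using M by (auto simp: det_mul power2_eq_square[of "det M"] invertible_det_nz zero_less_mult_iff)
  have "(1::real) = (\<Prod>i\<in>(UNIV::'k set). 1)" by simp
  also have "\<dots> \<le> (\<Prod>i\<in>UNIV. d i)" using d by (intro prod_mono) auto
  finally show "det X \<le> det Y" using det by simp
  assume "X \<noteq> Y"
  then have "\<exists>i. d i \<noteq> 1" using M diag_1 by (metis ext matrix_mul_rid)
  then have "(\<Prod>i\<in>(UNIV::'k set). 1) < (\<Prod>i\<in>UNIV. d i)" using d
    by (intro prod_strict_mono_ex1) (auto simp: order_less_le)
  then show "det X < det Y" using det by simp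
qed

section \<open>Frobenius norms under multiplication and congruence\<close>

lemma norm_matrix_sq:
  fixes X :: "real^'l^'k" shows "(norm X)^2 = (\<Sum>i\<in>UNIV. \<Sum>j\<in>UNIV. (X$i$j)^2)"
  unfolding power2_norm_eq_inner by (simp add: inner_vec_def power2_eq_square)

lemma norm_transpose:
  fixes X :: "real^'l^'k" shows "norm (transpose X) = norm X"
proof -
  have "(norm (transpose X))^2 = (norm X)^2"
    unfolding norm_matrix_sq by (subst sum.swap) (simp add: transpose_def)
  then show ?thesis by simp
qed

lemma norm_matrix_mult_le:
  fixes N :: "real^'k^'k" and X :: "real^'l^'k"
  assumes N: "\<And>v. (norm (N *v v))^2 \<le> R * (norm v)^2"
  shows "(norm (N ** X))^2 \<le> R * (norm X)^2"
proof -
  have sq: "(norm Y)^2 = (\<Sum>j\<in>UNIV. (norm (column j Y))^2)" for Y :: "real^'l^'k"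
  proof -
    have "(norm (column j Y))^2 = (\<Sum>i\<in>UNIV. (Y$i$j)^2)" for j
      unfolding power2_norm_eq_inner by (simp add: inner_vec_def column_def power2_eq_square)
    then show ?thesis unfolding norm_matrix_sq by (subst sum.swap) simp
  qed
  have "(norm (N ** X))^2 = (\<Sum>j\<in>UNIV. (norm (N *v column j X))^2)"
    unfolding sq by (simp add: matrix_matrix_mult_def matrix_vector_mult_def column_def)
  also have "\<dots> \<le> (\<Sum>j\<in>UNIV. R * (norm (column j X))^2)" by (intro sum_mono N)
  also have "\<dots> = R * (norm X)^2" by (simp add: sq sum_distrib_left)
  finally show ?thesis .
qed

text \<open>A matrix and its transpose have the same operator norm: with \<open>w = N *v v\<close>,
  write \<open>(norm w)^2\<close> as \<open>(transpose N *v w) \<bullet> v\<close>, apply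
  Cauchy--Schwarz and cancel one factor \<open>(norm w)^2\<close>.\<close>

lemma norm_mult_vec_le:
  fixes N :: "real^'l^'k"
  assumes "\<And>v. (norm (transpose N *v v))^2 \<le> R * (norm v)^2"
  shows "(norm (N *v v))^2 \<le> R * (norm v)^2"
proof (cases "N *v v = 0")
  case True
  have "0 \<le> R * (norm (axis undefined 1 :: real^'k))^2"
    using order_trans[OF zero_le_power2 assms[of "axis undefined 1"]] .
  then show ?thesis using True by simp
next
  case False
  define w where "w = N *v v"
  have "(norm w)^2 = (transpose N *v w) \<bullet> v"
    by (simp add: power2_norm_eq_inner w_def transpose_dot)
  also have "\<dots> \<le> norm (transpose N *v w) * norm v" by (rule norm_cauchy_schwarz)
  finally have "((norm w)^2)^2 \<le> (norm (transpose N *v w) * norm v)^2" by (intro power_mono) auto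
  also have "\<dots> \<le> (R * (norm w)^2) * (norm v)^2"
    unfolding power_mult_distrib by (intro mult_right_mono assms) auto
  finally have "(norm w)^2 * (norm w)^2 \<le> (norm w)^2 * (R * (norm v)^2)"
    by (simp only: power2_eq_square mult_ac)
  moreover have "0 < (norm w)^2" using False by (simp add: w_def)
  ultimately show ?thesis unfolding w_def by (rule mult_left_le_imp_le)
qed

text \<open>\<open>R\<close> bounds the largest eigenvalue of \<open>N ** transpose N\<close>, so
  multiplication by \<open>N\<close> on one side inflates the squared Frobenius norm by at most
  \<open>R\<close>. Symmetry of \<open>F\<close> lets the factor on the right be moved to the left
  by a transposition.\<close>

lemma norm_congruence_le:
  fixes N :: "real^'k^'k"
  assumes N: "\<And>v. v \<bullet> ((N ** transpose N) *v v) \<le> R * (v \<bullet> v)" and sym: "transpose F = F"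
  shows "(norm (N ** F ** transpose N))^2 \<le> R^2 * (norm F)^2"
proof -
  have N1: "(norm (N *v v))^2 \<le> R * (norm v)^2" for v
    by (rule norm_mult_vec_le) (use N in \<open>simp add: power2_norm_eq_inner quad_mult_transpose\<close>)
  \<comment> \<open>Nonnegativity of \<open>R\<close> is read off from the bound at a unit
    vector.\<close>
  have "0 \<le> R * (norm (axis undefined 1 :: real^'k))^2"
    using order_trans[OF zero_le_power2 N1[of "axis undefined 1"]] .
  then have R: "0 \<le> R" by simp
  have "(norm (N ** F ** transpose N))^2 = (norm (N ** (F ** transpose N)))^2"
    by (simp add: matrix_mul_assoc)
  also have "\<dots> \<le> R * (norm (F ** transpose N))^2" by (rule norm_matrix_mult_le[OF N1])
  also have "norm (F ** transpose N) = norm (N ** F)"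
    by (metis matrix_transpose_mul norm_transpose sym transpose_transpose)
  also have "R * (norm (N ** F))^2 \<le> R * (R * (norm F)^2)"
    by (intro mult_left_mono norm_matrix_mult_le[OF N1] R)
  finally show ?thesis by (simp add: power2_eq_square mult.assoc)
qed

lemma norm_diag_sq: "(norm (diag f))^2 = (\<Sum>i\<in>UNIV. (f i)^2)"
  by (simp add: norm_matrix_sq diag_def if_distrib[where f="\<lambda>x. x^2"] cong: if_cong)

section \<open>Strong convexity of the negative log-determinant\<close>

lemma congruence_affine:
  fixes M :: "real^'k^'k"
  shows "M ** (X + c *\<^sub>R (Y - X)) ** transpose M
    = M ** X ** transpose M + c *\<^sub>R (M ** Y ** transpose M - M ** X ** transpose M)"
  by (simp add: matrix_eq matrix_vector_mul_assoc[symmetric] matrix_vector_right_distrib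
    matrix_vector_mult_diff_distrib matrix_vector_mult_add_rdistrib matrix_vector_mult_diff_rdistrib
    scaleR_mult_vec matrix_vector_mult_scaleR)

text \<open>In a frame diagonalizing both matrices, \<open>ln det\<close> along the segment is a
  constant plus the sum \<open>p t\<close> of the \<open>ln (1 + t * e i)\<close>. Minus its second
  derivative is the squared Frobenius norm of the whitened difference \<open>B - A\<close>; undoing
  the whitening costs at most \<open>R^2\<close>, because every matrix on the segment is bounded by
  \<open>R\<close>. Maximality at \<open>t = 0\<close> leaves no positive first-order term, so the
  determinant gap is at least quadratic.\<close>

lemma logdet_strong_convexity:
  fixes A B :: "real^'k^'k"
  assumes A: "posdef A" and B: "posdef B" and R: "0 < R"
    and AR: "\<And>v. v \<bullet> (A *v v) \<le> R * (v \<bullet> v)" and BR: "\<And>v. v \<bullet> (B *v v) \<le> R * (v \<bullet> v)"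
    and opt: "\<And>t. 0 \<le> t \<Longrightarrow> t \<le> 1 \<Longrightarrow> det (A + t *\<^sub>R (B - A)) \<le> det A"
  shows "(norm (B - A))^2 / (2 * R^2) \<le> ln (det A) - ln (det B)"
proof -
  obtain M :: "real^'k^'k" and d where M: "invertible M" "A = M ** transpose M" "B = M ** diag d ** transpose M"
    using simultaneous_diagonalization[OF A posdef_sym[OF B]] .
  have dpos: "0 < d i" for i using posdef_congruence_diag_iff M B by metis
  define e where "e i = d i - 1" for i
  have pos: "0 < 1 + t * e i" if "0 \<le> t" "t \<le> 1" for t i
  proof -
    have "1 + t * e i = (1 - t) + t * d i" by (simp add: e_def algebra_simps)
    also have "\<dots> > 0" using that dpos[of i]
      by (cases "t = 1") (auto intro: add_pos_nonneg)
    finally show ?thesis .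
  qed
  have seg: "A + t *\<^sub>R (B - A) = M ** diag (\<lambda>i. 1 + t * e i) ** transpose M" for t
  proof -
    have "diag (\<lambda>i. 1 + t * e i) = mat 1 + t *\<^sub>R (diag d - mat 1)"
      by (simp add: diag_def mat_def vec_eq_iff e_def)
    then show ?thesis
      unfolding M(2,3) by (simp add: congruence_affine)
  qed
  have detM: "0 < (det M)^2" using M(1) by (simp add: invertible_det_nz)
  have dets: "det (A + t *\<^sub>R (B - A)) = (det M)^2 * (\<Prod>i\<in>UNIV. 1 + t * e i)" for t
    by (simp add: seg det_mul power2_eq_square)
  have detA: "det A = (det M)^2" using dets[of 0] by simp
  define p where "p t = (\<Sum>i\<in>UNIV. ln (1 + t * e i))" for t
  have p_le: "p t \<le> 0" if "0 \<le> t" "t \<le> 1" for t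
  proof -
    have "(\<Prod>i\<in>UNIV. 1 + t * e i) \<le> 1" using opt[OF that] detM unfolding dets detA by simp
    then have "ln (\<Prod>i\<in>UNIV. 1 + t * e i) \<le> 0" by (simp add: ln_le_zero_iff pos that prod_pos)
    then show ?thesis using pos[OF that] by (simp add: p_def ln_prod less_imp_neq[symmetric])
  qed
  define q where "q t = (\<Sum>i\<in>UNIV. e i / (1 + t * e i))" for t
  have dp: "(p has_real_derivative q t) (at t)" if "0 \<le> t" "t \<le> 1" for t
    unfolding p_def[abs_def] q_def using pos[OF that]
    by (auto intro!: derivative_eq_intros sum.cong simp: field_simps)
  have dq: "(q has_real_derivative - (\<Sum>i\<in>UNIV. (e i / (1 + t * e i))^2)) (at t)" if "0 \<le> t" "t \<le> 1" for t
    unfolding q_def[abs_def] sum_negf[symmetric] using pos[OF that]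
    by (auto intro!: derivative_eq_intros sum.cong simp: power2_eq_square less_imp_neq[symmetric])
  \<comment> \<open>A positive slope at 0 would lift the determinant above its maximum for small
    \<open>t\<close>.\<close>
  have q0: "q 0 \<le> 0"
  proof (rule ccontr)
    assume "\<not> q 0 \<le> 0"
    then obtain h where h: "0 < h" "\<And>s. 0 < s \<Longrightarrow> s < h \<Longrightarrow> p 0 < p (0 + s)"
      using DERIV_pos_inc_right[OF dp[of 0]] by auto
    then have "p 0 < p (0 + min (h/2) 1)" by (intro h(2)) auto
    then show False using p_le[of "min (h/2) 1"] h(1) by (auto simp: p_def)
  qed
  define K where "K = (norm (B - A))^2 / R^2"
  have K: "K \<le> (\<Sum>i\<in>UNIV. (e i / (1 + t * e i))^2)" if t: "0 \<le> t" "t \<le> 1" for t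
  proof -
    \<comment> \<open>A factor of the matrix at parameter \<open>t\<close>. In its frame
      \<open>B - A\<close> is diagonal with entries \<open>e i / (1 + t * e i)\<close>, the numbers
      whose squares make up the second derivative.\<close>
    define N where "N = M ** diag (\<lambda>i. sqrt (1 + t * e i))"
    have NN: "N ** D ** transpose N = M ** (diag (\<lambda>i. sqrt (1 + t * e i)) ** D ** diag (\<lambda>i. sqrt (1 + t * e i))) ** transpose M" for D
      by (simp add: N_def matrix_transpose_mul matrix_mul_assoc)
    have "N ** transpose N = A + t *\<^sub>R (B - A)"
      using NN[of "mat 1"] pos[OF t] by (simp add: seg diag_mult_diag less_imp_le)
    then have bd: "v \<bullet> ((N ** transpose N) *v v) \<le> R * (v \<bullet> v)" for v
    proof -
      have "v \<bullet> ((N ** transpose N) *v v) = (1 - t) * (v \<bullet> (A *v v)) + t * (v \<bullet> (B *v v))"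
        by (simp add: \<open>N ** transpose N = _\<close> matrix_vector_mult_add_rdistrib matrix_vector_mult_diff_rdistrib
          scaleR_mult_vec inner_add_right inner_diff_right algebra_simps)
      also have "\<dots> \<le> (1 - t) * (R * (v \<bullet> v)) + t * (R * (v \<bullet> v))"
        using t by (intro add_mono mult_left_mono AR BR) auto
      finally show ?thesis by (simp add: algebra_simps)
    qed
    have "B - A = M ** diag e ** transpose M"
    proof -
      have "diag e = 0 + 1 *\<^sub>R (diag d - mat 1)" by (simp add: diag_def mat_def vec_eq_iff e_def)
      then show ?thesis using seg[of 0]
        unfolding M(2,3) by (simp add: matrix_eq matrix_vector_mul_assoc[symmetric]
          matrix_vector_mult_diff_distrib matrix_vector_mult_diff_rdistrib)
    qed
    also have "diag e = diag (\<lambda>i. sqrt (1 + t * e i)) ** diag (\<lambda>i. e i / (1 + t * e i)) ** diag (\<lambda>i. sqrt (1 + t * e i))"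
    proof -
      have "sqrt (1 + t * e i) * (e i / (1 + t * e i)) * sqrt (1 + t * e i) = e i" for i
        using pos[OF t, of i] by (simp add: field_simps)
      then show ?thesis by (simp add: diag_mult_diag)
    qed
    also have "M ** \<dots> ** transpose M = N ** diag (\<lambda>i. e i / (1 + t * e i)) ** transpose N" by (simp add: NN)
    finally have "(norm (B - A))^2 \<le> R^2 * (norm (diag (\<lambda>i. e i / (1 + t * e i))))^2"
      using norm_congruence_le[OF bd] by simp
    then show ?thesis using R by (simp add: K_def norm_diag_sq field_simps)
  qed
  define g where "g t = q t + K * t" for t
  have g: "g t \<le> g 0" if "0 \<le> t" "t \<le> 1" for t
  proof (rule DERIV_nonpos_imp_nonincreasing[OF that(1)])
    fix s assume s: "0 \<le> s" "s \<le> t"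
    then have s1: "s \<le> 1" using that by simp
    show "\<exists>y. (g has_real_derivative y) (at s) \<and> y \<le> 0"
      unfolding g_def[abs_def] using K[OF s(1) s1]
      by (intro exI conjI) (rule derivative_eq_intros dq[OF s(1) s1] refl | simp)+
  qed
  \<comment> \<open>The second-order Taylor bound by two monotonicity arguments: the derivative of
    \<open>f\<close> is \<open>g s - g 0\<close>, and \<open>g\<close> does not increase.\<close>
  define f where "f t = p t + K * t^2 / 2 - q 0 * t" for t
  have "f 1 \<le> f 0"
  proof (rule DERIV_nonpos_imp_nonincreasing[where f=f and a=0 and b=1])
    fix s :: real assume s: "0 \<le> s" "s \<le> 1"
    have "(f has_real_derivative q s + K * s - q 0) (at s)"
      unfolding f_def[abs_def] by (rule derivative_eq_intros dp[OF s] refl | simp)+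
    moreover have "q s + K * s - q 0 \<le> 0" using g[OF s] by (simp add: g_def)
    ultimately show "\<exists>y. (f has_real_derivative y) (at s) \<and> y \<le> 0" by blast
  qed simp
  then have "p 1 + K / 2 \<le> 0" using q0 by (simp add: f_def p_def)
  moreover have "p 1 = ln (det B) - ln (det A)"
  proof -
    have "det B = (det M)^2 * (\<Prod>i\<in>UNIV. 1 + e i)" using dets[of 1] by simp
    moreover have "0 < 1 + e i" for i using dpos by (simp add: e_def)
    ultimately have "ln (det B) = ln ((det M)^2) + (\<Sum>i\<in>UNIV. ln (1 + e i))"
      using detM by (simp add: ln_mult prod_pos ln_prod less_imp_neq[symmetric] zero_less_mult_iff)
    then show ?thesis by (simp add: detA p_def)
  qed
  ultimately show ?thesis by (simp add: K_def)
qed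

text \<open>The set of eigenvalues is the range of the diagonal in a spectral decomposition, hence
  finite and nonempty, so that \<open>Min\<close> is an actual minimum.\<close>

lemma lambda_min_le:
  fixes A :: "real^'k^'k"
  assumes "transpose A = A" shows "lambda_min A * (v \<bullet> v) \<le> v \<bullet> (A *v v)"
proof -
  obtain U :: "real^'k^'k" and d where U: "transpose U ** U = mat 1" "U ** transpose U = mat 1"
    "A = U ** diag d ** transpose U"
    using spectral_decomposition[OF assms] .
  let ?E = "{l. \<exists>v. v \<noteq> 0 \<and> A *v v = l *\<^sub>R v}"
  have "?E = range d"
  proof safe
    fix l and v :: "real^'k" assume v: "v \<noteq> 0" "A *v v = l *\<^sub>R v"
    define w where "w = transpose U *v v"
    have "v = U *v w" by (simp add: w_def matrix_vector_mul_assoc U)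
    then have "w \<noteq> 0" using v by auto
    have "transpose U *v (A *v v) = diag d *v w"
      by (simp add: U(3) w_def matrix_vector_mul_assoc matrix_mul_assoc U(1))
    then have "diag d *v w = l *\<^sub>R w" by (simp add: v w_def matrix_vector_mult_scaleR)
    then have "d i * w $ i = l * w $ i" for i by (simp add: diag_mult_vec vec_eq_iff)
    moreover obtain i where "w $ i \<noteq> 0" using \<open>w \<noteq> 0\<close> by (auto simp: vec_eq_iff)
    ultimately show "l \<in> range d" by (metis mult_right_cancel rangeI)
  next
    fix i
    define v where "v = U *v axis i 1"
    have w: "transpose U *v v = axis i 1" by (simp add: v_def matrix_vector_mul_assoc U)
    then have "v \<noteq> 0" by (metis axis_eq_0_iff matrix_vector_mult_0_right zero_neq_one)
    moreover have "A *v v = U *v (diag d *v (transpose U *v v))"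
      by (simp add: U(3) matrix_vector_mul_assoc matrix_mul_assoc)
    moreover have "diag d *v axis i 1 = d i *\<^sub>R axis i 1"
      by (simp add: diag_mult_vec axis_def vec_eq_iff)
    ultimately have "v \<noteq> 0" "A *v v = d i *\<^sub>R v" unfolding w
      by (simp_all add: v_def matrix_vector_mult_scaleR)
    then show "\<exists>v. v \<noteq> 0 \<and> A *v v = d i *\<^sub>R v" by blast
  qed
  then have lm: "lambda_min A \<le> d i" for i unfolding lambda_min_def by simp
  define w where "w = transpose U *v v"
  have "v \<bullet> v = w \<bullet> w"
    using quad_mult_transpose[of v U] by (simp add: w_def U)
  then have "lambda_min A * (v \<bullet> v) = (\<Sum>i\<in>UNIV. lambda_min A * (w $ i)^2)"
    by (simp add: inner_vec_def power2_eq_square sum_distrib_left)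
  also have "\<dots> \<le> (\<Sum>i\<in>UNIV. d i * (w $ i)^2)" by (intro sum_mono mult_right_mono lm) auto
  also have "\<dots> = v \<bullet> (A *v v)"
    unfolding U(3) quad_congruence w_def[symmetric] diag_mult_vec
    by (simp add: inner_vec_def power2_eq_square mult_ac)
  finally show ?thesis .
qed

text \<open>Averaging the factors, instead of the matrices, keeps the support function of the
  corresponding ellipsoids below the average of the two support functions.\<close>

lemma factor_average_det:
  fixes S T :: "real^'k^'k"
  assumes S: "posdef S" and T: "posdef T" and ne: "S \<noteq> T" and dt: "det S = det T"
  obtains M N :: "real^'k^'k" where "S = M ** transpose M" "T = N ** transpose N"
    "invertible ((1/2) *\<^sub>R (M + N))" "det S < (det ((1/2) *\<^sub>R (M + N)))^2"
proof -
  obtain M :: "real^'k^'k" and d where M: "invertible M" "S = M ** transpose M" "T = M ** diag d ** transpose M"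
    using simultaneous_diagonalization[OF S posdef_sym[OF T]] .
  have dpos: "0 < d i" for i using posdef_congruence_diag_iff M T by metis
  have detM: "0 < (det M)^2" using M(1) by (simp add: invertible_det_nz)
  have "(\<Prod>i\<in>UNIV. d i) = 1" using dt detM unfolding M by (auto simp: det_mul power2_eq_square)
  define N where "N = M ** diag (\<lambda>i. sqrt (d i))"
  define c where "c i = (1 + sqrt (d i)) / 2" for i
  have cpos: "0 < c i" for i using dpos[of i] by (simp add: c_def add_pos_nonneg)
  have NN: "T = N ** transpose N"
  proof -
    have "N ** transpose N = M ** (diag (\<lambda>i. sqrt (d i)) ** diag (\<lambda>i. sqrt (d i))) ** transpose M"
      by (simp add: N_def matrix_transpose_mul matrix_mul_assoc)
    then show ?thesis using dpos by (simp add: diag_mult_diag M(3) less_imp_le)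
  qed
  have av: "(1/2) *\<^sub>R (M + N) = M ** diag c"
  proof -
    have "diag c = (1/2) *\<^sub>R (mat 1 + diag (\<lambda>i. sqrt (d i)))"
      by (simp add: diag_def mat_def vec_eq_iff c_def)
    then show ?thesis
      by (simp add: N_def matrix_eq matrix_vector_mul_assoc[symmetric] matrix_vector_right_distrib
        matrix_vector_mult_add_rdistrib scaleR_mult_vec matrix_vector_mult_scaleR)
  qed
  have det: "det ((1/2) *\<^sub>R (M + N)) = det M * (\<Prod>i\<in>UNIV. c i)" by (simp add: av det_mul)
  have "(\<Prod>i\<in>UNIV. d i) < (\<Prod>i\<in>UNIV. (c i)^4)"
  proof (rule prod_strict_mono_ex1)
    have *: "d i \<le> (c i)^4 \<and> (d i \<noteq> 1 \<longrightarrow> d i < (c i)^4)" for i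
    proof -
      obtain s where s: "0 < s" "d i = s^2" "sqrt (d i) = s" using dpos[of i]
        by (metis real_sqrt_gt_zero real_sqrt_pow2 less_imp_le)
      \<comment> \<open>The arithmetic-geometric mean inequality with its defect
        \<open>((1 - s)/2)^2\<close>, which is positive unless \<open>d i = 1\<close>.\<close>
      have c2: "s + ((1 - s)/2)^2 = (c i)^2" unfolding c_def s(3) by (simp add: power2_eq_square field_simps)
      have c4: "(c i)^4 = ((c i)^2)^2" by simp
      have "s^2 \<le> ((c i)^2)^2" unfolding c2[symmetric] using s by (intro power_mono) auto
      moreover have "s^2 < ((c i)^2)^2" if "d i \<noteq> 1" unfolding c2[symmetric] using s that
        by (intro power_strict_mono) auto
      ultimately show ?thesis unfolding c4 by (auto simp: s(2))
    qed
    show "\<And>i. i \<in> UNIV \<Longrightarrow> d i \<le> (c i)^4" using * by blast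
    have "\<exists>i. d i \<noteq> 1" using ne M diag_1 by (metis ext matrix_mul_rid)
    then show "\<exists>i\<in>UNIV. d i < (c i)^4" using * by blast
  qed (use dpos in auto)
  then have "1 < (\<Prod>i\<in>UNIV. c i)^4" by (simp add: \<open>prod d UNIV = 1\<close> prod_power_distrib)
  moreover have "0 < (\<Prod>i\<in>UNIV. c i)" using cpos by (intro prod_pos) auto
  ultimately have "1 < (\<Prod>i\<in>UNIV. c i)^2"
    by (metis less_imp_le one_less_power pos2 power_less_one_iff linorder_not_less power_le_one)
  then have "det S < (det ((1/2) *\<^sub>R (M + N)))^2"
    using detM by (simp add: det M(2) det_mul power_mult_distrib power2_eq_square[of "det M", symmetric])
  moreover have "invertible ((1/2) *\<^sub>R (M + N))"
    using M(1) by (simp add: invertible_det_nz det less_imp_neq[OF cpos, symmetric])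
  ultimately show thesis using M(2) NN by (intro that)
qed

section \<open>The lifted problem\<close>

lemma continuous_on_det [continuous_intros]:
  fixes f :: "'a::topological_space \<Rightarrow> real^'k^'k"
  assumes "continuous_on S f" shows "continuous_on S (\<lambda>x. det (f x))"
  unfolding det_def by (intro continuous_intros assms)

lemma posdef_segment:
  fixes A B :: "real^'k^'k"
  assumes "posdef A" "posdef B" "0 \<le> t" "t \<le> 1"
  shows "posdef (A + t *\<^sub>R (B - A))"
    and "v \<bullet> ((A + t *\<^sub>R (B - A)) *v v) = (1 - t) * (v \<bullet> (A *v v)) + t * (v \<bullet> (B *v v))"
proof -
  show eq: "v \<bullet> ((A + t *\<^sub>R (B - A)) *v v) = (1 - t) * (v \<bullet> (A *v v)) + t * (v \<bullet> (B *v v))" for v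
    by (simp add: matrix_vector_mult_add_rdistrib matrix_vector_mult_diff_rdistrib
      scaleR_mult_vec inner_add_right inner_diff_right algebra_simps)
  have "transpose (A + t *\<^sub>R (B - A)) = A + t *\<^sub>R (B - A)"
    using posdef_sym[OF assms(1)] posdef_sym[OF assms(2)]
    by (auto simp: transpose_def vec_eq_iff)
  moreover have "0 < (1 - t) * (v \<bullet> (A *v v)) + t * (v \<bullet> (B *v v))" if "v \<noteq> 0" for v
  proof -
    have "0 < v \<bullet> (A *v v)" "0 < v \<bullet> (B *v v)" using assms that by (auto simp: posdef_def)
    then show ?thesis using assms(3,4) by (cases "t = 1") (auto intro!: add_pos_nonneg)
  qed
  ultimately show "posdef (A + t *\<^sub>R (B - A))" by (simp add: posdef_def eq)
qed

section \<open>Determinant maximization under point constraints\<close>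

lemma norm_sq_cart: "(norm (x :: real^'k))^2 = (\<Sum>i\<in>UNIV. (x $ i)^2)"
  by (simp add: norm_vec_def L2_set_def sum_nonneg)

text \<open>Apply the coercivity bound to every row of \<open>N\<close> and exchange the two sums.
  For \<open>Q = transpose N ** N\<close> the squared norm of \<open>N\<close> is the trace of
  \<open>Q\<close>, so this is the trace bound on feasible matrices.\<close>

lemma sum_feasible_rows_le:
  fixes N :: "real^'k^'l" and h :: "'m::finite \<Rightarrow> real^'k"
  assumes lam: "\<And>w. lam * (w \<bullet> w) \<le> (\<Sum>i\<in>UNIV. (w \<bullet> h i)^2)"
    and N: "\<And>i. (norm (N *v h i))^2 \<le> 1"
  shows "lam * (norm N)^2 \<le> CARD('m)"
proof -
  have "lam * (norm N)^2 = (\<Sum>r\<in>UNIV. lam * (N $ r \<bullet> N $ r))"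
    unfolding power2_norm_eq_inner by (simp add: inner_vec_def[of N] sum_distrib_left)
  also have "\<dots> \<le> (\<Sum>r\<in>UNIV. \<Sum>i\<in>UNIV. (N $ r \<bullet> h i)^2)" by (intro sum_mono lam)
  also have "\<dots> = (\<Sum>i\<in>UNIV. (norm (N *v h i))^2)"
    by (subst sum.swap) (simp add: norm_sq_cart matrix_mult_dot)
  also have "\<dots> \<le> (\<Sum>i\<in>(UNIV::'m set). 1)" by (intro sum_mono N)
  finally show ?thesis by simp
qed

lemma norm_matrix_vector_le:
  fixes N :: "real^'k^'l" shows "norm (N *v v) \<le> norm N * norm v"
proof -
  have "(norm (N *v v))^2 = (\<Sum>r\<in>UNIV. (N $ r \<bullet> v)^2)"
    by (simp add: norm_sq_cart matrix_mult_dot)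
  also have "\<dots> \<le> (\<Sum>r\<in>UNIV. (N $ r \<bullet> N $ r) * (v \<bullet> v))" by (intro sum_mono Cauchy_Schwarz_ineq)
  also have "\<dots> = (norm N * norm v)^2"
    unfolding power_mult_distrib power2_norm_eq_inner by (simp add: inner_vec_def[of N] sum_distrib_right)
  finally show ?thesis by (rule power2_le_imp_le) auto
qed

definition det_feasible :: "('m::finite \<Rightarrow> real^'k) \<Rightarrow> real^'k^'k \<Rightarrow> bool" where
  "det_feasible h Q \<longleftrightarrow> posdef Q \<and> (\<forall>i. h i \<bullet> (Q *v h i) \<le> 1)"

text \<open>The variable is a factor \<open>N\<close> with \<open>Q = transpose N ** N\<close>: the
  conditions \<open>norm (N *v h i) \<le> 1\<close> describe a compact set that involves no
  positivity. A small multiple of the identity lies in it, so the maximum of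
  \<open>(det N)^2\<close> is positive and the optimal factor is invertible.\<close>

lemma max_det_exists:
  fixes h :: "'m::finite \<Rightarrow> real^'k"
  assumes lam: "0 < lam" "\<And>w. lam * (w \<bullet> w) \<le> (\<Sum>i\<in>UNIV. (w \<bullet> h i)^2)"
  obtains Q where "det_feasible h Q" "\<And>Q'. det_feasible h Q' \<Longrightarrow> det Q' \<le> det Q"
proof -
  define K where "K = {N :: real^'k^'k. \<forall>i. norm (N *v h i) \<le> 1}"
  have "closed K" unfolding K_def
  proof (intro closed_Collect_all closed_Collect_le)
    fix i show "continuous_on UNIV (\<lambda>N :: real^'k^'k. norm (N *v h i))"
      unfolding matrix_vector_mult_def by (intro continuous_intros)
  qed (intro continuous_intros)
  moreover have "bounded K" unfolding bounded_iff
  proof (intro exI ballI)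
    fix N assume "N \<in> K"
    then have "lam * (norm N)^2 \<le> CARD('m)"
      by (intro sum_feasible_rows_le[where h=h] lam) (auto simp: K_def power_le_one)
    then have "(norm N)^2 \<le> CARD('m) / lam" using lam(1) by (simp add: field_simps)
    then show "norm N \<le> sqrt (CARD('m) / lam)" by (rule real_le_rsqrt)
  qed
  ultimately have "compact K" by (simp add: compact_eq_bounded_closed)
  define c where "c = 1 / (1 + (\<Sum>i\<in>UNIV. norm (h i)))"
  have c: "0 < c" by (simp add: c_def sum_nonneg add_pos_nonneg)
  have "diag (\<lambda>_. c) \<in> K" unfolding K_def
  proof safe
    fix i
    have "diag (\<lambda>_. c) *v h i = c *\<^sub>R h i" by (simp add: diag_mult_vec vec_eq_iff)
    moreover have "norm (h i) \<le> (\<Sum>i\<in>UNIV. norm (h i))" by (rule member_le_sum) auto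
    then have "norm (c *\<^sub>R h i) \<le> 1" using c by (simp add: c_def field_simps)
    ultimately show "norm (diag (\<lambda>_. c) *v h i) \<le> 1" by simp
  qed
  moreover have "continuous_on K (\<lambda>N. (det N)^2)" by (intro continuous_intros)
  ultimately obtain N where N: "N \<in> K" "\<And>N'. N' \<in> K \<Longrightarrow> (det N')^2 \<le> (det N)^2"
    using \<open>compact K\<close> continuous_attains_sup[of K "\<lambda>N. (det N)^2"] by blast
  have "0 < (det (diag (\<lambda>_::'k. c)))^2" using c by simp
  also have "\<dots> \<le> (det N)^2" by (rule N(2)) fact
  finally have "invertible (transpose N)" by (simp add: invertible_det_nz)
  define Q where "Q = transpose N ** transpose (transpose N)"
  have "det_feasible h Q" unfolding det_feasible_def
  proof safe
    show "posdef Q" unfolding Q_def by (rule posdef_mult_transpose) fact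
    fix i
    have "(norm (N *v h i))^2 \<le> 1" using N(1) by (simp add: K_def power_le_one)
    then show "h i \<bullet> (Q *v h i) \<le> 1"
      unfolding Q_def quad_mult_transpose power2_norm_eq_inner by simp
  qed
  moreover have "det Q' \<le> det Q" if Q': "det_feasible h Q'" for Q'
  proof -
    have "posdef Q'" using Q' by (simp add: det_feasible_def)
    from posdef_factor[OF this] obtain M :: "real^'k^'k" where M: "invertible M" "Q' = M ** transpose M" .
    have "norm (transpose M *v h i) \<le> 1" for i
    proof -
      have "(norm (transpose M *v h i))^2 \<le> 1^2"
        using Q' unfolding det_feasible_def M(2) quad_mult_transpose power2_norm_eq_inner by simp
      then show ?thesis by (rule power2_le_imp_le) simp
    qed
    then have "transpose M \<in> K" by (simp add: K_def)
    from N(2)[OF this] show ?thesis by (simp add: M(2) Q_def det_mul power2_eq_square)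
  qed
  ultimately show thesis by (rule that)
qed

text \<open>The trace bound gives the common eigenvalue bound \<open>R\<close> for all feasible
  matrices, and the feasible set is convex, so strong convexity applies along the segment. For equal
  determinants the estimate becomes uniqueness of the optimum.\<close>

lemma max_det_stability:
  fixes h :: "'m::finite \<Rightarrow> real^'k"
  assumes lam: "0 < lam" "\<And>w. lam * (w \<bullet> w) \<le> (\<Sum>i\<in>UNIV. (w \<bullet> h i)^2)"
    and A: "det_feasible h A" and opt: "\<And>Q. det_feasible h Q \<Longrightarrow> det Q \<le> det A"
    and B: "det_feasible h B"
  shows "(norm (B - A))^2 \<le> 2 * (CARD('m) / lam)^2 * (ln (det A) - ln (det B))"
proof -
  define R where "R = CARD('m) / lam"
  have R: "0 < R" using lam by (simp add: R_def)
  have bound: "v \<bullet> (Q *v v) \<le> R * (v \<bullet> v)" if Q: "det_feasible h Q" for Q v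
  proof -
    have "posdef Q" using Q by (simp add: det_feasible_def)
    from posdef_factor[OF this] obtain M :: "real^'k^'k" where M: "invertible M" "Q = M ** transpose M" .
    have "lam * (norm (transpose M))^2 \<le> CARD('m)"
    proof (rule sum_feasible_rows_le[OF lam(2)])
      show "(norm (transpose M *v h i))^2 \<le> 1" for i
        using Q unfolding det_feasible_def M(2) quad_mult_transpose power2_norm_eq_inner by blast
    qed
    then have n: "(norm (transpose M))^2 \<le> R" using lam(1) by (simp add: R_def field_simps)
    have "v \<bullet> (Q *v v) = (norm (transpose M *v v))^2"
      unfolding M(2) quad_mult_transpose power2_norm_eq_inner ..
    also have "\<dots> \<le> (norm (transpose M) * norm v)^2"
      by (intro power_mono norm_matrix_vector_le) auto
    also have "\<dots> \<le> R * (norm v)^2"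
      unfolding power_mult_distrib using n by (intro mult_right_mono) auto
    finally show ?thesis by (simp add: power2_norm_eq_inner)
  qed
  have pd: "posdef A" "posdef B" using A B by (auto simp: det_feasible_def)
  have "(norm (B - A))^2 / (2 * R^2) \<le> ln (det A) - ln (det B)"
  proof (rule logdet_strong_convexity[OF pd R bound[OF A] bound[OF B]])
    fix t :: real assume t: "0 \<le> t" "t \<le> 1"
    show "det (A + t *\<^sub>R (B - A)) \<le> det A"
    proof (rule opt, unfold det_feasible_def, intro conjI allI)
      show "posdef (A + t *\<^sub>R (B - A))" by (rule posdef_segment[OF pd t])
      fix i
      have "h i \<bullet> ((A + t *\<^sub>R (B - A)) *v h i) = (1 - t) * (h i \<bullet> (A *v h i)) + t * (h i \<bullet> (B *v h i))"
        by (rule posdef_segment[OF pd t])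
      also have "\<dots> \<le> (1 - t) * 1 + t * 1"
        using A B t by (intro add_mono mult_left_mono) (auto simp: det_feasible_def)
      finally show "h i \<bullet> ((A + t *\<^sub>R (B - A)) *v h i) \<le> 1" by simp
    qed
  qed
  then show ?thesis using R by (simp add: R_def[symmetric] field_simps)
qed

section \<open>Interior points, recession directions and lifted points\<close>

lemma interior_polytope: "interior (polytope_of a) = {x. \<forall>i. a i \<bullet> x < 1}"
proof (intro equalityI subsetI)
  fix x assume x: "x \<in> {x. \<forall>i. a i \<bullet> x < 1}"
  have "{x. \<forall>i. a i \<bullet> x < 1} = (\<Inter>i. {x. a i \<bullet> x < 1})" by blast
  then have "open {x. \<forall>i. a i \<bullet> x < 1}"
    by (simp add: open_INT open_Collect_less continuous_on_inner)
  moreover have "{x. \<forall>i. a i \<bullet> x < 1} \<subseteq> polytope_of a" by (auto simp: polytope_of_def less_imp_le)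
  ultimately show "x \<in> interior (polytope_of a)" using x interior_maximal by blast
next
  fix x assume "x \<in> interior (polytope_of a)"
  then obtain e where e: "0 < e" "cball x e \<subseteq> polytope_of a" by (meson mem_interior_cball)
  have "a i \<bullet> x < 1" for i
  proof (cases "a i = 0")
    case False
    have "x + (e / norm (a i)) *\<^sub>R a i \<in> polytope_of a" using e False by (auto simp: dist_norm intro!: subsetD[OF e(2)])
    then have "a i \<bullet> x + (e / norm (a i)) * (a i \<bullet> a i) \<le> 1"
      by (simp add: polytope_of_def inner_add_right)
    moreover have "0 < (e / norm (a i)) * (a i \<bullet> a i)" using e False by simp
    ultimately show ?thesis by linarith
  qed simp
  then show "x \<in> {x. \<forall>i. a i \<bullet> x < 1}" by simp
qed

text \<open>Otherwise \<open>u\<close> would be a recession direction, and the polytope would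
  contain a whole ray.\<close>

lemma bounded_polytope_direction:
  assumes "bounded (polytope_of a)" "x \<in> polytope_of a" "\<And>i. a i \<bullet> u \<le> 0"
  shows "u = 0"
proof (rule ccontr)
  assume u: "u \<noteq> 0"
  obtain B where B: "\<And>y. y \<in> polytope_of a \<Longrightarrow> norm y \<le> B" "0 < B"
    using assms(1) by (meson bounded_pos)
  define t where "t = (B + norm x + 1) / norm u"
  have t: "0 \<le> t" using B by (simp add: t_def)
  have "x + t *\<^sub>R u \<in> polytope_of a" unfolding polytope_of_def
  proof safe
    fix i
    have "t * (a i \<bullet> u) \<le> 0" using t assms(3)[of i] by (simp add: mult_le_0_iff)
    moreover have "a i \<bullet> x \<le> 1" using assms(2) by (simp add: polytope_of_def)
    ultimately show "a i \<bullet> (x + t *\<^sub>R u) \<le> 1" by (simp add: inner_add_right)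
  qed
  then have "norm (x + t *\<^sub>R u) \<le> B" by (rule B)
  moreover have "norm (t *\<^sub>R u) \<le> norm (x + t *\<^sub>R u) + norm x"
    by (metis add_diff_cancel_left' norm_triangle_ineq4)
  moreover have "norm (t *\<^sub>R u) = B + norm x + 1" using t u B by (simp add: t_def)
  ultimately show False by simp
qed

definition lift :: "real^'n \<Rightarrow> real \<Rightarrow> real^('n::finite option)" where
  "lift v t = (\<chi> j. case j of None \<Rightarrow> t | Some k \<Rightarrow> v $ k)"

lemma lift_nth [simp]: "lift v t $ None = t" "lift v t $ Some k = v $ k"
  by (simp_all add: lift_def)

lemma sum_UNIV_option: "(\<Sum>j\<in>UNIV. f j) = f None + (\<Sum>k\<in>UNIV. f (Some k))"
  for f :: "'n::finite option \<Rightarrow> 'b::comm_monoid_add"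
  by (simp add: UNIV_option_conv sum.reindex)

lemma lift_dot [simp]: "lift u s \<bullet> lift v t = u \<bullet> v + s * t"
  by (simp add: inner_vec_def sum_UNIV_option add.commute)

lemma lift_cases:
  obtains v t where "w = lift v t"
proof
  show "w = lift (\<chi> k. w $ Some k) (w $ None)"
    by (simp add: vec_eq_iff lift_def split: option.split)
qed

lemma lift_eq_iff [simp]: "lift u s = lift v t \<longleftrightarrow> u = v \<and> s = t"
  by (metis lift_nth vec_eq_iff)

lemma lift_zero [simp]: "lift 0 0 = 0"
  by (simp add: vec_eq_iff lift_def split: option.split)

text \<open>The normal \<open>a i\<close> rescaled so that the inequality it defines for the
  translate \<open>P - x\<close> has right-hand side 1. For interior \<open>x\<close> of a bounded
  polytope the convex hull of these points is the polar body.\<close>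

definition dual_pt :: "('m::finite \<Rightarrow> real^'n) \<Rightarrow> real^'n \<Rightarrow> 'm \<Rightarrow> real^'n" where
  "dual_pt a x i = (1 / (1 - a i \<bullet> x)) *\<^sub>R a i"

lemma lift_pt_eq: "lift_pt a x i = lift (dual_pt a x i) 1"
  by (simp add: vec_eq_iff lift_pt_def lift_def dual_pt_def split: option.split)

text \<open>If \<open>lift u t\<close> is orthogonal to all lifted points, then
  \<open>a i \<bullet> u = - t * (1 - a i \<bullet> x)\<close>. These numbers all have the same
  sign, so \<open>u\<close> or \<open>- u\<close> is a recession direction and vanishes; then
  \<open>t\<close> vanishes as well.\<close>

lemma lift_pts_spanning:
  assumes P: "full_dim_polytope a" and x: "x \<in> interior (polytope_of a)" and w: "w \<noteq> 0"
  shows "\<exists>i. w \<bullet> lift_pt a x i \<noteq> 0"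
proof (rule ccontr)
  assume "\<not> ?thesis"
  then have 0: "\<And>i. w \<bullet> lift_pt a x i = 0" by blast
  obtain u t where ut: "w = lift u t" using lift_cases .
  have pos: "0 < 1 - a i \<bullet> x" for i using x by (simp add: interior_polytope)
  have dir: "v = 0" if "\<And>i. a i \<bullet> v \<le> 0" for v
    using bounded_polytope_direction[of a x v] P x that interior_subset
    by (auto simp: full_dim_polytope_def)
  have eq: "a i \<bullet> u = - t * (1 - a i \<bullet> x)" for i
    using 0[of i] pos[of i] by (simp add: ut lift_pt_eq dual_pt_def inner_commute field_simps)
  have "u = 0"
  proof (cases "0 \<le> t")
    case True
    then show ?thesis using pos by (intro dir) (simp add: eq less_imp_le)
  next
    case False
    have "- u = 0" using False pos by (intro dir) (simp add: eq mult_le_0_iff less_imp_le)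
    then show ?thesis by simp
  qed
  \<comment> \<open>\<open>undefined\<close> stands for some constraint; an index type is
    nonempty.\<close>
  moreover have "t = 0" using eq[of undefined] pos[of undefined] \<open>u = 0\<close> by simp
  ultimately show False using w by (simp add: ut)
qed

lemma sum_matrix_vector_mult: "sum f A *v w = (\<Sum>i\<in>A. f i *v w)"
  for f :: "'i \<Rightarrow> real^'k^'l"
  by (induction A rule: infinite_finite_induct) (simp_all add: matrix_vector_mult_add_rdistrib)

lemma outer_mult_vec: "outer u v *v w = (v \<bullet> w) *\<^sub>R u"
  by (simp add: outer_def matrix_vector_mult_def inner_vec_def vec_eq_iff sum_distrib_left mult_ac)

lemma lift_gram_quad: "w \<bullet> (lift_gram a x *v w) = (\<Sum>i\<in>UNIV. (w \<bullet> lift_pt a x i)^2)"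
proof -
  have "lift_gram a x *v w = (\<Sum>i\<in>UNIV. outer (lift_pt a x i) (lift_pt a x i) *v w)"
    unfolding lift_gram_def by (rule sum_matrix_vector_mult)
  then show ?thesis by (simp add: outer_mult_vec inner_sum_right power2_eq_square inner_commute)
qed

lemma transpose_lift_gram: "transpose (lift_gram a x) = lift_gram a x"
  by (simp add: lift_gram_def transpose_def outer_def vec_eq_iff mult.commute)

text \<open>Compactness of the sphere gives coercivity at any single interior point. It serves
  existence and uniqueness of the lifted optimum outside the level set, where \<open>lam0\<close>
  says nothing; the quantitative estimates use \<open>lam0\<close>.\<close>

lemma lift_pts_coercive:
  fixes a :: "'m::finite \<Rightarrow> real^'n"
  assumes P: "full_dim_polytope a" and x: "x \<in> interior (polytope_of a)"
  obtains lam where "0 < lam" "\<And>w. lam * (w \<bullet> w) \<le> (\<Sum>i\<in>UNIV. (w \<bullet> lift_pt a x i)^2)"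
proof -
  let ?f = "\<lambda>w. \<Sum>i\<in>UNIV. (w \<bullet> lift_pt a x i)^2"
  let ?S = "sphere (0::real^('n option)) 1"
  have "continuous_on ?S ?f" by (intro continuous_intros)
  moreover have "?S \<noteq> {}" by simp
  ultimately obtain v where v: "v \<in> ?S" "\<And>w. w \<in> ?S \<Longrightarrow> ?f v \<le> ?f w"
    using continuous_attains_inf[of ?S ?f] by (metis compact_sphere)
  have "v \<noteq> 0" using v(1) by auto
  then obtain i where i: "v \<bullet> lift_pt a x i \<noteq> 0" using lift_pts_spanning[OF P x] by blast
  have "0 < ?f v" by (rule sum_pos2[where i=i]) (use i in auto)
  moreover have "?f v * (w \<bullet> w) \<le> ?f w" for w
  proof (cases "w = 0")
    case False
    have "?f v \<le> ?f ((1 / norm w) *\<^sub>R w)" using False by (intro v(2)) simp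
    also have "\<dots> = ?f w / (w \<bullet> w)"
      by (simp add: power_divide power2_norm_eq_inner sum_divide_distrib)
    finally show ?thesis using False by (simp add: field_simps)
  qed simp
  ultimately show thesis by (rule that)
qed

lemma lifted_feasible_eq: "lifted_feasible a x = det_feasible (lift_pt a x)"
  by (simp add: fun_eq_iff lifted_feasible_def det_feasible_def)

text \<open>Makes the definite description usable: existence comes from compactness, uniqueness from
  stability at zero gap. Comparing values of \<open>- ln (det Q)\<close> amounts to comparing
  determinants, as these are positive.\<close>

lemma lifted_opt:
  assumes P: "full_dim_polytope a" and x: "x \<in> interior (polytope_of a)"
  shows lifted_opt_feasible: "lifted_feasible a x (lifted_opt a x)"
    and lifted_opt_max: "\<And>Q. lifted_feasible a x Q \<Longrightarrow> det Q \<le> det (lifted_opt a x)"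
    and lifted_opt_unique: "\<And>Q. lifted_feasible a x Q \<Longrightarrow> det (lifted_opt a x) \<le> det Q \<Longrightarrow> Q = lifted_opt a x"
proof -
  obtain lam where lam: "0 < lam" "\<And>w. lam * (w \<bullet> w) \<le> (\<Sum>i\<in>UNIV. (w \<bullet> lift_pt a x i)^2)"
    using lift_pts_coercive[OF P x] by metis
  obtain A where A: "det_feasible (lift_pt a x) A" "\<And>Q. det_feasible (lift_pt a x) Q \<Longrightarrow> det Q \<le> det A"
    using max_det_exists[OF lam] by metis
  have unique: "Q = A" if "det_feasible (lift_pt a x) Q" "det A \<le> det Q" for Q
  proof -
    have "det A = det Q" using A(2)[OF that(1)] that(2) by simp
    then have "(norm (Q - A))^2 \<le> 0" using max_det_stability[OF lam A that(1)] by simp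
    then show ?thesis by simp
  qed
  have ln: "- ln (det Q) \<le> - ln (det Q') \<longleftrightarrow> det Q' \<le> det Q"
    if "det_feasible (lift_pt a x) Q" "det_feasible (lift_pt a x) Q'" for Q Q'
    using that by (simp add: det_feasible_def posdef_det_pos)
  have "lifted_opt a x = A" unfolding lifted_opt_def lifted_feasible_eq
  proof (rule the_equality)
    show "det_feasible (lift_pt a x) A \<and> (\<forall>Q'. det_feasible (lift_pt a x) Q' \<longrightarrow> - ln (det A) \<le> - ln (det Q'))"
      using A ln by blast
    show "Q = A" if "det_feasible (lift_pt a x) Q \<and> (\<forall>Q'. det_feasible (lift_pt a x) Q' \<longrightarrow> - ln (det Q) \<le> - ln (det Q'))" for Q
      using that A ln unique by blast
  qed
  then show "lifted_feasible a x (lifted_opt a x)"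
    "\<And>Q. lifted_feasible a x Q \<Longrightarrow> det Q \<le> det (lifted_opt a x)"
    "\<And>Q. lifted_feasible a x Q \<Longrightarrow> det (lifted_opt a x) \<le> det Q \<Longrightarrow> Q = lifted_opt a x"
    using A unique by (auto simp: lifted_feasible_eq)
qed

lemma lifted_stability:
  fixes a :: "'m::finite \<Rightarrow> real^'n"
  assumes P: "full_dim_polytope a" and x: "x \<in> interior (polytope_of a)"
    and lam: "0 < lam" "lam \<le> lambda_min (lift_gram a x)"
    and Q: "lifted_feasible a x Q" "- ln (det Q) \<le> - ln (det (lifted_opt a x)) + \<epsilon>"
  shows "norm (Q - lifted_opt a x) \<le> CARD('m) / lam * sqrt (2 * \<epsilon>)"
proof -
  have "lam * (w \<bullet> w) \<le> (\<Sum>i\<in>UNIV. (w \<bullet> lift_pt a x i)^2)" for w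
  proof -
    have "lam * (w \<bullet> w) \<le> lambda_min (lift_gram a x) * (w \<bullet> w)" by (intro mult_right_mono lam) auto
    also have "\<dots> \<le> w \<bullet> (lift_gram a x *v w)" by (rule lambda_min_le[OF transpose_lift_gram])
    finally show ?thesis by (simp add: lift_gram_quad)
  qed
  from max_det_stability[OF lam(1) this, of "lifted_opt a x" Q] lifted_opt[OF P x] Q(1)
  have "(norm (Q - lifted_opt a x))^2 \<le> 2 * (CARD('m) / lam)^2 * (ln (det (lifted_opt a x)) - ln (det Q))"
    by (auto simp: lifted_feasible_eq)
  also have "\<dots> \<le> 2 * (CARD('m) / lam)^2 * \<epsilon>" using Q(2) by (intro mult_left_mono) auto
  finally have "norm (Q - lifted_opt a x) \<le> sqrt ((CARD('m) / lam)^2 * (2 * \<epsilon>))"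
    by (intro real_le_rsqrt) (simp add: mult_ac)
  then show ?thesis using lam(1) by (simp add: real_sqrt_mult)
qed

section \<open>Block matrices and Schur complements\<close>

definition block :: "real^'n^'n \<Rightarrow> real^'n \<Rightarrow> real \<Rightarrow> real^('n::finite option)^('n option)" where
  "block G z s = (\<chi> i. case i of None \<Rightarrow> lift z s | Some k \<Rightarrow> lift (G $ k) (z $ k))"

lemma block_nth [simp]:
  "block G z s $ None = lift z s" "block G z s $ Some k = lift (G $ k) (z $ k)"
  by (simp_all add: block_def)

lemma block_simps [simp]:
  "G_block (block G z s) = G" "z_block (block G z s) = z" "s_block (block G z s) = s"
  by (simp_all add: G_block_def z_block_def s_block_def vec_eq_iff)

lemma block_mult_lift: "block G z s *v lift v t = lift (G *v v + t *\<^sub>R z) (z \<bullet> v + s * t)"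
proof -
  have "(block G z s *v lift v t) $ j = lift (G *v v + t *\<^sub>R z) (z \<bullet> v + s * t) $ j" for j
    by (cases j) (simp_all add: matrix_mult_dot mult.commute)
  then show ?thesis by (simp add: vec_eq_iff)
qed

lemma block_eqI:
  assumes "transpose Q = Q" shows "Q = block (G_block Q) (z_block Q) (s_block Q)"
proof -
  have sym: "Q $ i $ j = Q $ j $ i" for i j
    using assms by (simp add: transpose_def vec_eq_iff)
  have "Q $ i $ j = block (G_block Q) (z_block Q) (s_block Q) $ i $ j" for i j
    by (cases i; cases j) (simp_all add: G_block_def z_block_def s_block_def sym[of None "Some _"])
  then show ?thesis by (simp add: vec_eq_iff)
qed

lemma transpose_block: "transpose (block G z s) = block (transpose G) z s"
proof -
  have "transpose (block G z s) $ i $ j = block (transpose G) z s $ i $ j" for i j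
    by (cases i; cases j) (simp_all add: transpose_def)
  then show ?thesis by (simp add: vec_eq_iff)
qed

lemma matrix_eq_lift: "A = B \<longleftrightarrow> (\<forall>v t. A *v lift v t = B *v lift v t)"
  by (metis lift_cases matrix_eq)

lemma block_diag_mult: "block A 0 s ** block B 0 t = block (A ** B) 0 (s * t)"
  by (simp add: matrix_eq_lift matrix_vector_mul_assoc[symmetric] block_mult_lift)

text \<open>The orthogonal factor of a spectral decomposition of \<open>G\<close> extends by a 1 to
  the lifted space. Both orthogonal matrices have a determinant of square 1, which leaves two
  diagonal determinants to compare.\<close>

lemma block_diag_det:
  fixes G :: "real^'n^'n"
  assumes "transpose G = G" shows "det (block G 0 k) = k * det G"
proof -
  obtain U :: "real^'n^'n" and d where U: "transpose U ** U = mat 1" "U ** transpose U = mat 1"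
    "G = U ** diag d ** transpose U"
    using spectral_decomposition[OF assms] .
  have one: "block (mat 1) 0 1 = mat 1" by (simp add: matrix_eq_lift block_mult_lift)
  have "(det U)^2 = det (U ** transpose U)" by (simp add: det_mul power2_eq_square)
  then have detU: "(det U)^2 = 1" by (simp add: U)
  have "(det (block U 0 1))^2 = det (block U 0 1 ** transpose (block U 0 1))"
    by (simp add: det_mul power2_eq_square)
  then have detB: "(det (block U 0 1))^2 = 1" by (simp add: transpose_block block_diag_mult U one)
  have dg: "block (diag d) 0 k = diag (\<lambda>j. case j of None \<Rightarrow> k | Some i \<Rightarrow> d i)"
  proof -
    have "block (diag d) 0 k $ i $ j = diag (\<lambda>j. case j of None \<Rightarrow> k | Some i \<Rightarrow> d i) $ i $ j" for i j
      by (cases i; cases j) (simp_all add: diag_def)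
    then show ?thesis by (simp add: vec_eq_iff)
  qed
  have "block G 0 k = block U 0 1 ** block (diag d) 0 k ** transpose (block U 0 1)"
    by (simp add: transpose_block block_diag_mult U(3))
  then have "det (block G 0 k) = (det (block U 0 1))^2 * (k * (\<Prod>i\<in>UNIV. d i))"
    by (simp add: det_mul dg power2_eq_square UNIV_option_conv prod.reindex)
  moreover have "det G = (det U)^2 * (\<Prod>i\<in>UNIV. d i)"
    by (simp add: U(3) det_mul power2_eq_square)
  ultimately show ?thesis by (simp add: detU detB)
qed

text \<open>Completing the square in \<open>v\<close>; what remains is \<open>t^2\<close> times the
  Schur complement of \<open>G\<close>.\<close>

lemma block_quad:
  assumes "posdef G"
  shows "lift v t \<bullet> (block G z s *v lift v t)
    = (v + t *\<^sub>R (matrix_inv G *v z)) \<bullet> (G *v (v + t *\<^sub>R (matrix_inv G *v z)))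
      + t^2 * (s - z \<bullet> (matrix_inv G *v z))"
proof -
  define c where "c = matrix_inv G *v z"
  have Gc: "G *v c = z" by (simp add: c_def matrix_vector_mul_assoc posdef_matrix_inv[OF assms])
  have "c \<bullet> (G *v v) = z \<bullet> v" using sym_dot[OF posdef_sym[OF assms], of c v] by (simp add: Gc)
  then show ?thesis unfolding c_def[symmetric]
    by (simp add: block_mult_lift matrix_vector_right_distrib matrix_vector_mult_scaleR Gc
      inner_add_left inner_add_right inner_commute power2_eq_square algebra_simps)
qed

text \<open>The last row differs from that of the identity by a combination of the other rows, which
  leaves the determinant unchanged.\<close>

lemma det_shear:
  "det (\<chi> j. case j of None \<Rightarrow> lift c 1 | Some k \<Rightarrow> axis (Some k) 1 :: real^('n::finite option)^('n option)) = 1"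
proof -
  let ?I = "mat 1 :: real^('n option)^('n option)"
  have row: "row j ?I = axis j 1" for j
    by (auto simp: row_def mat_def axis_def vec_eq_iff)
  have "lift c 0 = (\<Sum>k\<in>UNIV. c $ k *\<^sub>R axis (Some k) 1)"
  proof -
    have "lift c 0 $ j = (\<Sum>k\<in>UNIV. c $ k *\<^sub>R axis (Some k) 1) $ j" for j
      by (cases j) (simp_all add: axis_def if_distrib cong: if_cong)
    then show ?thesis by (simp add: vec_eq_iff)
  qed
  also have "\<dots> \<in> span {row j ?I | j. j \<noteq> None}"
    by (intro span_sum span_scale span_base) (auto simp: row)
  finally have "det (\<chi> k. if k = None then row None ?I + lift c 0 else row k ?I) = det ?I"
    by (intro det_row_span) (simp add: span_vec_eq)
  moreover have "(\<chi> k. if k = None then row None ?I + lift c 0 else row k ?I)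
      = (\<chi> j. case j of None \<Rightarrow> lift c 1 | Some k \<Rightarrow> axis (Some k) 1)"
  proof -
    have "row None ?I + lift c 0 = lift c 1"
    proof -
      have "(row None ?I + lift c 0) $ j = lift c 1 $ j" for j
        by (cases j) (simp_all add: row axis_def)
      then show ?thesis by (simp add: vec_eq_iff)
    qed
    then show ?thesis by (simp add: vec_eq_iff row split: option.split)
  qed
  ultimately show ?thesis by simp
qed

text \<open>The shear \<open>L\<close>, whose last row is built from
  \<open>c = matrix_inv G *v z\<close>, expresses the completion of the square as a congruence. Its
  determinant is 1, so the block-diagonal middle factor alone contributes.\<close>

lemma det_block:
  fixes G :: "real^'n^'n"
  assumes G: "posdef G"
  shows "det (block G z s) = (s - z \<bullet> (matrix_inv G *v z)) * det G"
proof -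
  define c where "c = matrix_inv G *v z"
  have Gc: "G *v c = z" by (simp add: c_def matrix_vector_mul_assoc posdef_matrix_inv[OF G])
  have cG: "c \<bullet> (G *v v) = z \<bullet> v" for v using sym_dot[OF posdef_sym[OF G], of c v] by (simp add: Gc)
  define L :: "real^('n option)^('n option)"
    where "L = (\<chi> j. case j of None \<Rightarrow> lift c 1 | Some k \<Rightarrow> axis (Some k) 1)"
  have L: "L *v lift v t = lift v (t + c \<bullet> v)" for v t
  proof -
    have "(L *v lift v t) $ j = lift v (t + c \<bullet> v) $ j" for j
      by (cases j) (simp_all add: L_def matrix_mult_dot inner_axis' )
    then show ?thesis by (simp add: vec_eq_iff)
  qed
  have LT: "transpose L *v lift v t = lift (v + t *\<^sub>R c) t" for v t
  proof -
    have "lift u r \<bullet> (transpose L *v lift v t) = lift u r \<bullet> lift (v + t *\<^sub>R c) t" for u r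
      using transpose_dot[of "lift u r" "transpose L" "lift v t"]
      by (simp add: L inner_add_right inner_commute algebra_simps)
    then have "x \<bullet> (transpose L *v lift v t) = x \<bullet> lift (v + t *\<^sub>R c) t" for x
      by (metis lift_cases)
    then show ?thesis by (rule vector_eq_ldot[THEN iffD1, OF allI])
  qed
  have "block G z s = L ** block G 0 (s - z \<bullet> c) ** transpose L"
    by (simp add: matrix_eq_lift matrix_vector_mul_assoc[symmetric] block_mult_lift L LT
      matrix_vector_right_distrib matrix_vector_mult_scaleR Gc cG inner_add_right inner_commute algebra_simps)
  then have "det (block G z s) = (det L)^2 * ((s - z \<bullet> c) * det G)"
    by (simp add: det_mul block_diag_det[OF posdef_sym[OF G]] power2_eq_square)
  then show ?thesis by (simp add: c_def L_def det_shear)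
qed

lemma posdef_blockI:
  fixes G :: "real^'n^'n"
  assumes G: "posdef G" and k: "0 < s - z \<bullet> (matrix_inv G *v z)"
  shows "posdef (block G z s)"
  unfolding posdef_def
proof (intro conjI allI impI)
  show "transpose (block G z s) = block G z s" by (simp add: transpose_block posdef_sym[OF G])
  fix w :: "real^('n option)" assume w: "w \<noteq> 0"
  obtain v t where vt: "w = lift v t" using lift_cases .
  define y where "y = v + t *\<^sub>R (matrix_inv G *v z)"
  have y: "0 \<le> y \<bullet> (G *v y)" "y \<noteq> 0 \<Longrightarrow> 0 < y \<bullet> (G *v y)"
    using G by (cases "y = 0"; force simp: posdef_def)+
  have "0 < y \<bullet> (G *v y) + t^2 * (s - z \<bullet> (matrix_inv G *v z))"
  proof (cases "t = 0")
    case True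
    then have "y \<noteq> 0" using w by (auto simp: y_def vt)
    then show ?thesis using y True by simp
  next
    case False
    then show ?thesis using y(1) k by (intro add_nonneg_pos) simp_all
  qed
  then show "0 < w \<bullet> (block G z s *v w)" by (simp add: vt block_quad[OF G] y_def)
qed

text \<open>\<open>1 - beta Q\<close> is the Schur complement of the block \<open>G_block Q\<close>.
  Its positivity is that of \<open>Q\<close> at the lifted vector of height 1 which annihilates the
  completed square.\<close>

lemma posdef_blocks:
  assumes "posdef Q"
  shows posdef_G_block: "posdef (G_block Q)"
    and beta_less_1: "beta Q < 1"
    and det_lifted: "det Q = (1 - beta Q) * det (G_block Q)"
    and lifted_quad: "lift v t \<bullet> (Q *v lift v t)
      = (v + t *\<^sub>R (matrix_inv (G_block Q) *v z_block Q))
          \<bullet> (G_block Q *v (v + t *\<^sub>R (matrix_inv (G_block Q) *v z_block Q)))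
        + t^2 * (1 - beta Q)"
    and lifted_quad': "lift v t \<bullet> (Q *v lift v t)
      = v \<bullet> (G_block Q *v v) + 2 * t * (z_block Q \<bullet> v) + t^2 * s_block Q"
proof -
  define G z s where "G = G_block Q" "z = z_block Q" "s = s_block Q"
  have Q: "Q = block G z s" using block_eqI[OF posdef_sym[OF assms]] by (simp add: G_z_s_def)
  have quad: "lift v t \<bullet> (Q *v lift v t) = v \<bullet> (G *v v) + 2 * t * (z \<bullet> v) + t^2 * s" for v t
    by (simp add: Q block_mult_lift inner_add_right inner_commute power2_eq_square algebra_simps)
  then show "lift v t \<bullet> (Q *v lift v t)
      = v \<bullet> (G_block Q *v v) + 2 * t * (z_block Q \<bullet> v) + t^2 * s_block Q" for v t
    by (simp add: G_z_s_def)
  have "transpose (block G z s) = block G z s" using posdef_sym[OF assms] Q by simp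
  then have "transpose G = G" by (metis transpose_block block_simps(1))
  moreover have "0 < v \<bullet> (G *v v)" if "v \<noteq> 0" for v
  proof -
    have "lift v 0 \<noteq> 0" using that by (metis lift_eq_iff lift_zero)
    then have "0 < lift v 0 \<bullet> (Q *v lift v 0)" using assms by (simp add: posdef_def)
    then show ?thesis by (simp add: quad)
  qed
  ultimately show G: "posdef (G_block Q)" by (simp add: posdef_def G_z_s_def)
  then have pG: "posdef G" by (simp add: G_z_s_def)
  have b: "1 - beta Q = s - z \<bullet> (matrix_inv G *v z)" by (simp add: beta_def G_z_s_def)
  show "det Q = (1 - beta Q) * det (G_block Q)"
    using det_block[OF pG, of z s] by (simp add: b Q[symmetric] G_z_s_def(1)[symmetric])
  show lq: "lift v t \<bullet> (Q *v lift v t)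
      = (v + t *\<^sub>R (matrix_inv (G_block Q) *v z_block Q))
          \<bullet> (G_block Q *v (v + t *\<^sub>R (matrix_inv (G_block Q) *v z_block Q)))
        + t^2 * (1 - beta Q)" for v t
    using block_quad[OF pG, of v t z s] by (simp add: b Q[symmetric] G_z_s_def[symmetric])
  have "lift (- (matrix_inv (G_block Q) *v z_block Q)) 1 \<noteq> 0"
    by (metis lift_eq_iff lift_zero zero_neq_one)
  then have "0 < lift (- (matrix_inv (G_block Q) *v z_block Q)) 1 \<bullet> (Q *v lift (- (matrix_inv (G_block Q) *v z_block Q)) 1)"
    using assms by (simp add: posdef_def)
  then show "beta Q < 1" by (simp add: lq)
qed

lemma det_scaleR: "det (c *\<^sub>R A) = c ^ CARD('k) * det A" for A :: "real^'k^'k"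
proof -
  have "c *\<^sub>R A = diag (\<lambda>_. c) ** A"
    by (simp add: matrix_eq matrix_vector_mul_assoc[symmetric] diag_mult_vec
      scaleR_mult_vec vec_eq_iff)
  then show ?thesis by (simp add: det_mul)
qed

lemma posdef_scaleR: "posdef A \<Longrightarrow> 0 < c \<Longrightarrow> posdef (c *\<^sub>R A)"
  by (auto simp: posdef_def transpose_def vec_eq_iff scaleR_mult_vec)

lemma posdef_quad_nonneg: "posdef A \<Longrightarrow> 0 \<le> v \<bullet> (A *v v)"
  by (cases "v = 0") (auto simp: posdef_def less_imp_le)

lemma posdef_cauchy_schwarz:
  fixes F :: "real^'k^'k"
  assumes "posdef F" shows "(u \<bullet> w)^2 \<le> (u \<bullet> (F *v u)) * (w \<bullet> (matrix_inv F *v w))"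
proof -
  obtain M :: "real^'k^'k" where M: "invertible M" "F = M ** transpose M"
    using posdef_factor[OF assms] .
  define y where "y = matrix_inv F *v w"
  have w: "w = F *v y" by (simp add: y_def matrix_vector_mul_assoc posdef_matrix_inv[OF assms])
  have "u \<bullet> w = (transpose M *v u) \<bullet> (transpose M *v y)"
    by (metis M(2) matrix_vector_mul_assoc transpose_dot w)
  then have "(u \<bullet> w)^2 \<le> ((transpose M *v u) \<bullet> (transpose M *v u)) * ((transpose M *v y) \<bullet> (transpose M *v y))"
    by (simp add: Cauchy_Schwarz_ineq)
  moreover have "(transpose M *v y) \<bullet> (transpose M *v y) = w \<bullet> y"
    using quad_mult_transpose[of y M] by (simp add: M(2)[symmetric] w[symmetric] inner_commute)
  ultimately show ?thesis by (simp add: M(2) quad_mult_transpose y_def)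
qed

section \<open>Covering and inscribed ellipsoids\<close>

lemma matrix_vector_mult_minus: "A *v (- x) = - (A *v x)" for A :: "real^'k^'l"
  by (metis linear_neg matrix_vector_mul_linear)

lemma full_dim_direction:
  assumes "full_dim_polytope a" "\<And>i. a i \<bullet> u \<le> 0" shows "u = 0"
  using bounded_polytope_direction[of a 0 u] assms by (simp add: full_dim_polytope_def polytope_of_def)

lemma dual_pt_inner: "dual_pt a x i \<bullet> u = (a i \<bullet> u) / (1 - a i \<bullet> x)"
  by (simp add: dual_pt_def)

lemma lift_dual_pt_quad:
  assumes "posdef Q"
  shows "lift_pt a x i \<bullet> (Q *v lift_pt a x i)
    = dual_pt a x i \<bullet> (G_block Q *v dual_pt a x i) + 2 * (z_block Q \<bullet> dual_pt a x i) + s_block Q"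
  by (simp add: lift_pt_eq lifted_quad'[OF assms])

text \<open>If \<open>beta Q \<le> 0\<close>, the term \<open>1 - beta Q\<close> of the completed
  square exhausts the right-hand side 1, so that all \<open>dual_pt a x i\<close> coincide with
  \<open>- c\<close>. Every \<open>u\<close> with \<open>0 \<le> c \<bullet> u\<close> is then a
  recession direction, so first \<open>c\<close> and then every vector is zero, which is absurd in
  positive dimension.\<close>

lemma beta_pos:
  fixes a :: "'m::finite \<Rightarrow> real^'n"
  assumes P: "full_dim_polytope a" and x: "x \<in> interior (polytope_of a)"
    and Q: "lifted_feasible a x Q"
  shows "0 < beta Q"
proof (rule ccontr)
  assume neg: "\<not> 0 < beta Q"
  define c where "c = matrix_inv (G_block Q) *v z_block Q"
  have pQ: "posdef Q" using Q by (simp add: lifted_feasible_def)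
  have pos: "0 < 1 - a i \<bullet> x" for i using x by (simp add: interior_polytope)
  have "dual_pt a x i = - c" for i
  proof (rule ccontr)
    assume "dual_pt a x i \<noteq> - c"
    then have "dual_pt a x i + c \<noteq> 0" by (metis add_eq_0_iff2)
    then have "0 < (dual_pt a x i + c) \<bullet> (G_block Q *v (dual_pt a x i + c))"
      using posdef_G_block[OF pQ] by (simp add: posdef_def)
    moreover have "lift (dual_pt a x i) 1 \<bullet> (Q *v lift (dual_pt a x i) 1) \<le> 1"
      using Q by (simp add: lifted_feasible_def lift_pt_eq)
    ultimately show False using neg by (simp add: lifted_quad[OF pQ] c_def)
  qed
  then have eq: "a i \<bullet> u = - (1 - a i \<bullet> x) * (c \<bullet> u)" for i u
    using dual_pt_inner[of a x i u] pos[of i] by (simp add: field_simps)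
  have dir: "u = 0" if "0 \<le> c \<bullet> u" for u
    using pos that by (intro full_dim_direction[OF P]) (simp add: eq[of _ u] mult_le_0_iff less_imp_le)
  have "c = 0" by (rule dir) simp
  then have "axis undefined 1 = (0 :: real^'n)" by (intro dir) simp
  then show False by (simp add: axis_eq_0_iff)
qed

section \<open>Minimal covering ellipsoid of the polar body\<close>

lemma convex_ellipsoid:
  fixes A :: "real^'k^'k"
  assumes "posdef A" shows "convex (ellipsoid c A)"
proof -
  obtain M :: "real^'k^'k" where M: "invertible M" "A = M ** transpose M" using posdef_factor[OF assms] .
  have "y \<in> ellipsoid c A \<longleftrightarrow> norm (transpose M *v y - transpose M *v c) \<le> 1" for y
    unfolding ellipsoid_def M(2) mem_Collect_eq quad_mult_transpose
    by (simp add: norm_eq_sqrt_inner matrix_vector_mult_diff_distrib)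
  then have "ellipsoid c A = (*v) (transpose M) -` cball (transpose M *v c) 1"
    by (intro set_eqI) (simp only: vimage_eq mem_cball dist_norm norm_minus_commute)
  then show ?thesis by (simp only:) (intro convex_linear_vimage convex_cball matrix_vector_mul_linear)
qed

text \<open>The polar body is the convex hull of the points \<open>dual_pt a x i\<close> and
  ellipsoids are convex, so covering is a finite condition. The inclusion of the polar body in the
  hull is a separation argument.\<close>

lemma polar_subset_ellipsoid_iff:
  fixes a :: "'m::finite \<Rightarrow> real^'n"
  assumes P: "full_dim_polytope a" and x: "x \<in> interior (polytope_of a)" and A: "posdef A"
  shows "polar ((\<lambda>p. p - x) ` polytope_of a) \<subseteq> ellipsoid c A
    \<longleftrightarrow> (\<forall>i. dual_pt a x i \<in> ellipsoid c A)"
proof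
  let ?K = "polar ((\<lambda>p. p - x) ` polytope_of a)"
  have pos: "0 < 1 - a i \<bullet> x" for i using x by (simp add: interior_polytope)
  let ?D = "convex hull (range (dual_pt a x))"
  have "dual_pt a x i \<in> ?K" for i
    using pos[of i] by (auto simp: polar_def dual_pt_inner polytope_of_def inner_diff_right
      diff_divide_distrib[symmetric])
  then show "?K \<subseteq> ellipsoid c A \<Longrightarrow> \<forall>i. dual_pt a x i \<in> ellipsoid c A"
    by blast
  assume "\<forall>i. dual_pt a x i \<in> ellipsoid c A"
  then have "?D \<subseteq> ellipsoid c A" by (intro hull_minimal convex_ellipsoid A) auto
  moreover have "y \<in> ?D" if y: "y \<in> ?K" for y
  proof (rule ccontr)
    assume "y \<notin> ?D"
    moreover have "compact ?D" by (intro finite_imp_compact_convex_hull) simp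
    ultimately obtain w b where w: "w \<bullet> y < b" "\<And>v. v \<in> ?D \<Longrightarrow> b < w \<bullet> v"
      using separating_hyperplane_closed_point[of ?D y] by (auto simp: compact_imp_closed)
    define u where "u = - w"
    have u: "- b < y \<bullet> u" "\<And>i. dual_pt a x i \<bullet> u < - b"
      using w(1) w(2)[OF hull_inc, of "dual_pt a x _"] by (auto simp: u_def inner_commute)
    have i: "a i \<bullet> u < - b * (1 - a i \<bullet> x)" for i
      using u(2)[of i] pos[of i] by (simp add: dual_pt_inner field_simps)
    \<comment> \<open>The sign of the offset \<open>- b\<close> decides. If it is positive,
      \<open>x + u / (- b)\<close> lies in the polytope and contradicts that \<open>y\<close> is
      polar; otherwise \<open>u\<close> is a recession direction and hence zero, so that it
      separates nothing.\<close>
    show False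
    proof (cases "0 < - b")
      case True
      have "(1 / - b) *\<^sub>R u + x \<in> polytope_of a" unfolding polytope_of_def
      proof safe
        fix j show "a j \<bullet> ((1 / - b) *\<^sub>R u + x) \<le> 1"
        proof -
          have "a j \<bullet> ((1 / - b) *\<^sub>R u + x) = (a j \<bullet> u) / (- b) + a j \<bullet> x"
            by (simp add: inner_add_right inner_diff_right)
          moreover have "(a j \<bullet> u) / (- b) < 1 - a j \<bullet> x"
            using i[of j] True by (subst pos_divide_less_eq) (simp_all add: mult.commute)
          ultimately show ?thesis by linarith
        qed
      qed
      then have "(1 / - b) *\<^sub>R u \<in> (\<lambda>p. p - x) ` polytope_of a" by (rule image_eqI[rotated]) simp
      then have "y \<bullet> ((1 / - b) *\<^sub>R u) \<le> 1" using y unfolding polar_def by blast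
      then show False using u(1) True by (simp add: field_simps)
    next
      case False
      have "a i \<bullet> u \<le> 0" for i
      proof -
        have "- b * (1 - a i \<bullet> x) \<le> 0" using False pos[of i] by (simp add: mult_le_0_iff zero_le_mult_iff)
        then show ?thesis using i[of i] by linarith
      qed
      then have "u = 0" by (rule full_dim_direction[OF P])
      then show False using u(1) u(2)[of undefined] by simp
    qed
  qed
  ultimately show "?K \<subseteq> ellipsoid c A" by blast
qed

lemma vol_pos: "posdef A \<Longrightarrow> 0 < vol A"
  using posdef_det_pos[of A] by (simp add: vol_def)

lemma ln_vol: "posdef A \<Longrightarrow> ln (vol A) = - ln (det A) / 2"
  using posdef_det_pos[of A] by (simp add: vol_def ln_powr)

lemma vol_le_iff:
  assumes "posdef A" "posdef B" shows "vol A \<le> vol B \<longleftrightarrow> det B \<le> det A"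
proof -
  have "vol A \<le> vol B \<longleftrightarrow> ln (vol A) \<le> ln (vol B)" using assms by (simp add: vol_pos)
  also have "\<dots> \<longleftrightarrow> ln (det B) \<le> ln (det A)" using assms by (simp add: ln_vol)
  also have "\<dots> \<longleftrightarrow> det B \<le> det A" using assms by (simp add: posdef_det_pos)
  finally show ?thesis .
qed

text \<open>The lifted quadratic form at \<open>lift v t\<close> is \<open>b\<close> times the
  \<open>A\<close>-form at \<open>v - t c\<close>, plus \<open>(1 - b) * t^2\<close>; over the
  ellipsoid at height 1 it is at most 1. Its determinant is that of \<open>A\<close> up to a factor
  depending on \<open>b\<close> and the dimension only.\<close>

lemma ellipsoid_lift:
  fixes A :: "real^'n^'n"
  assumes A: "posdef A" and pts: "\<And>i. dual_pt a x i \<in> ellipsoid c A" and b: "0 < b" "b < 1"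
  defines "Q \<equiv> block (b *\<^sub>R A) (- b *\<^sub>R (A *v c)) (b * (c \<bullet> (A *v c)) + 1 - b)"
  shows "lifted_feasible a x Q" "det Q = (1 - b) * (b ^ CARD('n) * det A)"
proof -
  have bA: "posdef (b *\<^sub>R A)" using posdef_scaleR[OF A b(1)] .
  have inv: "matrix_inv (b *\<^sub>R A) *v (- b *\<^sub>R (A *v c)) = - c"
  proof -
    have "- b *\<^sub>R (A *v c) = (b *\<^sub>R A) *v (- c)"
      by (simp add: scaleR_mult_vec matrix_vector_mult_scaleR[symmetric]
        matrix_vector_mult_minus)
    then show ?thesis using posdef_matrix_inv[OF bA] by (simp add: matrix_vector_mul_assoc)
  qed
  have k: "b * (c \<bullet> (A *v c)) + 1 - b - (- b *\<^sub>R (A *v c)) \<bullet> (matrix_inv (b *\<^sub>R A) *v (- b *\<^sub>R (A *v c))) = 1 - b"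
    unfolding inv by (simp add: inner_commute[of "A *v c" c])
  show "det Q = (1 - b) * (b ^ CARD('n) * det A)"
    unfolding Q_def det_block[OF bA] k det_scaleR ..
  have "posdef Q" unfolding Q_def by (rule posdef_blockI[OF bA]) (use k b in simp)
  moreover have "lift_pt a x i \<bullet> (Q *v lift_pt a x i) \<le> 1" for i
  proof -
    have "lift_pt a x i \<bullet> (Q *v lift_pt a x i) = b * ((dual_pt a x i - c) \<bullet> (A *v (dual_pt a x i - c))) + (1 - b)"
      unfolding Q_def lift_pt_eq block_quad[OF bA] k
      unfolding inv scaleR_one by (simp add: scaleR_mult_vec)
    also have "\<dots> \<le> b * 1 + (1 - b)"
      using pts[of i] b by (intro add_mono mult_left_mono) (auto simp: ellipsoid_def)
    finally show ?thesis by simp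
  qed
  ultimately show "lifted_feasible a x Q" by (simp add: lifted_feasible_def)
qed

text \<open>For \<open>b = beta Q\<close> the determinant of the optimum \<open>Q\<close> is the one
  that lifting would assign to the ellipsoid read off from it. Lifting a competitor with the same
  \<open>b\<close> lets the common factor cancel, so optimality and uniqueness pass from
  \<open>Q\<close> to the ellipsoid without computing \<open>b\<close>. The second claim is the
  source of upper bounds on \<open>pot\<close>.\<close>

lemma MinCE_eq:
  fixes a :: "'m::finite \<Rightarrow> real^'n"
  assumes P: "full_dim_polytope a" and x: "x \<in> interior (polytope_of a)"
  defines "Q \<equiv> lifted_opt a x"
  shows "MinCE (polar ((\<lambda>p. p - x) ` polytope_of a))
      = (- (matrix_inv (G_block Q) *v z_block Q), (1 / beta Q) *\<^sub>R G_block Q)"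
    and "\<And>c A. posdef A \<Longrightarrow> (\<And>i. dual_pt a x i \<in> ellipsoid c A) \<Longrightarrow> pot a x \<le> ln (vol A)"
proof -
  let ?K = "polar ((\<lambda>p. p - x) ` polytope_of a)"
  define c0 A0 b where "c0 = - (matrix_inv (G_block Q) *v z_block Q)"
    and "A0 = (1 / beta Q) *\<^sub>R G_block Q" and "b = beta Q"
  have fQ: "lifted_feasible a x Q" and pQ: "posdef Q"
    using lifted_opt_feasible[OF P x] by (auto simp: Q_def lifted_feasible_def)
  have b: "0 < b" "b < 1" using beta_pos[OF P x fQ] beta_less_1[OF pQ] by (auto simp: b_def)
  have pA0: "posdef A0" unfolding A0_def using posdef_G_block[OF pQ] b by (intro posdef_scaleR) (auto simp: b_def)
  have G: "G_block Q = b *\<^sub>R A0" using b by (simp add: A0_def b_def)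
  have in0: "dual_pt a x i \<in> ellipsoid c0 A0" for i
  proof -
    have "lift (dual_pt a x i) 1 \<bullet> (Q *v lift (dual_pt a x i) 1) \<le> 1"
      using fQ by (simp add: lifted_feasible_def lift_pt_eq)
    then have "(dual_pt a x i - c0) \<bullet> (G_block Q *v (dual_pt a x i - c0)) \<le> b"
      by (simp add: lifted_quad[OF pQ] c0_def b_def)
    then show ?thesis using b by (simp add: ellipsoid_def A0_def b_def[symmetric]
          scaleR_mult_vec field_simps)
  qed
  have detQ: "det Q = (1 - b) * (b ^ CARD('n) * det A0)"
    using det_lifted[OF pQ] by (simp add: G det_scaleR b_def[symmetric])
  have pw: "0 < (1 - b) * b ^ CARD('n)" using b by simp
  have opt: "det A \<le> det A0 \<and> (det A0 \<le> det A \<longrightarrow> c = c0 \<and> A = A0)"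
    if A: "posdef A" and pts: "\<And>i. dual_pt a x i \<in> ellipsoid c A" for c A
  proof -
    define R where "R = block (b *\<^sub>R A) (- b *\<^sub>R (A *v c)) (b * (c \<bullet> (A *v c)) + 1 - b)"
    have fR: "lifted_feasible a x R" and dR: "det R = (1 - b) * (b ^ CARD('n) * det A)"
      unfolding R_def using ellipsoid_lift[OF A pts b] by auto
    have "((1 - b) * b ^ CARD('n)) * det A \<le> ((1 - b) * b ^ CARD('n)) * det A0"
      using lifted_opt_max[OF P x fR] detQ dR by (simp add: Q_def[symmetric] mult_ac)
    then have le: "det A \<le> det A0" using pw by (simp add: mult_le_cancel_left_pos)
    moreover have "c = c0 \<and> A = A0" if "det A0 \<le> det A"
    proof -
      have "det A = det A0" using that le by simp
      then have "R = Q" using lifted_opt_unique[OF P x fR] detQ dR by (simp add: Q_def[symmetric])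
      then have GR: "G_block Q = b *\<^sub>R A" "z_block Q = - b *\<^sub>R (A *v c)" by (auto simp: R_def)
      then have "A = A0" using G b by simp
      moreover have "z_block Q = G_block Q *v (- c)"
        by (simp add: GR scaleR_mult_vec matrix_vector_mult_minus)
      then have "c = c0" using posdef_matrix_inv[OF posdef_G_block[OF pQ]]
        by (simp add: c0_def matrix_vector_mul_assoc)
      ultimately show ?thesis by simp
    qed
    ultimately show ?thesis by blast
  qed
  have eq: "MinCE (?K) = (c0, A0)"
    unfolding MinCE_def
  proof (rule the_equality)
    show "case (c0, A0) of (c, Q) \<Rightarrow> posdef Q \<and> ?K \<subseteq> ellipsoid c Q \<and>
        (\<forall>c' Q'. posdef Q' \<and> ?K \<subseteq> ellipsoid c' Q' \<longrightarrow> vol Q \<le> vol Q')"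
    proof (simp only: prod.case, intro conjI allI impI)
      show "posdef A0" by (rule pA0)
      show "?K \<subseteq> ellipsoid c0 A0"
        using in0 by (simp add: polar_subset_ellipsoid_iff[OF P x pA0])
      fix c A assume A: "posdef A \<and> ?K \<subseteq> ellipsoid c A"
      then have "dual_pt a x i \<in> ellipsoid c A" for i
        using polar_subset_ellipsoid_iff[OF P x, of A c] by blast
      with A show "vol A0 \<le> vol A" using opt[of A c] vol_le_iff[OF pA0, of A] by blast
    qed
  next
    fix e :: "(real^'n) \<times> (real^'n^'n)"
    obtain c A where e: "e = (c, A)" by (cases e)
    assume "case e of (c, Q) \<Rightarrow> posdef Q \<and> ?K \<subseteq> ellipsoid c Q \<and>
        (\<forall>c' Q'. posdef Q' \<and> ?K \<subseteq> ellipsoid c' Q' \<longrightarrow> vol Q \<le> vol Q')"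
    then have A: "posdef A" "?K \<subseteq> ellipsoid c A"
      and min: "\<And>c' Q'. posdef Q' \<Longrightarrow> ?K \<subseteq> ellipsoid c' Q' \<Longrightarrow> vol A \<le> vol Q'"
      unfolding e by auto
    have pts: "dual_pt a x i \<in> ellipsoid c A" for i
      using A polar_subset_ellipsoid_iff[OF P x, of A c] by blast
    have "?K \<subseteq> ellipsoid c0 A0"
      using in0 by (simp add: polar_subset_ellipsoid_iff[OF P x pA0])
    then have "det A0 \<le> det A" using min[OF pA0] vol_le_iff[OF A(1) pA0] by blast
    then show "e = (c0, A0)" using opt[OF A(1) pts] e by blast
  qed
  then show "MinCE (?K)
      = (- (matrix_inv (G_block Q) *v z_block Q), (1 / beta Q) *\<^sub>R G_block Q)"
    by (simp add: c0_def A0_def)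
  show "pot a x \<le> ln (vol A)" if "posdef A" "\<And>i. dual_pt a x i \<in> ellipsoid c A" for c A
    using opt[OF that] vol_le_iff[OF pA0 that(1)] vol_pos[OF pA0] by (simp add: pot_def eq)
qed

section \<open>The inscribed ellipsoid produced by a step\<close>

lemma new_shape_mult_vec:
  "new_shape Q *v w = (1 - s_block Q) *\<^sub>R (matrix_inv (G_block Q) *v w
     - (1 / beta Q) *\<^sub>R ((z_block Q \<bullet> (matrix_inv (G_block Q) *v w)) *\<^sub>R (matrix_inv (G_block Q) *v z_block Q)))"
proof -
  have "(matrix_inv (G_block Q) ** outer (z_block Q) (z_block Q) ** matrix_inv (G_block Q)) *v w
    = (z_block Q \<bullet> (matrix_inv (G_block Q) *v w)) *\<^sub>R (matrix_inv (G_block Q) *v z_block Q)"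
    by (simp add: matrix_vector_mul_assoc[symmetric] outer_mult_vec matrix_vector_mult_scaleR)
  then show ?thesis
    by (simp add: new_shape_def Let_def scaleR_mult_vec matrix_vector_mult_diff_rdistrib)
qed

text \<open>By Cauchy--Schwarz for the form \<open>F\<close>, the functional \<open>u\<close>
  exceeds its value at the center by at most \<open>sqrt (u \<bullet> (F *v u))\<close> on the
  ellipsoid.\<close>

lemma ellipsoid_in_halfspace:
  fixes F :: "real^'k^'k"
  assumes F: "posdef F" and u: "u \<bullet> c \<le> 1" "u \<bullet> (F *v u) \<le> (1 - u \<bullet> c)^2"
    and y: "y \<in> ellipsoid c (matrix_inv F)"
  shows "u \<bullet> y \<le> 1"
proof -
  have "(u \<bullet> (y - c))^2 \<le> (u \<bullet> (F *v u)) * ((y - c) \<bullet> (matrix_inv F *v (y - c)))"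
    by (rule posdef_cauchy_schwarz[OF F])
  also have "\<dots> \<le> (1 - u \<bullet> c)^2 * 1"
    using y u posdef_quad_nonneg[OF posdef_matrix_inv(1)[OF F]] by (intro mult_mono) (auto simp: ellipsoid_def)
  finally have "u \<bullet> (y - c) \<le> 1 - u \<bullet> c" using u(1) by (simp add: power2_le_iff_abs_le)
  then show ?thesis by (simp add: inner_diff_right)
qed

text \<open>By Sherman--Morrison \<open>new_shape Q\<close> is the inverse of the rank-one update
  \<open>F\<close>, and for \<open>F\<close> the half-space test turns into the lifted constraint
  with a square completed. The argument rests on feasibility and \<open>s < 1\<close>, so it serves
  exact and inexact steps alike.\<close>

lemma new_ellipsoid:
  fixes a :: "'m::finite \<Rightarrow> real^'n"
  assumes P: "full_dim_polytope a" and x: "x \<in> interior (polytope_of a)"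
    and Q: "lifted_feasible a x Q" and s: "0 < 1 - s_block Q"
  shows "posdef (new_shape Q)" "ellipsoid (new_center x Q) (new_shape Q) \<subseteq> polytope_of a"
    "det (new_shape Q) \<le> (1 - s_block Q) ^ CARD('n) / det (G_block Q)"
proof -
  have pQ: "posdef Q" using Q by (simp add: lifted_feasible_def)
  define G Gi z \<sigma> b where "G = G_block Q" and "Gi = matrix_inv (G_block Q)" and "z = z_block Q"
    and "\<sigma> = 1 - s_block Q" and "b = beta Q"
  note defs = G_def Gi_def z_def \<sigma>_def b_def
  have \<sigma>: "0 < \<sigma>" using s by (simp add: \<sigma>_def)
  have b: "0 < b" using beta_pos[OF P x Q] by (simp add: b_def)
  have pG: "posdef G" using posdef_G_block[OF pQ] by (simp add: G_def)
  have GiG: "Gi ** G = mat 1" and pGi: "posdef Gi" and detGi: "det Gi = 1 / det G"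
    using posdef_matrix_inv[OF pG] by (auto simp: Gi_def G_def)
  have beq: "b = \<sigma> + z \<bullet> (Gi *v z)" by (simp add: defs beta_def)
  define F where "F = (1 / \<sigma>) *\<^sub>R (G + (1 / \<sigma>) *\<^sub>R outer z z)"
  have Fv: "F *v v = (1 / \<sigma>) *\<^sub>R (G *v v + ((z \<bullet> v) / \<sigma>) *\<^sub>R z)" for v
    by (simp add: F_def scaleR_mult_vec matrix_vector_mult_add_rdistrib outer_mult_vec)
  have vFv: "v \<bullet> (F *v v) = (1 / \<sigma>) * (v \<bullet> (G *v v) + (z \<bullet> v)^2 / \<sigma>)" for v
    by (simp add: Fv inner_add_right inner_commute power2_eq_square)
  have pF: "posdef F" unfolding posdef_def
  proof (intro conjI allI impI)
    show "transpose F = F" using posdef_sym[OF pG]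
      by (auto simp: F_def transpose_def outer_def vec_eq_iff)
    show "0 < v \<bullet> (F *v v)" if "v \<noteq> 0" for v
      using pG that \<sigma> by (simp add: vFv posdef_def add_pos_nonneg)
  qed
  have E: "new_shape Q *v w = \<sigma> *\<^sub>R (Gi *v w - (1 / b) *\<^sub>R ((z \<bullet> (Gi *v w)) *\<^sub>R (Gi *v z)))" for w
    unfolding defs by (rule new_shape_mult_vec)
  have "new_shape Q *v (F *v v) = v" for v
  proof -
    define r where "r = z \<bullet> v"
    have GiF: "Gi *v (F *v v) = (1 / \<sigma>) *\<^sub>R (v + (r / \<sigma>) *\<^sub>R (Gi *v z))"
      unfolding Fv r_def by (simp add: matrix_vector_mult_scaleR matrix_vector_right_distrib matrix_vector_mul_assoc GiG)
    have "z \<bullet> (Gi *v (F *v v)) = r * b / \<sigma>^2"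
      using \<sigma> by (simp add: GiF inner_add_right r_def[symmetric] beq power2_eq_square field_simps)
    then have "new_shape Q *v (F *v v) = \<sigma> *\<^sub>R ((1 / \<sigma>) *\<^sub>R (v + (r / \<sigma>) *\<^sub>R (Gi *v z)) - (1 / b) *\<^sub>R ((r * b / \<sigma>^2) *\<^sub>R (Gi *v z)))"
      unfolding E GiF by simp
    also have "\<dots> = v" using \<sigma> b by (simp add: algebra_simps power2_eq_square)
    finally show ?thesis .
  qed
  then have "new_shape Q ** F = mat 1" by (simp add: matrix_eq matrix_vector_mul_assoc[symmetric])
  then have Einv: "new_shape Q = matrix_inv F"
    by (metis matrix_inv_unique matrix_left_right_inverse)
  then show pE: "posdef (new_shape Q)" using posdef_matrix_inv[OF pF] by simp
  show "ellipsoid (new_center x Q) (new_shape Q) \<subseteq> polytope_of a"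
    unfolding polytope_of_def
  proof safe
    fix y i assume y: "y \<in> ellipsoid (new_center x Q) (new_shape Q)"
    define p where "p = dual_pt a x i"
    define r where "r = 1 - a i \<bullet> x"
    have r: "0 < r" using x by (simp add: interior_polytope r_def)
    have ai: "a i = r *\<^sub>R p" using r by (simp add: p_def dual_pt_def r_def)
    have feas: "p \<bullet> (G *v p) + 2 * (z \<bullet> p) \<le> \<sigma>"
      using Q lift_dual_pt_quad[OF pQ, of a x i] unfolding lifted_feasible_def p_def defs by (smt (verit))
    have zp: "z \<bullet> p \<le> \<sigma>" using feas posdef_quad_nonneg[OF pG, of p] \<sigma> by linarith
    have c: "1 - a i \<bullet> new_center x Q = r * (1 - (z \<bullet> p) / \<sigma>)"
    proof -
      have "a i \<bullet> new_center x Q = a i \<bullet> x + (1 / \<sigma>) * (a i \<bullet> z)"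
        by (simp add: new_center_def inner_add_right defs)
      also have "a i \<bullet> z = r * (z \<bullet> p)" by (simp add: ai inner_commute)
      finally show ?thesis by (simp add: r_def algebra_simps)
    qed
    show "a i \<bullet> y \<le> 1"
    proof (rule ellipsoid_in_halfspace[OF pF _ _ y[unfolded Einv]])
      have "0 \<le> r * (1 - (z \<bullet> p) / \<sigma>)" using r zp \<sigma> by (simp add: field_simps)
      then show "a i \<bullet> new_center x Q \<le> 1" using c by linarith
      have "a i \<bullet> (F *v a i) = r^2 * (p \<bullet> (F *v p))"
        by (simp add: ai matrix_vector_mult_scaleR power2_eq_square)
      \<comment> \<open>The lifted constraint bounds \<open>p \<bullet> (G *v p)\<close> by
        \<open>\<sigma> - 2 * (z \<bullet> p)\<close>; the rank-one term
        \<open>(z \<bullet> p)^2 / \<sigma>\<close> completes the square.\<close>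
      also have "\<dots> \<le> r^2 * ((1 / \<sigma>) * ((\<sigma> - 2 * (z \<bullet> p)) + (z \<bullet> p)^2 / \<sigma>))"
        unfolding vFv using feas \<sigma> by (intro mult_left_mono add_right_mono) auto
      also have "\<dots> = (1 - a i \<bullet> new_center x Q)^2"
        unfolding c using \<sigma> by (simp add: power2_eq_square field_simps)
      finally show "a i \<bullet> (F *v a i) \<le> (1 - a i \<bullet> new_center x Q)\<^sup>2" .
    qed
  qed
  \<comment> \<open>Dropping the subtracted rank-one term can only enlarge the form.\<close>
  have "det (new_shape Q) \<le> det (\<sigma> *\<^sub>R Gi)"
  proof (rule det_mono_posdef(1)[OF pE])
    show "transpose (\<sigma> *\<^sub>R Gi) = \<sigma> *\<^sub>R Gi" using posdef_scaleR[OF pGi \<sigma>] by (rule posdef_sym)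
    fix v
    have "v \<bullet> (Gi *v z) = z \<bullet> (Gi *v v)"
      using sym_dot[OF posdef_sym[OF pGi], of v z] by (simp add: inner_commute)
    then have "v \<bullet> (new_shape Q *v v) = \<sigma> * (v \<bullet> (Gi *v v) - (z \<bullet> (Gi *v v))^2 / b)"
      by (simp add: E inner_diff_right power2_eq_square)
    also have "\<dots> \<le> \<sigma> * (v \<bullet> (Gi *v v))" using \<sigma> b by (intro mult_left_mono) auto
    finally show "v \<bullet> (new_shape Q *v v) \<le> v \<bullet> ((\<sigma> *\<^sub>R Gi) *v v)"
      by (simp add: scaleR_mult_vec)
  qed
  then show "det (new_shape Q) \<le> (1 - s_block Q) ^ CARD('n) / det (G_block Q)"
    by (simp add: det_scaleR detGi \<sigma>_def G_def)
qed

text \<open>Since \<open>1 - s \<le> beta\<close>, the determinant bound of the step is at most that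
  of \<open>beta\<close> times the inverse of \<open>G\<close>, which is the inverse of the
  \<open>MinCE\<close> matrix and has log-volume \<open>- pot a x\<close>.\<close>

lemma new_shape_opt_vol:
  fixes a :: "'m::finite \<Rightarrow> real^'n"
  assumes P: "full_dim_polytope a" and x: "x \<in> interior (polytope_of a)"
    and s: "0 < 1 - s_block (lifted_opt a x)"
  shows "- pot a x \<le> ln (vol (new_shape (lifted_opt a x)))"
proof -
  define Q where "Q = lifted_opt a x"
  have Q: "lifted_feasible a x Q" and pQ: "posdef Q"
    using lifted_opt_feasible[OF P x] by (auto simp: Q_def lifted_feasible_def)
  have s': "0 < 1 - s_block Q" using s by (simp add: Q_def)
  note E = new_ellipsoid[OF P x Q s']
  have b: "0 < beta Q" by (rule beta_pos[OF P x Q])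
  have pG: "posdef (G_block Q)" by (rule posdef_G_block[OF pQ])
  have dG: "0 < det (G_block Q)" by (rule posdef_det_pos[OF pG])
  have sb: "1 - s_block Q \<le> beta Q"
    using posdef_quad_nonneg[OF posdef_matrix_inv(1)[OF pG]] by (simp add: beta_def)
  have "det (new_shape Q) \<le> (1 - s_block Q) ^ CARD('n) / det (G_block Q)" by (rule E)
  also have "\<dots> \<le> beta Q ^ CARD('n) / det (G_block Q)"
    using sb s' dG by (intro divide_right_mono power_mono) auto
  finally have "ln (det (new_shape Q)) \<le> ln (beta Q ^ CARD('n) / det (G_block Q))"
    using posdef_det_pos[OF E(1)] by (intro ln_mono) auto
  also have "\<dots> = CARD('n) * ln (beta Q) - ln (det (G_block Q))"
    using b dG by (simp add: ln_div ln_realpow)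
  finally have 1: "ln (det (new_shape Q)) \<le> CARD('n) * ln (beta Q) - ln (det (G_block Q))" .
  have pA: "posdef ((1 / beta Q) *\<^sub>R G_block Q)" using b by (intro posdef_scaleR pG) simp
  have "pot a x = ln (vol ((1 / beta Q) *\<^sub>R G_block Q))"
    by (simp add: pot_def MinCE_eq[OF P x] Q_def)
  also have "\<dots> = - ln ((1 / beta Q) ^ CARD('n) * det (G_block Q)) / 2"
    by (simp add: ln_vol[OF pA] det_scaleR)
  also have "ln ((1 / beta Q) ^ CARD('n) * det (G_block Q)) = ln (det (G_block Q)) - CARD('n) * ln (beta Q)"
    using b dG by (simp add: ln_mult ln_realpow ln_div)
  finally show ?thesis using 1 unfolding Q_def[symmetric] ln_vol[OF E(1)] by simp
qed

section \<open>Maximal inscribed ellipsoid\<close>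

lemma ellipsoid_subset_polytope_iff:
  fixes Q :: "real^'n^'n"
  assumes Q: "posdef Q"
  shows "ellipsoid c Q \<subseteq> polytope_of a
    \<longleftrightarrow> (\<forall>i. a i \<bullet> c + sqrt (a i \<bullet> (matrix_inv Q *v a i)) \<le> 1)"
proof
  define S where "S = matrix_inv Q"
  have S: "posdef S" "Q ** S = mat 1" "S ** Q = mat 1" using posdef_matrix_inv[OF Q] by (auto simp: S_def)
  have invS: "matrix_inv S = Q" using S by (intro matrix_inv_unique)
  {
    assume sub: "ellipsoid c Q \<subseteq> polytope_of a"
    have "a i \<bullet> c + sqrt (a i \<bullet> (S *v a i)) \<le> 1" for i
    proof -
      define q where "q = sqrt (a i \<bullet> (S *v a i))"
      have q2: "q^2 = a i \<bullet> (S *v a i)" and q0: "0 \<le> q"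
        using posdef_quad_nonneg[OF S(1)] by (simp_all add: q_def)
      \<comment> \<open>The point of the ellipsoid farthest in direction \<open>a i\<close>. For
        \<open>a i = 0\<close> division by zero gives \<open>y = c\<close>, which still yields the
        claim.\<close>
      define y where "y = c + (1 / q) *\<^sub>R (S *v a i)"
      have "(y - c) \<bullet> (Q *v (y - c)) = (1 / q)^2 * q^2"
        by (simp add: y_def matrix_vector_mult_scaleR matrix_vector_mul_assoc S q2[unfolded power2_eq_square] power2_eq_square inner_commute)
      also have "\<dots> \<le> 1" by (simp add: power_divide)
      finally have "y \<in> ellipsoid c Q" by (simp add: ellipsoid_def)
      then have "a i \<bullet> y \<le> 1" using sub by (auto simp: polytope_of_def)
      moreover have "a i \<bullet> y = a i \<bullet> c + (1 / q) * q^2" by (simp add: y_def inner_add_right q2)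
      ultimately show ?thesis by (simp add: q_def[symmetric] power2_eq_square split: if_splits)
    qed
    then show "\<forall>i. a i \<bullet> c + sqrt (a i \<bullet> (matrix_inv Q *v a i)) \<le> 1" by (simp add: S_def)
  next
    assume *: "\<forall>i. a i \<bullet> c + sqrt (a i \<bullet> (matrix_inv Q *v a i)) \<le> 1"
    show "ellipsoid c Q \<subseteq> polytope_of a" unfolding polytope_of_def
    proof safe
      fix y i assume y: "y \<in> ellipsoid c Q"
      have le: "a i \<bullet> c + sqrt (a i \<bullet> (S *v a i)) \<le> 1" using * by (simp add: S_def)
      have nn: "0 \<le> a i \<bullet> (S *v a i)" by (rule posdef_quad_nonneg[OF S(1)])
      show "a i \<bullet> y \<le> 1"
      proof (rule ellipsoid_in_halfspace[OF S(1)])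
        show "a i \<bullet> c \<le> 1" using le real_sqrt_ge_zero[OF nn] by linarith
        show "a i \<bullet> (S *v a i) \<le> (1 - a i \<bullet> c)\<^sup>2" using le by (intro sqrt_le_D) linarith
        show "y \<in> ellipsoid c (matrix_inv S)" using y by (simp add: invS)
      qed
    qed
  }
qed

text \<open>As in the lifted problem the variable is a factor, now of the inverse matrix: being
  inscribed reads \<open>a i \<bullet> c + norm (transpose M *v a i) \<le> 1\<close>, a closed
  condition on \<open>(c, M)\<close>. An inscribed ball shows that the maximal determinant is not
  zero.\<close>

lemma MaxIE_exists:
  fixes a :: "'m::finite \<Rightarrow> real^'n"
  assumes P: "full_dim_polytope a"
  obtains c Q where "posdef Q" "ellipsoid c Q \<subseteq> polytope_of a"
    "\<And>c' Q'. posdef Q' \<Longrightarrow> ellipsoid c' Q' \<subseteq> polytope_of a \<Longrightarrow> det Q \<le> det Q'"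
proof -
  define K where "K = {e :: (real^'n) \<times> (real^'n^'n). \<forall>i. a i \<bullet> fst e + norm (transpose (snd e) *v a i) \<le> 1}"
  obtain B where B: "\<And>y. y \<in> polytope_of a \<Longrightarrow> norm y \<le> B" "0 < B"
    using P unfolding full_dim_polytope_def by (meson bounded_pos)
  have "closed K" unfolding K_def
  proof (intro closed_Collect_all closed_Collect_le)
    fix i
    have "continuous_on UNIV (\<lambda>e :: (real^'n) \<times> (real^'n^'n). \<chi> j. \<Sum>k\<in>UNIV. snd e $ k $ j * a i $ k)"
      by (intro continuous_intros)
    then have "continuous_on UNIV (\<lambda>e :: (real^'n) \<times> (real^'n^'n). transpose (snd e) *v a i)"
      by (simp add: matrix_vector_mult_def transpose_def)
    then show "continuous_on UNIV (\<lambda>e :: (real^'n) \<times> (real^'n^'n). a i \<bullet> fst e + norm (transpose (snd e) *v a i))"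
      by (intro continuous_intros)
  qed (intro continuous_intros)
  moreover have "bounded K"
  proof -
    have "norm e \<le> B + sqrt (CARD('n) * (2 * B)^2)" if "e \<in> K" for e
    proof -
      obtain c M where e: "e = (c, M)" by (cases e)
      have le: "a i \<bullet> c + norm (transpose M *v a i) \<le> 1" for i using that by (simp add: K_def e)
      have "a i \<bullet> c \<le> 1" for i using le[of i] norm_ge_zero[of "transpose M *v a i"] by linarith
      then have c: "norm c \<le> B" by (intro B) (simp add: polytope_of_def)
      \<comment> \<open>\<open>c + column j M\<close> lies in the polytope, because an entry of
        \<open>transpose M *v a i\<close> is at most its norm; this bounds the factor.\<close>
      have col: "norm (column j M) \<le> 2 * B" for j
      proof -
        have "a i \<bullet> (c + column j M) \<le> 1" for i
        proof -
          have "a i \<bullet> column j M = (transpose M *v a i) $ j"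
            using transpose_dot[of "a i" M "axis j 1"] by (simp add: matrix_vector_mult_basis inner_axis)
          also have "\<dots> \<le> norm (transpose M *v a i)"
            using component_le_norm_cart[of "transpose M *v a i" j] by linarith
          finally show ?thesis using le[of i] by (simp add: inner_add_right)
        qed
        then have "norm (c + column j M) \<le> B" by (intro B) (simp add: polytope_of_def)
        moreover have "norm (column j M) \<le> norm (c + column j M) + norm c"
          by (metis add_diff_cancel_left' norm_triangle_ineq4)
        ultimately show ?thesis using c by linarith
      qed
      have "(norm M)^2 = (\<Sum>j\<in>UNIV. (norm (column j M))^2)"
        by (subst norm_transpose[symmetric]) (simp add: norm_matrix_sq norm_sq_cart transpose_def column_def)
      also have "\<dots> \<le> (\<Sum>j\<in>(UNIV::'n set). (2 * B)^2)" by (intro sum_mono power_mono col) auto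
      finally have "norm M \<le> sqrt (CARD('n) * (2 * B)^2)" by (intro real_le_rsqrt) simp
      moreover have "norm e \<le> norm c + norm M" by (simp add: e norm_Pair sqrt_sum_squares_le_sum)
      ultimately show ?thesis using c by linarith
    qed
    then show ?thesis unfolding bounded_iff by blast
  qed
  ultimately have "compact K" by (simp add: compact_eq_bounded_closed)
  obtain x0 r where r: "0 < r" "cball x0 r \<subseteq> polytope_of a"
    using P unfolding full_dim_polytope_def by (meson mem_interior_cball ex_in_conv)
  have "(x0, diag (\<lambda>_. r)) \<in> K" unfolding K_def
  proof safe
    fix i
    have n: "norm (transpose (diag (\<lambda>_. r)) *v a i) = r * norm (a i)"
    proof -
      have "diag (\<lambda>_. r) *v a i = r *\<^sub>R a i" by (simp add: diag_mult_vec vec_eq_iff)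
      then show ?thesis using r by simp
    qed
    have "x0 + (r / norm (a i)) *\<^sub>R a i \<in> polytope_of a"
      using r by (intro subsetD[OF r(2)]) (simp add: dist_norm)
    then have "a i \<bullet> x0 + (r / norm (a i)) * (norm (a i))^2 \<le> 1"
      by (simp add: polytope_of_def inner_add_right power2_norm_eq_inner)
    then show "a i \<bullet> fst (x0, diag (\<lambda>_. r)) + norm (transpose (snd (x0, diag (\<lambda>_. r))) *v a i) \<le> 1"
      unfolding snd_conv fst_conv n by (simp add: power2_eq_square split: if_splits)
  qed
  moreover have "continuous_on K (\<lambda>e. (det (snd e))^2)" by (intro continuous_intros)
  ultimately obtain e where e: "e \<in> K" "\<And>e'. e' \<in> K \<Longrightarrow> (det (snd e'))^2 \<le> (det (snd e))^2"
    using \<open>compact K\<close> continuous_attains_sup[of K "\<lambda>e. (det (snd e))^2"] by blast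
  have "0 < (det (snd (x0, diag (\<lambda>_::'n. r))))^2" using r by simp
  also have "\<dots> \<le> (det (snd e))^2" by (rule e(2)) fact
  finally have dete: "0 < (det (snd e))^2" .
  then have "invertible (snd e)" by (simp add: invertible_det_nz)
  define S where "S = snd e ** transpose (snd e)"
  have S: "posdef S" unfolding S_def by (rule posdef_mult_transpose) fact
  define Q where "Q = matrix_inv S"
  have Q: "posdef Q" and invQ: "matrix_inv Q = S" and detQ: "det Q = 1 / det S"
    using posdef_matrix_inv[OF S] by (auto simp: Q_def intro: matrix_inv_unique)
  have sq: "sqrt (a i \<bullet> ((M ** transpose M) *v a i)) = norm (transpose M *v a i)" for M :: "real^'n^'n" and i
    by (simp only: quad_mult_transpose norm_eq_sqrt_inner)
  have "ellipsoid (fst e) Q \<subseteq> polytope_of a"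
    using e(1) by (simp add: ellipsoid_subset_polytope_iff[OF Q] invQ S_def sq K_def)
  moreover have "det Q \<le> det Q'" if Q': "posdef Q'" "ellipsoid c' Q' \<subseteq> polytope_of a" for c' Q'
  proof -
    obtain M :: "real^'n^'n" where M: "invertible M" "matrix_inv Q' = M ** transpose M"
      using posdef_factor[OF posdef_matrix_inv(1)[OF Q'(1)]] .
    have "(c', M) \<in> K" using Q'(2) by (simp add: ellipsoid_subset_polytope_iff[OF Q'(1)] M(2) sq K_def)
    from e(2)[OF this] have "(det M)^2 \<le> det S" by (simp add: S_def det_mul power2_eq_square)
    moreover have "1 / det Q' = (det M)^2"
      using posdef_matrix_inv(4)[OF Q'(1)] by (simp add: M(2) det_mul power2_eq_square)
    ultimately have "1 / det Q' \<le> det S" by simp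
    then show ?thesis using posdef_det_pos[OF Q'(1)] posdef_det_pos[OF S] by (simp add: detQ field_simps)
  qed
  ultimately show thesis using Q that by blast
qed

text \<open>Two different optimal shapes would be beaten by the averaged factor at the midpoint of
  the centers, two centers of one shape by stretching it along their difference.\<close>

lemma MaxIE_unique:
  fixes a :: "'m::finite \<Rightarrow> real^'n"
  assumes Q: "posdef Q" "ellipsoid c Q \<subseteq> polytope_of a"
    and opt: "\<And>c' Q'. posdef Q' \<Longrightarrow> ellipsoid c' Q' \<subseteq> polytope_of a \<Longrightarrow> det Q \<le> det Q'"
    and R: "posdef R" "ellipsoid d R \<subseteq> polytope_of a" "det R \<le> det Q"
  shows "d = c \<and> R = Q"
proof -
  define S T where "S = matrix_inv Q" and "T = matrix_inv R"
  note iQ = posdef_matrix_inv[OF Q(1), folded S_def] and iR = posdef_matrix_inv[OF R(1), folded T_def]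
  have det: "det R = det Q" using opt[OF R(1,2)] R(3) by simp
  have better: "det S' \<le> det S" if S': "posdef S'" "\<And>i. a i \<bullet> e + sqrt (a i \<bullet> (S' *v a i)) \<le> 1" for S' e
  proof -
    note i = posdef_matrix_inv[OF S'(1)]
    have "matrix_inv (matrix_inv S') = S'" using i by (intro matrix_inv_unique)
    then have "ellipsoid e (matrix_inv S') \<subseteq> polytope_of a"
      using S'(2) by (simp add: ellipsoid_subset_polytope_iff[OF i(1)])
    from opt[OF i(1) this] have "det Q \<le> 1 / det S'" by (simp add: i(4))
    then show ?thesis using posdef_det_pos[OF S'(1)] posdef_det_pos[OF Q(1)] by (simp add: iQ(4) field_simps)
  qed
  have leS: "a i \<bullet> c + sqrt (a i \<bullet> (S *v a i)) \<le> 1" for i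
    using Q(2) by (simp add: ellipsoid_subset_polytope_iff[OF Q(1)] S_def)
  have leT: "a i \<bullet> d + sqrt (a i \<bullet> (T *v a i)) \<le> 1" for i
    using R(2) by (simp add: ellipsoid_subset_polytope_iff[OF R(1)] T_def)
  have "S = T"
  proof (rule ccontr)
    assume "S \<noteq> T"
    have "det S = det T" by (simp add: iQ(4) iR(4) det)
    from factor_average_det[OF iQ(1) iR(1) \<open>S \<noteq> T\<close> this] obtain M N :: "real^'n^'n" where
      MN: "S = M ** transpose M" "T = N ** transpose N"
      "invertible ((1/2) *\<^sub>R (M + N))" "det S < (det ((1/2) *\<^sub>R (M + N)))^2" .
    define L where "L = (1/2) *\<^sub>R (M + N)"
    have "det (L ** transpose L) \<le> det S"
    proof (rule better[where e = "(1/2) *\<^sub>R (c + d)"])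
      show "posdef (L ** transpose L)" using MN(3) unfolding L_def by (rule posdef_mult_transpose)
      fix i
      have nrm: "sqrt (a i \<bullet> ((X ** transpose X) *v a i)) = norm (transpose X *v a i)" for X :: "real^'n^'n"
        by (simp only: quad_mult_transpose norm_eq_sqrt_inner)
      have "transpose L = (1/2) *\<^sub>R (transpose M + transpose N)"
        by (simp add: L_def transpose_def vec_eq_iff)
      then have "transpose L *v a i = (1/2) *\<^sub>R (transpose M *v a i + transpose N *v a i)"
        by (simp add: scaleR_mult_vec matrix_vector_mult_add_rdistrib)
      then have "norm (transpose L *v a i) \<le> (norm (transpose M *v a i) + norm (transpose N *v a i)) / 2"
        using norm_triangle_ineq[of "transpose M *v a i" "transpose N *v a i"] by simp
      then show "a i \<bullet> ((1/2) *\<^sub>R (c + d)) + sqrt (a i \<bullet> ((L ** transpose L) *v a i)) \<le> 1"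
        using leS[of i] leT[of i] unfolding MN(1,2) nrm by (simp add: inner_add_right field_simps)
    qed
    then show False using MN(4) by (simp add: det_mul power2_eq_square L_def)
  qed
  then have "matrix_inv S = matrix_inv T" by simp
  moreover have "matrix_inv S = Q" "matrix_inv T = R"
    using iQ iR by (auto intro: matrix_inv_unique)
  ultimately have "R = Q" by simp
  moreover have "c = d"
  proof (rule ccontr)
    assume "c \<noteq> d"
    define w where "w = (1/2) *\<^sub>R (c - d)"
    have w: "w \<noteq> 0" using \<open>c \<noteq> d\<close> by (simp add: w_def)
    \<comment> \<open>At the midpoint the stretch raises the support function by at most
      \<open>\<bar>a i \<bullet> w\<bar>\<close>, exactly the room that the two translated copies
      leave.\<close>
    define S' where "S' = S + outer w w"
    have q: "v \<bullet> (S' *v v) = v \<bullet> (S *v v) + (v \<bullet> w)^2" for v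
      by (simp add: S'_def matrix_vector_mult_add_rdistrib outer_mult_vec inner_add_right power2_eq_square inner_commute)
    have sym: "transpose S' = S'" using posdef_sym[OF iQ(1)]
      by (auto simp: S'_def outer_def transpose_def vec_eq_iff)
    have S': "posdef S'" unfolding posdef_def
    proof (intro conjI allI impI sym)
      show "0 < v \<bullet> (S' *v v)" if "v \<noteq> 0" for v
        using iQ(1) that by (simp add: q posdef_def add_pos_nonneg)
    qed
    have "S \<noteq> S'"
    proof
      assume "S = S'"
      then have "(w \<bullet> w)^2 = 0" using q[of w] by simp
      then show False using w by simp
    qed
    then have "det S < det S'" by (intro det_mono_posdef(2) iQ(1) sym) (simp_all add: q)
    moreover have "det S' \<le> det S"
    proof (rule better[OF S', where e = "(1/2) *\<^sub>R (c + d)"])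
      fix i
      have nn: "0 \<le> a i \<bullet> (S *v a i)" by (rule posdef_quad_nonneg[OF iQ(1)])
      have "sqrt (a i \<bullet> (S' *v a i)) \<le> sqrt (a i \<bullet> (S *v a i)) + \<bar>a i \<bullet> w\<bar>"
        unfolding q using sqrt_add_le_add_sqrt[OF nn, of "(a i \<bullet> w)^2"] by simp
      moreover have "a i \<bullet> c = a i \<bullet> ((1/2) *\<^sub>R (c + d)) + a i \<bullet> w" "a i \<bullet> d = a i \<bullet> ((1/2) *\<^sub>R (c + d)) - a i \<bullet> w"
        by (simp_all add: w_def inner_add_right inner_diff_right field_simps)
      ultimately show "a i \<bullet> ((1/2) *\<^sub>R (c + d)) + sqrt (a i \<bullet> (S' *v a i)) \<le> 1"
        using leS[of i] leT[of i] unfolding \<open>S = T\<close>[symmetric] by linarith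
    qed
    ultimately show False by simp
  qed
  ultimately show ?thesis by simp
qed

lemma MaxIE:
  fixes a :: "'m::finite \<Rightarrow> real^'n"
  assumes P: "full_dim_polytope a"
  defines "c \<equiv> fst (MaxIE (polytope_of a))" and "Q \<equiv> snd (MaxIE (polytope_of a))"
  shows MaxIE_posdef: "posdef Q"
    and MaxIE_subset: "ellipsoid c Q \<subseteq> polytope_of a"
    and MaxIE_max: "\<And>c' Q'. posdef Q' \<Longrightarrow> ellipsoid c' Q' \<subseteq> polytope_of a \<Longrightarrow> vol Q' \<le> vol Q"
proof -
  obtain c0 Q0 where Q0: "posdef Q0" "ellipsoid c0 Q0 \<subseteq> polytope_of a"
    "\<And>c' Q'. posdef Q' \<Longrightarrow> ellipsoid c' Q' \<subseteq> polytope_of a \<Longrightarrow> det Q0 \<le> det Q'"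
    using MaxIE_exists[OF P] by metis
  have "MaxIE (polytope_of a) = (c0, Q0)" unfolding MaxIE_def
  proof (rule the_equality)
    show "case (c0, Q0) of (c, Q) \<Rightarrow> posdef Q \<and> ellipsoid c Q \<subseteq> polytope_of a \<and>
       (\<forall>c' Q'. posdef Q' \<and> ellipsoid c' Q' \<subseteq> polytope_of a \<longrightarrow> vol Q' \<le> vol Q)"
      using Q0 vol_le_iff[OF _ Q0(1)] by blast
  next
    fix e :: "(real^'n) \<times> (real^'n^'n)"
    obtain c Q where e: "e = (c, Q)" by (cases e)
    assume "case e of (c, Q) \<Rightarrow> posdef Q \<and> ellipsoid c Q \<subseteq> polytope_of a \<and>
       (\<forall>c' Q'. posdef Q' \<and> ellipsoid c' Q' \<subseteq> polytope_of a \<longrightarrow> vol Q' \<le> vol Q)"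
    then have Q: "posdef Q" "ellipsoid c Q \<subseteq> polytope_of a" "vol Q0 \<le> vol Q"
      using Q0(1,2) by (auto simp: e)
    then have "det Q \<le> det Q0" using Q0(1) by (simp add: vol_le_iff)
    then show "e = (c0, Q0)" using MaxIE_unique[OF Q0(1,2) Q0(3) Q(1,2)] by (simp add: e)
  qed
  then show "posdef Q" "ellipsoid c Q \<subseteq> polytope_of a"
    "\<And>c' Q'. posdef Q' \<Longrightarrow> ellipsoid c' Q' \<subseteq> polytope_of a \<Longrightarrow> vol Q' \<le> vol Q"
    using Q0 by (simp_all add: c_def Q_def vol_le_iff)
qed

lemma ellipsoid_center_interior:
  fixes Q :: "real^'n^'n"
  assumes "posdef Q" "ellipsoid c Q \<subseteq> polytope_of a"
  shows "c \<in> interior (polytope_of a)"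
proof -
  have "a i \<bullet> c < 1" for i
  proof (cases "a i = 0")
    case False
    have "0 < sqrt (a i \<bullet> (matrix_inv Q *v a i))"
      using posdef_matrix_inv(1)[OF assms(1)] False by (simp add: posdef_def)
    moreover have "a i \<bullet> c + sqrt (a i \<bullet> (matrix_inv Q *v a i)) \<le> 1"
      using assms(2) by (simp add: ellipsoid_subset_polytope_iff[OF assms(1)])
    ultimately show ?thesis by linarith
  qed simp
  then show ?thesis by (simp add: interior_polytope)
qed

text \<open>Polarity reverses inclusion: the polar of the inscribed ellipsoid about its center has
  the inverse matrix, covers the polar body and has the reciprocal volume.\<close>

lemma pot_MaxIE_center:
  fixes a :: "'m::finite \<Rightarrow> real^'n"
  assumes P: "full_dim_polytope a"
  shows "pot a (fst (MaxIE (polytope_of a))) \<le> - ln (vol (snd (MaxIE (polytope_of a))))"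
proof -
  define c Q where "c = fst (MaxIE (polytope_of a))" and "Q = snd (MaxIE (polytope_of a))"
  have Q: "posdef Q" "ellipsoid c Q \<subseteq> polytope_of a"
    using MaxIE_posdef[OF P] MaxIE_subset[OF P] by (auto simp: c_def Q_def)
  have int: "c \<in> interior (polytope_of a)" by (rule ellipsoid_center_interior[OF Q])
  define S where "S = matrix_inv Q"
  note S = posdef_matrix_inv[OF Q(1), folded S_def]
  have "pot a c \<le> ln (vol S)"
  proof (rule MinCE_eq(2)[OF P int S(1)])
    fix i
    have r: "0 < 1 - a i \<bullet> c" using int by (simp add: interior_polytope)
    have "sqrt (a i \<bullet> (S *v a i)) \<le> 1 - a i \<bullet> c"
      using Q(2) by (simp add: ellipsoid_subset_polytope_iff[OF Q(1)] S_def algebra_simps)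
    then have "a i \<bullet> (S *v a i) \<le> (1 - a i \<bullet> c)^2" by (rule sqrt_le_D)
    then have "(1 / (1 - a i \<bullet> c))^2 * (a i \<bullet> (S *v a i)) \<le> 1" using r by (simp add: power_divide)
    then have "dual_pt a c i \<bullet> (S *v dual_pt a c i) \<le> 1"
      unfolding dual_pt_def matrix_vector_mult_scaleR by (simp add: power2_eq_square)
    then show "dual_pt a c i \<in> ellipsoid 0 S" by (simp add: ellipsoid_def)
  qed
  also have "ln (vol S) = - ln (vol Q)"
    using posdef_det_pos[OF Q(1)] by (simp add: ln_vol[OF S(1)] ln_vol[OF Q(1)] S(4) ln_div)
  finally show ?thesis by (simp add: c_def Q_def)
qed

text \<open>Both claims come from one chain: \<open>- pot a x\<close> is at most the log-volume of
  the new ellipsoid, which is at most that of the maximal one, which is at most \<open>- pot\<close>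
  at the center of the latter.\<close>

lemma new_shape_opt_gap:
  fixes a :: "'m::finite \<Rightarrow> real^'n"
  assumes P: "full_dim_polytope a" and x: "x \<in> interior (polytope_of a)"
    and s: "0 < 1 - s_block (lifted_opt a x)"
  shows "ln (vol (snd (MaxIE (polytope_of a)))) - delta a x \<le> ln (vol (new_shape (lifted_opt a x)))"
    and "0 \<le> delta a x"
proof -
  note E = new_ellipsoid[OF P x lifted_opt_feasible[OF P x] s]
  have 1: "- pot a x \<le> ln (vol (new_shape (lifted_opt a x)))" by (rule new_shape_opt_vol[OF P x s])
  have 2: "pot a (fst (MaxIE (polytope_of a))) \<le> - ln (vol (snd (MaxIE (polytope_of a))))"
    by (rule pot_MaxIE_center[OF P])
  show "ln (vol (snd (MaxIE (polytope_of a)))) - delta a x \<le> ln (vol (new_shape (lifted_opt a x)))"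
    using 1 2 unfolding delta_def by linarith
  have "ln (vol (new_shape (lifted_opt a x))) \<le> ln (vol (snd (MaxIE (polytope_of a))))"
    using MaxIE_max[OF P E(1,2)] vol_pos[OF E(1)] by (intro ln_mono) auto
  then show "0 \<le> delta a x" using 1 2 unfolding delta_def by linarith
qed

section \<open>Convergence of the inexact process\<close>

lemma GDERIV_lipschitz_segment:
  fixes f :: "'a::real_inner \<Rightarrow> real"
  assumes "\<And>y. y \<in> closed_segment u v \<Longrightarrow> GDERIV f y :> g y"
    and "\<And>y. y \<in> closed_segment u v \<Longrightarrow> norm (g y) \<le> B"
  shows "\<bar>f v - f u\<bar> \<le> B * norm (v - u)"
proof -
  have "norm (f v - f u) \<le> B * norm (v - u)"
  proof (rule differentiable_bound[where S="closed_segment u v" and f'="\<lambda>y h. h \<bullet> g y"])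
    fix y assume y: "y \<in> closed_segment u v"
    show "(f has_derivative (\<lambda>h. h \<bullet> g y)) (at y within closed_segment u v)"
      using assms(1)[OF y] unfolding gderiv_def by (rule has_derivative_at_withinI)
    show "onorm (\<lambda>h. h \<bullet> g y) \<le> B"
    proof (rule onorm_bound)
      show "0 \<le> B" using assms(2)[OF y] norm_ge_zero order_trans by blast
      fix h
      have "norm (h \<bullet> g y) \<le> norm h * norm (g y)" by (simp add: Cauchy_Schwarz_ineq2)
      also have "\<dots> \<le> norm h * B" using assms(2)[OF y] by (intro mult_left_mono) auto
      finally show "norm (h \<bullet> g y) \<le> B * norm h" by (simp add: mult.commute)
    qed
  qed auto
  then show ?thesis by simp
qed

text \<open>The factor 2 inside the logarithm of the budget leaves half of \<open>c\<close>, later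
  \<open>ln (1 / \<gamma>)\<close>, to be shared equally by the center errors and the final volume
  error.\<close>

lemma budget_power_le:
  assumes q: "0 < q" "q < 1" and c: "0 < c" and d: "0 \<le> d"
    and N: "nat \<lceil>log_plus (2 * d / c) / ln (1 / q)\<rceil> \<le> N"
  shows "q ^ N * d \<le> c / 2"
proof (cases "d = 0")
  case False
  then have d0: "0 < d" using d by simp
  have l: "0 < ln (1 / q)" using q by (simp add: ln_div)
  have "ln (2 * d / c) \<le> log_plus (2 * d / c)" using d0 c by (simp add: log_plus_def)
  moreover have "log_plus (2 * d / c) / ln (1 / q) \<le> N" using N by linarith
  ultimately have "ln (2 * d / c) \<le> N * ln (1 / q)" using l by (simp add: pos_divide_le_eq)
  also have "\<dots> = ln ((1 / q) ^ N)" using q by (simp add: ln_realpow)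
  finally have "2 * d / c \<le> (1 / q) ^ N" using d0 c q by simp
  then show ?thesis using q c by (simp add: field_simps)
qed (use c in simp)

text \<open>Each of the five terms of the tolerance is \<open>lam^2 * K^2 / (2 * m^2)\<close> for a
  desired distance \<open>K\<close>: \<open>rho0\<close>, \<open>r0 / (2 * Lctr)\<close>,
  \<open>(1 - q0) / (L0 * Lctr)\<close>,
  \<open>(1 - q0) * ln (1 / \<gamma>) / (4 * L0 * Lctr)\<close> and
  \<open>ln (1 / \<gamma>) / (4 * Lvol)\<close>.\<close>

lemma le_of_tolerance:
  fixes m lam d K e :: real
  assumes "0 < m" "0 < lam" "0 \<le> K" "d \<le> m / lam * sqrt (2 * e)" "e \<le> lam^2 * K^2 / (2 * m^2)"
  shows "d \<le> K"
proof -
  have "2 * e \<le> (lam * K / m)^2" using assms(1,5) by (simp add: field_simps)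
  then have "sqrt (2 * e) \<le> lam * K / m" using assms by (intro real_le_lsqrt) auto
  then have "m / lam * sqrt (2 * e) \<le> m / lam * (lam * K / m)" using assms by (intro mult_left_mono) auto
  also have "\<dots> = K" using assms by simp
  finally show ?thesis using assms(4) by simp
qed

section \<open>Error propagation along the iterates\<close>

context polarity_constants
begin

lemma level_set_interior: "x \<in> level_set a x0 \<Longrightarrow> x \<in> interior (polytope_of a)"
  by (simp add: level_set_def)

lemma sigma_opt_pos: "x \<in> level_set a x0 \<Longrightarrow> 0 < 1 - s_block (lifted_opt a x)"
  using sigma0_min sigma0_pos unfolding is_min_on_def by (meson less_le_trans)

lemma delta_nonneg: "x \<in> level_set a x0 \<Longrightarrow> 0 \<le> delta a x"
  using new_shape_opt_gap(2)[OF polytope level_set_interior sigma_opt_pos] by blast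

lemma x0_level: "x0 \<in> level_set a x0" using x0_interior by (simp add: level_set_def)

definition tol :: "real \<Rightarrow> real" where
  "tol \<gamma> = tolerance CARD('m) \<gamma> q0 lam0 rho0 Lctr Lvol r0 L0"

lemma tol_pos:
  assumes "0 < \<gamma>" "\<gamma> < 1" shows "0 < tol \<gamma>"
proof -
  have "0 < ln (1 / \<gamma>)" using assms by (simp add: ln_div)
  then show ?thesis
    using lam0_pos rho0_pos r0_pos Lctr_pos L0_pos Lvol_pos q0_range
    by (simp add: tol_def tolerance_def)
qed

lemma inexact_error:
  assumes \<gamma>: "0 < \<gamma>" "\<gamma> < 1" and x: "x \<in> level_set a x0" and Q: "lifted_feasible a x Q"
    and acc: "- ln (det Q) \<le> - ln (det (lifted_opt a x)) + tol \<gamma>"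
  defines "d \<equiv> norm (Q - lifted_opt a x)"
  shows "d \<le> rho0" "Lctr * d \<le> r0 / 2" "L0 * (Lctr * d) \<le> (1 - q0) * min 1 (ln (1 / \<gamma>) / 4)"
    "Lvol * d \<le> ln (1 / \<gamma>) / 4"
proof -
  let ?m = "real CARD('m)"
  have m: "0 < ?m" by simp
  have l: "0 < ln (1 / \<gamma>)" using \<gamma> by (simp add: ln_div)
  have "lam0 \<le> lambda_min (lift_gram a x)" using lam0_min x by (simp add: is_min_on_def)
  from lifted_stability[OF polytope level_set_interior[OF x] lam0_pos this Q acc]
  have d: "d \<le> CARD('m) / lam0 * sqrt (2 * tol \<gamma>)" by (simp add: d_def)
  note K = le_of_tolerance[OF m lam0_pos _ d]
  show "d \<le> rho0" by (rule K) (use rho0_pos in \<open>simp_all add: tol_def tolerance_def\<close>)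
  have "d \<le> r0 / (2 * Lctr)"
  proof (rule K)
    have "lam0\<^sup>2 * r0\<^sup>2 / (8 * ?m\<^sup>2 * Lctr\<^sup>2) = lam0\<^sup>2 * (r0 / (2 * Lctr))\<^sup>2 / (2 * ?m\<^sup>2)"
      by (simp add: power_divide power_mult_distrib)
    then show "tol \<gamma> \<le> lam0\<^sup>2 * (r0 / (2 * Lctr))\<^sup>2 / (2 * ?m\<^sup>2)"
      unfolding tol_def tolerance_def by simp
  qed (use r0_pos Lctr_pos in simp)
  then show "Lctr * d \<le> r0 / 2" using Lctr_pos by (simp add: field_simps)
  have "d \<le> (1 - q0) / (L0 * Lctr)"
  proof (rule K)
    have "lam0\<^sup>2 * (1 - q0)\<^sup>2 / (2 * ?m\<^sup>2 * L0\<^sup>2 * Lctr\<^sup>2)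
        = lam0\<^sup>2 * ((1 - q0) / (L0 * Lctr))\<^sup>2 / (2 * ?m\<^sup>2)"
      by (simp add: power_divide power_mult_distrib)
    then show "tol \<gamma> \<le> lam0\<^sup>2 * ((1 - q0) / (L0 * Lctr))\<^sup>2 / (2 * ?m\<^sup>2)"
      unfolding tol_def tolerance_def by simp
  qed (use q0_range L0_pos Lctr_pos in simp)
  then have 1: "L0 * (Lctr * d) \<le> (1 - q0) * 1" using Lctr_pos L0_pos by (simp add: field_simps)
  have "d \<le> (1 - q0) * ln (1 / \<gamma>) / (4 * L0 * Lctr)"
  proof (rule K)
    have "lam0\<^sup>2 * (1 - q0)\<^sup>2 * (ln (1 / \<gamma>))\<^sup>2 / (32 * ?m\<^sup>2 * L0\<^sup>2 * Lctr\<^sup>2)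
        = lam0\<^sup>2 * ((1 - q0) * ln (1 / \<gamma>) / (4 * L0 * Lctr))\<^sup>2 / (2 * ?m\<^sup>2)"
      by (simp add: power_divide power_mult_distrib mult_ac)
    then show "tol \<gamma> \<le> lam0\<^sup>2 * ((1 - q0) * ln (1 / \<gamma>) / (4 * L0 * Lctr))\<^sup>2 / (2 * ?m\<^sup>2)"
      unfolding tol_def tolerance_def by simp
  qed (use q0_range L0_pos Lctr_pos l in simp)
  then have 2: "L0 * (Lctr * d) \<le> (1 - q0) * (ln (1 / \<gamma>) / 4)" using Lctr_pos L0_pos by (simp add: field_simps)
  show "L0 * (Lctr * d) \<le> (1 - q0) * min 1 (ln (1 / \<gamma>) / 4)"
    using 1 2 by (simp add: min_def)
  have "d \<le> ln (1 / \<gamma>) / (4 * Lvol)"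
  proof (rule K)
    have "lam0\<^sup>2 * (ln (1 / \<gamma>))\<^sup>2 / (32 * ?m\<^sup>2 * Lvol\<^sup>2)
        = lam0\<^sup>2 * (ln (1 / \<gamma>) / (4 * Lvol))\<^sup>2 / (2 * ?m\<^sup>2)"
      by (simp add: power_divide power_mult_distrib)
    then show "tol \<gamma> \<le> lam0\<^sup>2 * (ln (1 / \<gamma>) / (4 * Lvol))\<^sup>2 / (2 * ?m\<^sup>2)"
      unfolding tol_def tolerance_def by simp
  qed (use Lvol_pos l in simp)
  then show "Lvol * d \<le> ln (1 / \<gamma>) / 4" using Lvol_pos by (simp add: field_simps)
qed

lemma inexact_step:
  assumes \<gamma>: "0 < \<gamma>" "\<gamma> < 1" and x: "x \<in> level_set a x0" and Q: "lifted_feasible a x Q"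
    and acc: "- ln (det Q) \<le> - ln (det (lifted_opt a x)) + tol \<gamma>"
  shows "posdef (new_shape Q)" "ellipsoid (new_center x Q) (new_shape Q) \<subseteq> polytope_of a"
    "delta a (new_center x Q) \<le> q0 * delta a x + (1 - q0) * min 1 (ln (1 / \<gamma>) / 4)"
    "ln (vol (new_shape (lifted_opt a x))) - ln (1 / \<gamma>) / 4 \<le> ln (vol (new_shape Q))"
proof -
  define d where "d = norm (Q - lifted_opt a x)"
  note err = inexact_error[OF \<gamma> x Q acc, folded d_def]
  \<comment> \<open>The margin at radius \<open>rho0\<close> keeps the inexact \<open>1 - s\<close>
    positive, which makes the new ellipsoid inscribed.\<close>
  have "0 < 1 - s_block Q" using rho0_margin[OF x Q] err(1) sigma0_pos by (simp add: d_def)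
  note E = new_ellipsoid[OF polytope level_set_interior[OF x] Q this]
  show "posdef (new_shape Q)" "ellipsoid (new_center x Q) (new_shape Q) \<subseteq> polytope_of a"
    by (rule E)+
  define u v where "u = polarity_map a x" and "v = new_center x Q"
  have uv: "norm (v - u) \<le> Lctr * d"
    using Lctr_lipschitz[OF x Q] err(1) by (simp add: u_def v_def d_def)
  obtain g where g: "\<forall>y\<in>{y. infdist y (polarity_map a ` level_set a x0) \<le> r0 / 2}. GDERIV (delta a) y :> g y"
    "is_max_on (\<lambda>y. norm (g y)) {y. infdist y (polarity_map a ` level_set a x0) \<le> r0 / 2} L0"
    using L0_max by blast
  \<comment> \<open>The segment from the exact to the inexact center must stay where the gradient is
    bounded; it starts in the image of the level set and is at most \<open>r0 / 2\<close>
    long.\<close>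
  have seg: "y \<in> {y. infdist y (polarity_map a ` level_set a x0) \<le> r0 / 2}" if "y \<in> closed_segment u v" for y
  proof -
    have "infdist y (polarity_map a ` level_set a x0) \<le> dist y u"
      using x by (intro infdist_le) (simp add: u_def)
    also have "\<dots> \<le> norm (v - u)" using segment_bound(1)[OF that] by (simp add: dist_norm)
    also have "\<dots> \<le> r0 / 2" using uv err(2) by linarith
    finally show ?thesis by simp
  qed
  have "\<bar>delta a v - delta a u\<bar> \<le> L0 * norm (v - u)"
    using g seg by (intro GDERIV_lipschitz_segment[where g=g]) (auto simp: is_max_on_def)
  also have "\<dots> \<le> L0 * (Lctr * d)" using L0_pos uv by (intro mult_left_mono) auto
  also have "\<dots> \<le> (1 - q0) * min 1 (ln (1 / \<gamma>) / 4)" by (rule err)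
  finally have "delta a v \<le> delta a u + (1 - q0) * min 1 (ln (1 / \<gamma>) / 4)" by linarith
  then show "delta a (new_center x Q) \<le> q0 * delta a x + (1 - q0) * min 1 (ln (1 / \<gamma>) / 4)"
    using q0_contraction[OF x] by (simp add: u_def v_def)
  have "\<bar>ln (vol (new_shape Q)) - ln (vol (new_shape (lifted_opt a x)))\<bar> \<le> Lvol * d"
    using Lvol_lipschitz[OF x Q] err(1) by (simp add: d_def)
  then show "ln (vol (new_shape (lifted_opt a x))) - ln (1 / \<gamma>) / 4 \<le> ln (vol (new_shape Q))"
    using err(4) by linarith
qed

text \<open>Errors do not pile up: a step error of \<open>(1 - q0) * c\<close> is absorbed by the
  contraction, as \<open>q0 * c + (1 - q0) * c = c\<close>. The bound \<open>c \<le> 1\<close> keeps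
  the iterates in the level set, \<open>c \<le> ln (1 / \<gamma>) / 4\<close> serves the final
  volume. The oracle is assumed correct at points of the level set only, so that a solver with a
  guarantee at interior points can take its place.\<close>

lemma iterates_in_level_set:
  assumes \<gamma>: "0 < \<gamma>" "\<gamma> < 1" and start: "xs 0 = x0"
    and orcl: "\<And>k. k \<le> N \<Longrightarrow> xs k \<in> level_set a x0 \<Longrightarrow> lifted_feasible a (xs k) (Qs k) \<and>
      - ln (det (Qs k)) \<le> - ln (det (lifted_opt a (xs k))) + tol \<gamma> \<and>
      xs (Suc k) = new_center (xs k) (Qs k)"
    and k: "k \<le> N"
  shows "xs k \<in> level_set a x0 \<and> delta a (xs k) \<le> q0 ^ k * delta a x0 + min 1 (ln (1 / \<gamma>) / 4)"
  using k
proof (induction k)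
  case 0
  have "0 < ln (1 / \<gamma>)" using \<gamma> by (simp add: ln_div)
  then show ?case using x0_level by (simp add: start)
next
  case (Suc k)
  define c where "c = min 1 (ln (1 / \<gamma>) / 4)"
  have x: "xs k \<in> level_set a x0" and dk: "delta a (xs k) \<le> q0 ^ k * delta a x0 + c"
    using Suc by (auto simp: c_def)
  note orc = orcl[OF Suc_leD[OF Suc.prems] x]
  note step = inexact_step[OF \<gamma> x conjunct1[OF orc] conjunct1[OF conjunct2[OF orc]], folded c_def]
  have xS: "xs (Suc k) = new_center (xs k) (Qs k)" using orc by blast
  have "delta a (xs (Suc k)) \<le> q0 * delta a (xs k) + (1 - q0) * c" using step(3) by (simp add: xS)
  also have "\<dots> \<le> q0 * (q0 ^ k * delta a x0 + c) + (1 - q0) * c"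
    using dk q0_range by (intro add_right_mono mult_left_mono) auto
  finally have d: "delta a (xs (Suc k)) \<le> q0 ^ Suc k * delta a x0 + c" by (simp add: algebra_simps)
  have "q0 ^ Suc k * delta a x0 \<le> 1 * delta a x0"
    using q0_range delta_nonneg[OF x0_level] by (intro mult_right_mono power_le_one) auto
  then have "delta a (xs (Suc k)) \<le> delta a x0 + 1" using d by (simp add: c_def)
  then have "pot a (xs (Suc k)) \<le> pot a x0 + 1" by (simp add: delta_def)
  \<comment> \<open>The center of a nondegenerate inscribed ellipsoid is an interior point.\<close>
  moreover have "xs (Suc k) \<in> interior (polytope_of a)"
    unfolding xS by (rule ellipsoid_center_interior[OF step(1,2)])
  ultimately have "xs (Suc k) \<in> level_set a x0" by (simp add: level_set_def)
  with d show ?case by (simp add: c_def)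
qed

theorem inexact_run_gamma_maximal:
  assumes \<gamma>: "0 < \<gamma>" "\<gamma> < 1" and N: "N = budget \<gamma> q0 (delta a x0)"
    and run: "inexact_polarity_run a x0 (tol \<gamma>) N xs Qs"
  shows "gamma_maximal a \<gamma> (xs (N + 1)) (new_shape (Qs N))"
proof -
  have l: "0 < ln (1 / \<gamma>)" using \<gamma> by (simp add: ln_div)
  have orc: "lifted_feasible a (xs k) (Qs k) \<and>
      - ln (det (Qs k)) \<le> - ln (det (lifted_opt a (xs k))) + tol \<gamma> \<and>
      xs (Suc k) = new_center (xs k) (Qs k)" if "k \<le> N" for k
    using run that by (simp add: inexact_polarity_run_def)
  have start: "xs 0 = x0" using run by (simp add: inexact_polarity_run_def)
  have x: "xs N \<in> level_set a x0"
    and dN: "delta a (xs N) \<le> q0 ^ N * delta a x0 + min 1 (ln (1 / \<gamma>) / 4)"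
    using iterates_in_level_set[OF \<gamma> start orc, of N N] by auto
  have "q0 ^ N * delta a x0 \<le> ln (1 / \<gamma>) / 2"
    using N unfolding budget_def by (intro budget_power_le q0_range l delta_nonneg x0_level) simp
  then have gap: "delta a (xs N) \<le> 3 / 4 * ln (1 / \<gamma>)" using dN by linarith
  have oN: "lifted_feasible a (xs N) (Qs N)"
    "- ln (det (Qs N)) \<le> - ln (det (lifted_opt a (xs N))) + tol \<gamma>"
    "xs (N + 1) = new_center (xs N) (Qs N)" using orc[of N] by auto
  note step = inexact_step[OF \<gamma> x oN(1,2)]
  define V where "V = vol (snd (MaxIE (polytope_of a)))"
  have V: "0 < V" unfolding V_def by (rule vol_pos[OF MaxIE_posdef[OF polytope]])
  have "ln V - delta a (xs N) \<le> ln (vol (new_shape (lifted_opt a (xs N))))"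
    unfolding V_def by (rule new_shape_opt_gap(1)[OF polytope level_set_interior[OF x] sigma_opt_pos[OF x]])
  then have "ln V - ln (1 / \<gamma>) \<le> ln (vol (new_shape (Qs N)))" using step(4) gap by linarith
  also have "ln V - ln (1 / \<gamma>) = ln (\<gamma> * V)" using V \<gamma> by (simp add: ln_mult ln_div)
  finally have "\<gamma> * V \<le> vol (new_shape (Qs N))" using V \<gamma> vol_pos[OF step(1)] by simp
  then show ?thesis using step(1,2) unfolding gamma_maximal_def V_def oN(3) by simp
qed

text \<open>Volume is the determinant to the power \<open>- 1 / 2\<close>, so the relative accuracy
  \<open>1 + \<eta> \<le> exp (\<epsilon> / 2)\<close> is an additive accuracy
  \<open>\<epsilon>\<close> of \<open>- ln det\<close>. The solver needs interior points, and the
  iterates are interior because the solver is accurate; one induction settles both.\<close>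

lemma solver_run:
  assumes \<gamma>: "0 < \<gamma>" "\<gamma> < 1"
    and S: "khachiyan_guarantee S B"
    and xs: "xs 0 = x0" "\<And>k. xs (Suc k) = new_center (xs k) (solver_point (S (solver_accuracy (tol \<gamma>))) a (xs k))"
  shows "inexact_polarity_run a x0 (tol \<gamma>) N xs (\<lambda>k. solver_point (S (solver_accuracy (tol \<gamma>))) a (xs k))"
    and "\<And>k. k \<le> N \<Longrightarrow> xs k \<in> interior (polytope_of a)"
proof -
  define \<eta> where "\<eta> = solver_accuracy (tol \<gamma>)"
  have \<eta>: "0 < \<eta>" "\<eta> \<le> 1" "1 + \<eta> \<le> exp (tol \<gamma> / 2)"
    using tol_pos[OF \<gamma>] by (auto simp: \<eta>_def solver_accuracy_def)
  have orc: "lifted_feasible a (xs k) (solver_point (S \<eta>) a (xs k)) \<and>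
      - ln (det (solver_point (S \<eta>) a (xs k))) \<le> - ln (det (lifted_opt a (xs k))) + tol \<gamma> \<and>
      xs (Suc k) = new_center (xs k) (solver_point (S \<eta>) a (xs k))" if x: "xs k \<in> level_set a x0" for k
  proof -
    let ?Q = "solver_point (S \<eta>) a (xs k)" and ?O = "lifted_opt a (xs k)"
    have Q: "lifted_feasible a (xs k) ?Q" "vol ?Q \<le> (1 + \<eta>) * vol ?O"
      using S polytope level_set_interior[OF x] \<eta> unfolding khachiyan_guarantee_def by auto
    have pQ: "posdef ?Q" "posdef ?O"
      using Q(1) lifted_opt_feasible[OF polytope level_set_interior[OF x]] by (auto simp: lifted_feasible_def)
    have "vol ?Q \<le> exp (tol \<gamma> / 2) * vol ?O"
      using Q(2) mult_right_mono[OF \<eta>(3), of "vol ?O"] vol_pos[OF pQ(2)] by linarith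
    then have "ln (vol ?Q) \<le> ln (exp (tol \<gamma> / 2) * vol ?O)"
      using vol_pos[OF pQ(1)] by (intro ln_mono) auto
    also have "\<dots> = tol \<gamma> / 2 + ln (vol ?O)" using vol_pos[OF pQ(2)] by (simp add: ln_mult)
    finally have "- ln (det ?Q) \<le> - ln (det ?O) + tol \<gamma>" by (simp add: ln_vol[OF pQ(1)] ln_vol[OF pQ(2)])
    then show ?thesis using Q(1) xs(2)[of k] by (simp add: \<eta>_def)
  qed
  have x: "xs k \<in> level_set a x0" if "k \<le> N" for k
    using iterates_in_level_set[OF \<gamma> xs(1) orc that] by blast
  then show "\<And>k. k \<le> N \<Longrightarrow> xs k \<in> interior (polytope_of a)" using level_set_interior by blast
  show "inexact_polarity_run a x0 (tol \<gamma>) N xs (\<lambda>k. solver_point (S (solver_accuracy (tol \<gamma>))) a (xs k))"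
    using x orc xs(1) by (simp add: inexact_polarity_run_def \<eta>_def)
qed

end

text \<open>The lifted points span a space of dimension \<open>n + 1\<close>. The inequality is what
  lets a cost of \<open>n^3\<close> be absorbed into \<open>m n^2\<close>.\<close>

lemma card_constraints:
  fixes a :: "'m::finite \<Rightarrow> real^'n"
  assumes P: "full_dim_polytope a"
  shows "CARD('n) + 1 \<le> CARD('m)"
proof -
  obtain x where x: "x \<in> interior (polytope_of a)" using P by (auto simp: full_dim_polytope_def)
  let ?H = "range (lift_pt a x)"
  have "span ?H = UNIV"
  proof (rule ccontr)
    assume "span ?H \<noteq> UNIV"
    then have "span ?H \<subset> span UNIV" by auto
    then obtain w where w: "w \<noteq> 0" "\<And>y. y \<in> span ?H \<Longrightarrow> orthogonal w y"
      using orthogonal_to_subspace_exists_gen[of ?H UNIV] by auto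
    obtain i where "w \<bullet> lift_pt a x i \<noteq> 0" using lift_pts_spanning[OF P x w(1)] by blast
    moreover have "orthogonal w (lift_pt a x i)" by (intro w(2) span_base) simp
    ultimately show False by (simp add: orthogonal_def)
  qed
  then have "CARD('n option) = dim ?H"
    by (metis dim_span dim_UNIV DIM_cart DIM_real mult.right_neutral)
  also have "\<dots> \<le> card ?H" by (rule dim_le_card') simp
  also have "\<dots> \<le> CARD('m)" by (rule card_image_le) simp
  finally show ?thesis by simp
qed

section \<open>Programs and their cost\<close>

fun valid_opd :: "nat \<Rightarrow> 'i operand \<Rightarrow> bool" where
  "valid_opd t (Tmp k) \<longleftrightarrow> k < t"
| "valid_opd t _ \<longleftrightarrow> True"

text \<open>\<open>off\<close> counts the temporaries of the host, \<open>c\<close> those of the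
  guest so far. A guest temporary that does not exist reads as 0; the literal preserves this value
  when later operations lengthen the list.\<close>

fun subst_opd :: "('i \<Rightarrow> 'j operand) \<Rightarrow> nat \<Rightarrow> nat \<Rightarrow> 'i operand \<Rightarrow> 'j operand" where
  "subst_opd inp off c (In i) = inp i"
| "subst_opd inp off c (Tmp k) = (if k < c then Tmp (off + k) else Lit 0)"
| "subst_opd inp off c (Lit r) = Lit r"

text \<open>The leaves of a tree differ in their output operands and in the number of temporaries on
  their paths, so what follows is a continuation to which each leaf hands its own.\<close>

primrec graft :: "('i, 'o) prog \<Rightarrow> ('i \<Rightarrow> 'j operand) \<Rightarrow> nat \<Rightarrow> nat \<Rightarrow>
    (nat \<Rightarrow> ('o \<Rightarrow> 'j operand) \<Rightarrow> ('j, 'p) prog) \<Rightarrow> ('j, 'p) prog" where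
  "graft (Halt out) inp off c K = K (off + c) (\<lambda>j. subst_opd inp off c (out j))"
| "graft (Arith f u w p) inp off c K =
     Arith f (subst_opd inp off c u) (subst_opd inp off c w) (graft p inp off (Suc c) K)"
| "graft (IfLe u w p q) inp off c K =
     IfLe (subst_opd inp off c u) (subst_opd inp off c w) (graft p inp off c K) (graft q inp off c K)"

lemma fetch_append: "valid_opd (length ts) u \<Longrightarrow> fetch \<sigma> (ts @ ts') u = fetch \<sigma> ts u"
  by (cases u) (auto simp: nth_append)

lemma valid_opd_mono: "valid_opd t u \<Longrightarrow> t \<le> t' \<Longrightarrow> valid_opd t' u"
  by (cases u) auto

context
  fixes inp :: "'i \<Rightarrow> 'j operand" and base :: "real list" and \<sigma> :: "'j \<Rightarrow> real" and \<tau> :: "'i \<Rightarrow> real"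
  assumes inp_valid: "\<And>i. valid_opd (length base) (inp i)"
    and inp_fetch: "\<And>i. fetch \<sigma> base (inp i) = \<tau> i"
begin

lemma fetch_subst:
  "fetch \<sigma> (base @ loc) (subst_opd inp (length base) (length loc) u) = fetch \<tau> loc u"
  by (cases u) (auto simp: fetch_append inp_valid inp_fetch nth_append)

lemma valid_subst: "valid_opd (length base + c) (subst_opd inp (length base) c u)"
  by (cases u) (auto intro: valid_opd_mono[OF inp_valid])

text \<open>\<open>ext\<close> holds the temporaries of the path taken and \<open>out\<close> the
  outputs of the leaf reached; both depend on the input, hence the existential form. Validity of
  \<open>out\<close> ensures that the outputs survive later operations.\<close>

lemma exec_graft:
  "\<exists>ext out. (\<forall>j. valid_opd (length (base @ loc @ ext)) (out j)) \<and>
     fst (exec p \<tau> loc) = (\<lambda>j. fetch \<sigma> (base @ loc @ ext) (out j)) \<and>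
     exec (graft p inp (length base) (length loc) K) \<sigma> (base @ loc) =
       (fst (exec (K (length (base @ loc @ ext)) out) \<sigma> (base @ loc @ ext)),
        snd (exec p \<tau> loc) + snd (exec (K (length (base @ loc @ ext)) out) \<sigma> (base @ loc @ ext)))"
proof (induction p arbitrary: loc)
  case (Halt out)
  show ?case
    by (rule exI[of _ "[]"], rule exI[of _ "\<lambda>j. subst_opd inp (length base) (length loc) (out j)"])
      (simp add: fetch_subst valid_subst)
next
  case (Arith f u w p)
  define v where "v = apply_aop f (fetch \<tau> loc u) (fetch \<tau> loc w)"
  from Arith.IH[of "loc @ [v]"] obtain ext out where
    *: "\<forall>j. valid_opd (length (base @ (loc @ [v]) @ ext)) (out j)"
     "fst (exec p \<tau> (loc @ [v])) = (\<lambda>j. fetch \<sigma> (base @ (loc @ [v]) @ ext) (out j))"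
     "exec (graft p inp (length base) (length (loc @ [v])) K) \<sigma> (base @ loc @ [v]) =
       (fst (exec (K (length (base @ (loc @ [v]) @ ext)) out) \<sigma> (base @ (loc @ [v]) @ ext)),
        snd (exec p \<tau> (loc @ [v])) + snd (exec (K (length (base @ (loc @ [v]) @ ext)) out) \<sigma> (base @ (loc @ [v]) @ ext)))"
    by blast
  show ?case
    using * by (intro exI[of _ "v # ext"] exI[of _ out]) (simp add: fetch_subst v_def case_prod_unfold)
next
  case (IfLe u w p q)
  show ?case
  proof (cases "fetch \<tau> loc u \<le> fetch \<tau> loc w")
    case True
    with IfLe.IH(1)[of loc] show ?thesis by (simp add: fetch_subst case_prod_unfold prod_eq_iff)
  next
    case False
    with IfLe.IH(2)[of loc] show ?thesis by (simp add: fetch_subst case_prod_unfold prod_eq_iff)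
  qed
qed

end

section \<open>Composition of programs and cost bounds\<close>

definition seq_prog :: "('i, 'k) prog \<Rightarrow> ('k, 'o) prog \<Rightarrow> ('i, 'o) prog" where
  "seq_prog p q = graft p In 0 0 (\<lambda>t out. graft q out t 0 (\<lambda>_. Halt))"

definition pair_prog :: "('i, 'o) prog \<Rightarrow> ('i, 'p) prog \<Rightarrow> ('i, 'o + 'p) prog" where
  "pair_prog p q = graft p In 0 0 (\<lambda>t out. graft q In t 0 (\<lambda>_ out'. Halt (case_sum out out')))"

lemma exec_seq_prog:
  fixes p :: "('a, 'b) prog" and q :: "('b, 'c) prog"
  shows
  "prog_result (seq_prog p q) \<sigma> = prog_result q (prog_result p \<sigma>)"
  "op_count (seq_prog p q) \<sigma> = op_count p \<sigma> + op_count q (prog_result p \<sigma>)"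
proof -
  define K where "K = (\<lambda>t out. graft q out t 0 (\<lambda>_. Halt) :: ('a, 'c) prog)"
  from exec_graft[of "[]" In \<sigma> \<sigma> "[]" p K] obtain ext out where
    p: "\<forall>j. valid_opd (length ext) (out j)" "fst (exec p \<sigma> []) = (\<lambda>j. fetch \<sigma> ext (out j))"
     "exec (graft p In 0 0 K) \<sigma> [] = (fst (exec (K (length ext) out) \<sigma> ext),
        snd (exec p \<sigma> []) + snd (exec (K (length ext) out) \<sigma> ext))"
    by auto
  have f: "fetch \<sigma> ext (out j) = prog_result p \<sigma> j" for j by (simp add: prog_result_def p(2))
  from exec_graft[of ext out \<sigma> "prog_result p \<sigma>" "[]" q "\<lambda>_. Halt"] p(1) f obtain ext' out' where
    q: "fst (exec q (prog_result p \<sigma>) []) = (\<lambda>j. fetch \<sigma> (ext @ ext') (out' j))"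
     "exec (graft q out (length ext) 0 (\<lambda>_. Halt)) \<sigma> ext = (fst (exec (Halt out') \<sigma> (ext @ ext')),
        snd (exec q (prog_result p \<sigma>) []) + snd (exec (Halt out') \<sigma> (ext @ ext')))"
    by auto
  have "exec (seq_prog p q) \<sigma> [] = (prog_result q (prog_result p \<sigma>), op_count p \<sigma> + op_count q (prog_result p \<sigma>))"
    unfolding seq_prog_def K_def[symmetric] p(3) unfolding K_def q(2)
    by (simp add: prog_result_def op_count_def q(1)[unfolded prog_result_def])
  then show "prog_result (seq_prog p q) \<sigma> = prog_result q (prog_result p \<sigma>)"
    "op_count (seq_prog p q) \<sigma> = op_count p \<sigma> + op_count q (prog_result p \<sigma>)"
    by (simp_all add: prog_result_def[of "seq_prog p q"] op_count_def[of "seq_prog p q"])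
qed

lemma exec_pair_prog:
  fixes p :: "('a, 'b) prog" and q :: "('a, 'c) prog"
  shows
  "prog_result (pair_prog p q) \<sigma> = case_sum (prog_result p \<sigma>) (prog_result q \<sigma>)"
  "op_count (pair_prog p q) \<sigma> = op_count p \<sigma> + op_count q \<sigma>"
proof -
  define K where "K = (\<lambda>t out. graft q In t 0 (\<lambda>_ out'. Halt (case_sum out out')) :: ('a, 'b + 'c) prog)"
  from exec_graft[of "[]" In \<sigma> \<sigma> "[]" p K] obtain ext out where
    p: "\<forall>j. valid_opd (length ext) (out j)" "fst (exec p \<sigma> []) = (\<lambda>j. fetch \<sigma> ext (out j))"
     "exec (graft p In 0 0 K) \<sigma> [] = (fst (exec (K (length ext) out) \<sigma> ext),
        snd (exec p \<sigma> []) + snd (exec (K (length ext) out) \<sigma> ext))"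
    by auto
  from exec_graft[of ext In \<sigma> \<sigma> "[]" q "\<lambda>_ out'. Halt (case_sum out out')"] obtain ext' out' where
    q: "fst (exec q \<sigma> []) = (\<lambda>j. fetch \<sigma> (ext @ ext') (out' j))"
     "exec (graft q In (length ext) 0 (\<lambda>_ out'. Halt (case_sum out out'))) \<sigma> ext
       = (fst (exec (Halt (case_sum out out')) \<sigma> (ext @ ext')),
        snd (exec q \<sigma> []) + snd (exec (Halt (case_sum out out')) \<sigma> (ext @ ext')))"
    by auto
  have "(\<lambda>j. fetch \<sigma> (ext @ ext') (case_sum out out' j)) = case_sum (prog_result p \<sigma>) (prog_result q \<sigma>)"
    using p(1) by (auto simp: fun_eq_iff prog_result_def p(2) q(1) fetch_append split: sum.split)
  then have "exec (pair_prog p q) \<sigma> [] = (case_sum (prog_result p \<sigma>) (prog_result q \<sigma>), op_count p \<sigma> + op_count q \<sigma>)"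
    unfolding pair_prog_def K_def[symmetric] p(3) unfolding K_def q(2)
    by (simp add: op_count_def)
  then show "prog_result (pair_prog p q) \<sigma> = case_sum (prog_result p \<sigma>) (prog_result q \<sigma>)"
    "op_count (pair_prog p q) \<sigma> = op_count p \<sigma> + op_count q \<sigma>"
    by (simp_all add: prog_result_def[of "pair_prog p q"] op_count_def[of "pair_prog p q"])
qed

text \<open>One program has to serve all instances \<open>z\<close> in \<open>I\<close>; outside
  \<open>I\<close> neither its result nor its cost is constrained. Input and output are both
  encodings of \<open>z\<close>, so an algorithm becomes a chain of encodings.\<close>

definition computable :: "'z set \<Rightarrow> ('z \<Rightarrow> 'i \<Rightarrow> real) \<Rightarrow> ('z \<Rightarrow> 'o \<Rightarrow> real) \<Rightarrow> real \<Rightarrow> bool" where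
  "computable I inp f c \<longleftrightarrow>
     (\<exists>p. \<forall>z\<in>I. prog_result p (inp z) = f z \<and> real (op_count p (inp z)) \<le> c)"

lemma computable_mono: "computable I inp f c \<Longrightarrow> c \<le> d \<Longrightarrow> computable I inp f d"
  unfolding computable_def by (meson order_trans)

lemma computable_cong:
  "computable I inp f c \<Longrightarrow> (\<And>z. z \<in> I \<Longrightarrow> f z = g z) \<Longrightarrow> (\<And>z. z \<in> I \<Longrightarrow> inp z = inp' z)
    \<Longrightarrow> computable I inp' g c"
  unfolding computable_def by metis

lemma computable_subst:
  assumes "computable J inp f c" "\<And>z. z \<in> I \<Longrightarrow> h z \<in> J"
  shows "computable I (\<lambda>z. inp (h z)) (\<lambda>z. f (h z)) c"
  using assms unfolding computable_def by blast

lemma computable_comp: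
  assumes "computable I inp f c" "computable I f g d" shows "computable I inp g (c + d)"
proof -
  obtain p q where "\<And>z. z \<in> I \<Longrightarrow> prog_result p (inp z) = f z \<and> real (op_count p (inp z)) \<le> c"
    "\<And>z. z \<in> I \<Longrightarrow> prog_result q (f z) = g z \<and> real (op_count q (f z)) \<le> d"
    using assms unfolding computable_def by blast
  then show ?thesis unfolding computable_def
    by (intro exI[of _ "seq_prog p q"]) (auto simp: exec_seq_prog intro!: add_mono)
qed

lemma computable_pair:
  assumes "computable I inp f c" "computable I inp g d"
  shows "computable I inp (\<lambda>z. case_sum (f z) (g z)) (c + d)"
proof -
  obtain p q where "\<And>z. z \<in> I \<Longrightarrow> prog_result p (inp z) = f z \<and> real (op_count p (inp z)) \<le> c"
    "\<And>z. z \<in> I \<Longrightarrow> prog_result q (inp z) = g z \<and> real (op_count q (inp z)) \<le> d"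
    using assms unfolding computable_def by blast
  then show ?thesis unfolding computable_def
    by (intro exI[of _ "pair_prog p q"]) (auto simp: exec_pair_prog intro!: add_mono)
qed

lemma computable_halt: "computable I inp (\<lambda>z j. fetch (inp z) [] (u j)) 0"
  unfolding computable_def by (intro exI[of _ "Halt u"]) (simp add: prog_result_def op_count_def)

lemma computable_proj: "computable I inp (\<lambda>z j. inp z (h j)) 0"
  using computable_halt[of I inp "\<lambda>j. In (h j)"] by simp

lemma computable_const: "computable I inp (\<lambda>z j. c j) 0"
  using computable_halt[of I inp "\<lambda>j. Lit (c j)"] by simp

lemma computable_reindex: "computable I inp f c \<Longrightarrow> computable I inp (\<lambda>z j. f z (h j)) c"
  using computable_comp[OF _ computable_proj[of I f h], of inp c] by simp

text \<open>The input stays available beside the new value, so that intermediate results are shared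
  instead of recomputed.\<close>

lemma computable_let:
  assumes "computable I inp f c" "computable I (\<lambda>z. case_sum (inp z) (f z)) g d"
  shows "computable I inp g (c + d)"
  using computable_comp[OF computable_pair[OF computable_proj[of I inp "\<lambda>j. j"] assms(1)] assms(2)] by simp

definition scalar :: "'z set \<Rightarrow> ('z \<Rightarrow> 'i \<Rightarrow> real) \<Rightarrow> ('z \<Rightarrow> real) \<Rightarrow> real \<Rightarrow> bool" where
  "scalar I inp f c \<longleftrightarrow> computable I inp (\<lambda>z (_::unit). f z) c"

lemma scalar_in: "scalar I inp (\<lambda>z. inp z i) 0"
  unfolding scalar_def by (rule computable_proj)

lemma scalar_const: "scalar I inp (\<lambda>z. c) 0"
  unfolding scalar_def by (rule computable_const)

lemma scalar_mono: "scalar I inp f c \<Longrightarrow> c \<le> d \<Longrightarrow> scalar I inp f d"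
  unfolding scalar_def by (rule computable_mono)

lemma scalar_aop:
  assumes "scalar I inp f c" "scalar I inp g d"
  shows "scalar I inp (\<lambda>z. apply_aop b (f z) (g z)) (c + d + 1)"
proof -
  have "computable I (\<lambda>z. case_sum (\<lambda>_::unit. f z) (\<lambda>_::unit. g z)) (\<lambda>z (_::unit). apply_aop b (f z) (g z)) 1"
    unfolding computable_def
    by (intro exI[of _ "Arith b (In (Inl ())) (In (Inr ())) (Halt (\<lambda>_. Tmp 0))"])
      (simp add: prog_result_def op_count_def)
  from computable_comp[OF computable_pair[OF assms[unfolded scalar_def]] this] show ?thesis
    by (simp add: scalar_def)
qed

lemmas scalar_add = scalar_aop[where b=Add, simplified]
  and scalar_sub = scalar_aop[where b=Sub, simplified]
  and scalar_mult = scalar_aop[where b=Mul, simplified]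
  and scalar_div = scalar_aop[where b=Div, simplified]

lemma scalar_sum:
  fixes c :: real
  assumes "finite K" "\<And>k. k \<in> K \<Longrightarrow> scalar I inp (f k) c"
  shows "scalar I inp (\<lambda>z. \<Sum>k\<in>K. f k z) (card K * (c + 1))"
  using assms
proof (induction K rule: finite_induct)
  case empty
  then show ?case by (simp add: scalar_const)
next
  case (insert k K)
  have "scalar I inp (\<lambda>z. f k z + (\<Sum>k\<in>K. f k z)) (c + card K * (c + 1) + 1)"
    using insert by (intro scalar_add) auto
  then show ?case using insert by (simp add: algebra_simps)
qed

lemma computable_family:
  fixes f :: "'z \<Rightarrow> 'o::finite \<Rightarrow> real" and c :: real
  assumes "\<And>j. scalar I inp (\<lambda>z. f z j) c"
  shows "computable I inp f (CARD('o) * c)"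
proof -
  have "computable I inp (\<lambda>z j. if j \<in> J then f z j else 0) (card J * c)" for J :: "'o set"
  proof (induction J rule: finite_induct[OF finite])
    case 1
    then show ?case by (simp add: computable_const)
  next
    case (2 k J)
    have "computable I inp (\<lambda>z. case_sum (\<lambda>j. if j \<in> J then f z j else 0) (\<lambda>_::unit. f z k)) (card J * c + c)"
      using 2 assms by (intro computable_pair) (auto simp: scalar_def)
    from computable_reindex[OF this, of "\<lambda>j. if j = k then Inr () else Inl j"]
    have "computable I inp (\<lambda>z j. if j \<in> insert k J then f z j else 0) (card J * c + c)"
      by (rule computable_cong) (auto simp: fun_eq_iff)
    then show ?case using 2 by (simp add: algebra_simps)
  qed
  from this[of UNIV] show ?thesis by simp
qed

section \<open>Matrix inversion by Gauss--Jordan elimination\<close>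

definition replace_columns :: "'n set \<Rightarrow> real^'n^'n \<Rightarrow> real^'n^'n" where
  "replace_columns K G = (\<chi> i j. if j \<in> K then G $ i $ j else if i = j then 1 else 0)"

lemma replace_columns_mult:
  "(replace_columns K G *v v) $ i
     = (G *v (\<chi> j. if j \<in> K then v $ j else 0)) $ i + (if i \<in> K then 0 else v $ i)"
proof -
  have "(replace_columns K G *v v) $ i
      = (\<Sum>j\<in>UNIV. G $ i $ j * (if j \<in> K then v $ j else 0) + (if i = j then (if i \<in> K then 0 else v $ i) else 0))"
    unfolding replace_columns_def matrix_vector_mult_def by (auto intro!: sum.cong)
  then show ?thesis by (simp add: sum.distrib matrix_vector_mult_def)
qed

text \<open>These matrices lead from the identity, \<open>K = {}\<close>, to \<open>G\<close>,
  \<open>K = UNIV\<close>, and the elimination passes through their inverses. For a kernel vector,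
  the part \<open>u\<close> supported on \<open>K\<close> satisfies
  \<open>u \<bullet> (G *v u) = 0\<close> and vanishes; the other entries follow.\<close>

lemma invertible_replace_columns:
  fixes G :: "real^'n^'n"
  assumes "posdef G" shows "invertible (replace_columns K G)"
proof -
  have "v = 0" if 0: "replace_columns K G *v v = 0" for v
  proof -
    define u where "u = (\<chi> j. if j \<in> K then v $ j else 0)"
    have eq: "(G *v u) $ i + (if i \<in> K then 0 else v $ i) = 0" for i
      using replace_columns_mult[of K G v i] 0 by (simp add: u_def)
    have "u $ i * (G *v u) $ i = 0" for i
    proof (cases "i \<in> K")
      case True
      then show ?thesis using eq[of i] by simp
    next
      case False
      then show ?thesis by (simp add: u_def)
    qed
    then have "u \<bullet> (G *v u) = 0" unfolding inner_vec_def inner_real_def by (intro sum.neutral ballI)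
    then have u: "u = 0" using assms unfolding posdef_def by (metis less_irrefl)
    have "v $ i = 0" for i
    proof (cases "i \<in> K")
      case True
      then have "v $ i = u $ i" by (simp add: u_def)
      then show ?thesis using u by simp
    next
      case False
      then show ?thesis using eq[of i] u by simp
    qed
    then show ?thesis by (simp add: vec_eq_iff)
  qed
  then show ?thesis using matrix_left_invertible_ker invertible_left_inverse by blast
qed

text \<open>One Gauss--Jordan elimination step. No pivoting is needed, since the leading principal
  minors of a positive definite matrix are positive.\<close>

lemma matrix_inv_replace_column:
  fixes G :: "real^'n^'n"
  assumes G: "posdef G" and k: "k \<notin> K"
  defines "B \<equiv> matrix_inv (replace_columns K G)"
  defines "w \<equiv> B *v column k G"
  shows "matrix_inv (replace_columns (insert k K) G)
    = (\<chi> i j. if i = k then B $ k $ j / w $ k else B $ i $ j - w $ i / w $ k * B $ k $ j)"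
proof -
  define A A' where "A = replace_columns K G" and "A' = replace_columns (insert k K) G"
  have BA: "B ** A = mat 1" "A ** B = mat 1"
    using invertible_matrix_inv[OF invertible_replace_columns[OF G, of K]] by (auto simp: A_def B_def)
  let ?e = "axis k 1 :: real^'n"
  have Gk: "G *v ?e = column k G" by (rule matrix_vector_mult_basis)
  have A'v: "A' *v v = A *v v + v $ k *\<^sub>R (column k G - ?e)" for v
  proof -
    have split: "(\<chi> j. if j \<in> insert k K then v $ j else 0) = (\<chi> j. if j \<in> K then v $ j else 0) + v $ k *\<^sub>R ?e"
      using k by (auto simp: vec_eq_iff axis_def)
    have "(A' *v v) $ i = (A *v v + v $ k *\<^sub>R (column k G - ?e)) $ i" for i
    proof -
      have "(A' *v v) $ i = (G *v (\<chi> j. if j \<in> K then v $ j else 0)) $ i + v $ k * column k G $ i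
          + (if i \<in> insert k K then 0 else v $ i)"
        unfolding A'_def replace_columns_mult split
        by (simp only: matrix_vector_right_distrib matrix_vector_mult_scaleR Gk vector_add_component
          vector_scaleR_component real_scaleR_def)
      then show ?thesis using k by (simp add: A_def replace_columns_mult axis_def algebra_simps)
    qed
    then show ?thesis by (simp add: vec_eq_iff)
  qed
  have Ae: "A *v ?e = ?e"
  proof -
    have z: "(\<chi> j. if j \<in> K then ?e $ j else 0) = (0 :: real^'n)" using k by (auto simp: vec_eq_iff axis_def)
    have "(A *v ?e) $ i = ?e $ i" for i
      unfolding A_def replace_columns_mult z using k by (simp add: axis_def)
    then show ?thesis by (simp add: vec_eq_iff)
  qed
  have BAv: "B *v (A *v v) = v" for v by (simp add: matrix_vector_mul_assoc BA)
  have Be: "B *v ?e = ?e" using BAv[of ?e] by (simp add: Ae)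
  have Aw: "A *v w = column k G" by (simp add: w_def matrix_vector_mul_assoc BA)
  \<comment> \<open>With a zero pivot, \<open>A'\<close> would send \<open>w\<close> and the unit
    vector \<open>?e\<close> to the same column, against injectivity.\<close>
  have wk: "w $ k \<noteq> 0"
  proof
    assume "w $ k = 0"
    then have "A' *v w = A' *v ?e" by (simp add: A'v Aw Ae)
    moreover have "inj ((*v) A')"
      unfolding A'_def by (intro inj_matrix_vector_mult invertible_replace_columns G)
    ultimately have "w = ?e" by (simp add: inj_eq)
    then show False using \<open>w $ k = 0\<close> by simp
  qed
  define B' where "B' = (\<chi> i j. if i = k then B $ k $ j / w $ k else B $ i $ j - w $ i / w $ k * B $ k $ j)"
  have B'x: "B' *v x = B *v x + ((B *v x) $ k / w $ k) *\<^sub>R (?e - w)" for x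
  proof -
    have "(B' *v x) $ i = (B *v x + ((B *v x) $ k / w $ k) *\<^sub>R (?e - w)) $ i" for i
    proof (cases "i = k")
      case True
      then have "(B' *v x) $ i = (B *v x) $ k / w $ k"
        by (simp add: B'_def matrix_vector_mult_def sum_divide_distrib)
      then show ?thesis using True wk by (simp add: field_simps)
    next
      case False
      then have "(B' *v x) $ i = (B *v x) $ i - w $ i / w $ k * (B *v x) $ k"
        by (simp add: B'_def matrix_vector_mult_def sum_distrib_left sum_subtractf algebra_simps)
      then show ?thesis using False by (simp add: axis_def)
    qed
    then show ?thesis by (simp add: vec_eq_iff)
  qed
  have "B' *v (A' *v v) = v" for v
  proof -
    have "B *v (A' *v v) = v + v $ k *\<^sub>R (w - ?e)"
      by (simp add: A'v matrix_vector_right_distrib matrix_vector_mult_diff_distrib matrix_vector_mult_scaleR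
        BAv Be w_def)
    moreover have "(v + v $ k *\<^sub>R (w - ?e)) $ k = v $ k * w $ k" by (simp add: algebra_simps)
    ultimately have "B *v (A' *v v) + ((B *v (A' *v v)) $ k / w $ k) *\<^sub>R (?e - w)
        = v + v $ k *\<^sub>R (w - ?e) + v $ k *\<^sub>R (?e - w)" using wk by simp
    then show ?thesis unfolding B'x by (simp add: algebra_simps)
  qed
  then have "B' ** A' = mat 1" by (simp add: matrix_eq matrix_vector_mul_assoc[symmetric])
  then have "matrix_inv A' = B'" by (metis matrix_inv_unique matrix_left_right_inverse)
  then show ?thesis by (simp add: A'_def B'_def)
qed

definition entries :: "real^'k^'l \<Rightarrow> 'l \<times> 'k \<Rightarrow> real" where
  "entries A = (\<lambda>(i, j). A $ i $ j)"

lemma entries_pair [simp]: "entries A (i, j) = A $ i $ j"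
  by (simp add: entries_def)

lemma scalar_inner:
  fixes f g :: "'z \<Rightarrow> real^'n" and c d :: real
  assumes "\<And>k. scalar I inp (\<lambda>z. f z $ k) c" "\<And>k. scalar I inp (\<lambda>z. g z $ k) d"
  shows "scalar I inp (\<lambda>z. f z \<bullet> g z :: real) (CARD('n) * (c + d + 2))"
proof -
  have "scalar I inp (\<lambda>z. \<Sum>k\<in>UNIV. f z $ k * g z $ k) (CARD('n) * ((c + d + 1) + 1))"
    by (intro scalar_sum scalar_mult assms) simp
  then show ?thesis by (simp add: inner_vec_def add.assoc)
qed

text \<open>Each of the \<open>n\<close> columns costs \<open>2 n^2\<close> operations for the
  vector \<open>w\<close> and at most \<open>3 n^2\<close> for the update of the inverse.\<close>

lemma computable_matrix_inv:
  "computable {G :: real^'n^'n. posdef G} entries (\<lambda>G. entries (matrix_inv G)) (5 * real CARD('n) ^ 3)"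
proof -
  let ?I = "{G :: real^'n^'n. posdef G}"
  let ?B = "\<lambda>K G. matrix_inv (replace_columns K G)"
  have step: "computable ?I (\<lambda>G. case_sum (entries G) (entries (?B K G)))
      (\<lambda>G. case_sum (entries G) (entries (?B (insert k K) G))) (5 * real CARD('n) ^ 2)"
    if k: "k \<notin> K" for k K
  proof -
    let ?inp = "\<lambda>G. case_sum (entries G) (entries (?B K G))"
    let ?w = "\<lambda>G. ?B K G *v column k G"
    have "scalar ?I ?inp (\<lambda>G. ?w G $ i) (real CARD('n) * (0 + 0 + 2))" for i
    proof -
      have B: "scalar ?I ?inp (\<lambda>G. ?B K G $ i $ j) 0" for j
        using scalar_in[of ?I ?inp "Inr (i, j)"] by simp
      have c: "scalar ?I ?inp (\<lambda>G. column k G $ j) 0" for j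
        using scalar_in[of ?I ?inp "Inl (j, k)"] by (simp add: column_def)
      show ?thesis using scalar_inner[OF B c] by (simp add: matrix_mult_dot mult.commute)
    qed
    then have w: "computable ?I ?inp (\<lambda>G i. ?w G $ i) (real CARD('n) * (real CARD('n) * (0 + 0 + 2)))"
      by (rule computable_family)
    let ?inp2 = "\<lambda>G. case_sum (?inp G) (\<lambda>i. ?w G $ i)"
    have "scalar ?I ?inp2 (\<lambda>G. entries (?B (insert k K) G) e) 3" for e
    proof -
      obtain i j where e: "e = (i, j)" by (cases e)
      have B: "scalar ?I ?inp2 (\<lambda>G. ?B K G $ i $ j) 0" for i j
        using scalar_in[of ?I ?inp2 "Inl (Inr (i, j))"] by simp
      have w: "scalar ?I ?inp2 (\<lambda>G. ?w G $ i) 0" for i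
        using scalar_in[of ?I ?inp2 "Inr i"] by simp
      have "scalar ?I ?inp2 (\<lambda>G. if i = k then ?B K G $ k $ j / ?w G $ k
          else ?B K G $ i $ j - ?w G $ i / ?w G $ k * ?B K G $ k $ j) 3"
      proof (cases "i = k")
        case True
        have "scalar ?I ?inp2 (\<lambda>G. ?B K G $ k $ j / ?w G $ k) (0 + 0 + 1)"
          by (intro scalar_div B w)
        then show ?thesis using True by (simp add: scalar_mono)
      next
        case False
        have "scalar ?I ?inp2 (\<lambda>G. ?B K G $ i $ j - ?w G $ i / ?w G $ k * ?B K G $ k $ j) (0 + (0 + 0 + 1 + 0 + 1) + 1)"
          by (intro scalar_sub scalar_mult scalar_div B w)
        then show ?thesis using False by simp
      qed
      then show ?thesis unfolding scalar_def
        by (rule computable_cong) (simp_all add: e matrix_inv_replace_column[OF _ k])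
    qed
    then have "computable ?I ?inp2 (\<lambda>G. entries (?B (insert k K) G)) (real CARD('n \<times> 'n) * 3)"
      by (rule computable_family)
    from computable_pair[OF computable_proj[of ?I ?inp2 "\<lambda>e. Inl (Inl e)"] this]
    have "computable ?I ?inp2 (\<lambda>G. case_sum (entries G) (entries (?B (insert k K) G))) (real CARD('n \<times> 'n) * 3)"
      by simp
    from computable_let[OF w this] show ?thesis
      by (rule computable_mono) (simp add: power2_eq_square)
  qed
  have "computable ?I entries (\<lambda>G. case_sum (entries G) (entries (?B K G))) (card K * (5 * real CARD('n) ^ 2))" for K
  proof (induction K rule: finite_induct[OF finite])
    case 1
    have "replace_columns {} G = mat 1" for G :: "real^'n^'n"
      by (simp add: replace_columns_def mat_def)
    then have inv: "?B {} G = mat 1" for G :: "real^'n^'n" by (simp add: matrix_inv_unique)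
    have "computable ?I entries (\<lambda>G. case_sum (entries G) (entries (mat 1 :: real^'n^'n))) 0"
      using computable_pair[OF computable_proj[of ?I entries "\<lambda>e. e"] computable_const[of ?I entries "entries (mat 1)"]]
      by simp
    then have "computable ?I entries (\<lambda>G. case_sum (entries G) (entries (?B {} G))) 0"
      by (rule computable_cong) (simp_all only: inv)
    then show ?case by simp
  next
    case (2 k K)
    from computable_comp[OF 2(3) step[OF 2(2)]] 2 show ?case by (simp add: algebra_simps)
  qed
  from computable_reindex[OF this[of UNIV], of Inr]
  have "computable ?I entries (\<lambda>G. entries (?B UNIV G)) (real CARD('n) * (5 * real CARD('n) ^ 2))" by simp
  moreover have "replace_columns UNIV G = G" for G :: "real^'n^'n"
    by (simp add: replace_columns_def vec_eq_iff)
  ultimately show ?thesis by (simp add: power2_eq_square power3_eq_cube mult_ac)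
qed

section \<open>Cost of the steps of the process\<close>

lemma computable_solver_input:
  fixes av :: "'z \<Rightarrow> 'm::finite \<Rightarrow> real^'n" and xv :: "'z \<Rightarrow> real^'n"
  shows "computable I (\<lambda>z. process_input (av z) (xv z)) (\<lambda>z. solver_input (av z) (xv z))
    (real CARD('m) * (real CARD('n) + 1) * (2 * real CARD('n) + 2))"
proof -
  let ?inp = "\<lambda>z. process_input (av z) (xv z)"
  \<comment> \<open>The denominator is recomputed for every coordinate: \<open>2 n\<close> for the
    inner product, a subtraction and a division. The total over all entries remains
    \<open>O(m n^2)\<close>.\<close>
  have "scalar I ?inp (\<lambda>z. solver_input (av z) (xv z) e) (2 * real CARD('n) + 2)" for e
  proof -
    obtain i j where e: "e = (i, j)" by (cases e)
    have ain: "scalar I ?inp (\<lambda>z. av z i $ k) 0" for k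
      using scalar_in[of I ?inp "Inl (i, k)"] by (simp add: process_input_def)
    have xin: "scalar I ?inp (\<lambda>z. xv z $ k) 0" for k
      using scalar_in[of I ?inp "Inr k"] by (simp add: process_input_def)
    show ?thesis
    proof (cases j)
      case None
      then show ?thesis
        using scalar_mono[OF scalar_const[of I ?inp 1]] by (simp add: e solver_input_def lift_pt_eq)
    next
      case (Some k)
      have "scalar I ?inp (\<lambda>z. av z i $ k / (1 - av z i \<bullet> xv z)) (0 + (0 + real CARD('n) * (0 + 0 + 2) + 1) + 1)"
        by (intro scalar_div scalar_sub scalar_inner scalar_const ain xin)
      then show ?thesis by (simp add: e Some solver_input_def lift_pt_eq dual_pt_def mult.commute add.commute)
    qed
  qed
  then have "computable I ?inp (\<lambda>z. solver_input (av z) (xv z)) (real CARD('m \<times> 'n option) * (2 * real CARD('n) + 2))"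
    by (rule computable_family)
  then show ?thesis by (simp add: algebra_simps)
qed

lemma computable_solver_point:
  fixes av :: "'z \<Rightarrow> 'm::finite \<Rightarrow> real^'n" and xv :: "'z \<Rightarrow> real^'n"
  assumes S: "khachiyan_guarantee S B" and \<eta>: "0 < \<eta>" "\<eta> \<le> 1"
    and I: "\<And>z. z \<in> I \<Longrightarrow> full_dim_polytope (av z) \<and> xv z \<in> interior (polytope_of (av z))"
  shows "computable I (\<lambda>z. process_input (av z) (xv z)) (\<lambda>z. entries (solver_point (S \<eta>) (av z) (xv z)))
    (real CARD('m) * (real CARD('n) + 1) * (2 * real CARD('n) + 2) + B \<eta>)"
proof (rule computable_comp[OF computable_solver_input])
  show "computable I (\<lambda>z. solver_input (av z) (xv z)) (\<lambda>z. entries (solver_point (S \<eta>) (av z) (xv z))) (B \<eta>)"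
    unfolding computable_def
    using S \<eta> I by (intro exI[of _ "S \<eta>"]) (auto simp: khachiyan_guarantee_def entries_def solver_point_def)
qed

lemma computable_new_center:
  fixes av :: "'z \<Rightarrow> 'm::finite \<Rightarrow> real^'n" and xv :: "'z \<Rightarrow> real^'n"
  shows "computable I (\<lambda>z. case_sum (process_input (av z) (xv z)) (entries (Qv z)))
    (\<lambda>z k. new_center (xv z) (Qv z) $ k) (real CARD('n) * 4)"
proof -
  let ?inp = "\<lambda>z. case_sum (process_input (av z) (xv z)) (entries (Qv z))"
  have "scalar I ?inp (\<lambda>z. new_center (xv z) (Qv z) $ k) 4" for k
  proof -
    have x: "scalar I ?inp (\<lambda>z. xv z $ k) 0"
      using scalar_in[of I ?inp "Inl (Inr k)"] by (simp add: process_input_def)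
    have s: "scalar I ?inp (\<lambda>z. s_block (Qv z)) 0"
      using scalar_in[of I ?inp "Inr (None, None)"] by (simp add: s_block_def)
    have zk: "scalar I ?inp (\<lambda>z. z_block (Qv z) $ k) 0"
      using scalar_in[of I ?inp "Inr (Some k, None)"] by (simp add: z_block_def)
    have "scalar I ?inp (\<lambda>z. xv z $ k + 1 / (1 - s_block (Qv z)) * z_block (Qv z) $ k)
      (0 + (0 + (0 + 0 + 1) + 1 + 0 + 1) + 1)"
      by (intro scalar_add scalar_mult scalar_div scalar_sub scalar_const x s zk)
    then show ?thesis by (simp add: new_center_def)
  qed
  then have "computable I ?inp (\<lambda>z k. new_center (xv z) (Qv z) $ k) (real CARD('n) * 4)"
    by (rule computable_family)
  then show ?thesis by simp
qed

text \<open>By symmetry of the inverse, the rank-one correction is \<open>outer (t z) (t z)\<close>,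
  which avoids matrix products. The cost is \<open>5 n^3\<close> for the inversion,
  \<open>2 n^2\<close> for \<open>t\<close>, \<open>2 n + 2\<close> for \<open>beta\<close> and 6
  per entry.\<close>

lemma computable_new_shape:
  fixes Qv :: "'z \<Rightarrow> real^('n::finite option)^('n option)"
  assumes I: "\<And>z. z \<in> I \<Longrightarrow> posdef (Qv z)"
  shows "computable I (\<lambda>z. entries (Qv z)) (\<lambda>z. entries (new_shape (Qv z)))
    (5 * real CARD('n) ^ 3 + 8 * real CARD('n) ^ 2 + 2 * real CARD('n) + 2)"
proof -
  define Gi t where "Gi = (\<lambda>z. matrix_inv (G_block (Qv z)))" and "t = (\<lambda>z. Gi z *v z_block (Qv z))"
  have G: "posdef (G_block (Qv z))" if "z \<in> I" for z using I[OF that] by (rule posdef_G_block)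
  have "computable I (\<lambda>z. entries (Qv z)) (\<lambda>z. entries (G_block (Qv z))) 0"
    using computable_proj[of I "\<lambda>z. entries (Qv z)" "\<lambda>(i, j). (Some i, Some j)"]
    by (rule computable_cong) (auto simp: entries_def G_block_def fun_eq_iff)
  moreover have "computable I (\<lambda>z. entries (G_block (Qv z))) (\<lambda>z. entries (Gi z)) (5 * real CARD('n) ^ 3)"
    unfolding Gi_def using computable_subst[OF computable_matrix_inv, of I "\<lambda>z. G_block (Qv z)"] G by simp
  ultimately have stage1: "computable I (\<lambda>z. entries (Qv z)) (\<lambda>z. entries (Gi z)) (0 + 5 * real CARD('n) ^ 3)"
    by (rule computable_comp)
  let ?e1 = "\<lambda>z. case_sum (entries (Qv z)) (entries (Gi z))"
  have "scalar I ?e1 (\<lambda>z. t z $ i) (real CARD('n) * (0 + 0 + 2))" for i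
  proof -
    have "scalar I ?e1 (\<lambda>z. Gi z $ i $ k) 0" for k using scalar_in[of I ?e1 "Inr (i, k)"] by simp
    moreover have "scalar I ?e1 (\<lambda>z. z_block (Qv z) $ k) 0" for k
      using scalar_in[of I ?e1 "Inl (Some k, None)"] by (simp add: z_block_def)
    ultimately have "scalar I ?e1 (\<lambda>z. Gi z $ i \<bullet> z_block (Qv z)) (real CARD('n) * (0 + 0 + 2))"
      by (rule scalar_inner)
    then show ?thesis by (simp add: t_def matrix_mult_dot)
  qed
  then have stage2: "computable I ?e1 (\<lambda>z i. t z $ i) (real CARD('n) * (real CARD('n) * (0 + 0 + 2)))"
    by (rule computable_family)
  let ?e2 = "\<lambda>z. case_sum (?e1 z) (\<lambda>i. t z $ i)"
  have s2: "scalar I ?e2 (\<lambda>z. s_block (Qv z)) 0"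
    using scalar_in[of I ?e2 "Inl (Inl (None, None))"] by (simp add: s_block_def)
  have z2: "scalar I ?e2 (\<lambda>z. z_block (Qv z) $ k) 0" for k
    using scalar_in[of I ?e2 "Inl (Inl (Some k, None))"] by (simp add: z_block_def)
  have t2: "scalar I ?e2 (\<lambda>z. t z $ k) 0" for k using scalar_in[of I ?e2 "Inr k"] by simp
  have "scalar I ?e2 (\<lambda>z. 1 - s_block (Qv z) + z_block (Qv z) \<bullet> t z) (0 + 0 + 1 + real CARD('n) * (0 + 0 + 2) + 1)"
    by (intro scalar_add scalar_sub scalar_inner scalar_const s2 z2 t2)
  then have stage3: "computable I ?e2 (\<lambda>z (_::unit). beta (Qv z)) (0 + 0 + 1 + real CARD('n) * (0 + 0 + 2) + 1)"
    by (simp add: scalar_def beta_def t_def Gi_def)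
  let ?e3 = "\<lambda>z. case_sum (?e2 z) (\<lambda>_::unit. beta (Qv z))"
  have "scalar I ?e3 (\<lambda>z. entries (new_shape (Qv z)) e) 6" for e
  proof -
    obtain i j where e: "e = (i, j)" by (cases e)
    have Gi3: "scalar I ?e3 (\<lambda>z. Gi z $ i $ j) 0"
      using scalar_in[of I ?e3 "Inl (Inl (Inr (i, j)))"] by simp
    have s3: "scalar I ?e3 (\<lambda>z. s_block (Qv z)) 0"
      using scalar_in[of I ?e3 "Inl (Inl (Inl (None, None)))"] by (simp add: s_block_def)
    have t3: "scalar I ?e3 (\<lambda>z. t z $ k) 0" for k using scalar_in[of I ?e3 "Inl (Inr k)"] by simp
    have b3: "scalar I ?e3 (\<lambda>z. beta (Qv z)) 0" using scalar_in[of I ?e3 "Inr ()"] by simp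
    have sc: "scalar I ?e3 (\<lambda>z. (1 - s_block (Qv z)) * (Gi z $ i $ j - 1 / beta (Qv z) * (t z $ i * t z $ j)))
       (0 + 0 + 1 + (0 + (0 + 0 + 1 + (0 + 0 + 1) + 1) + 1) + 1)"
      by (intro scalar_mult scalar_sub scalar_div scalar_const Gi3 s3 t3 b3)
    have eq: "(1 - s_block (Qv z)) * (Gi z $ i $ j - 1 / beta (Qv z) * (t z $ i * t z $ j))
      = entries (new_shape (Qv z)) e" if "z \<in> I" for z
    proof -
      let ?Z = "z_block (Qv z)"
      have sym: "transpose (Gi z) = Gi z"
        unfolding Gi_def by (intro posdef_sym posdef_matrix_inv(1) G that)
      have "(Gi z ** outer ?Z ?Z ** Gi z) *v w = outer (t z) (t z) *v w" for w
        by (simp add: matrix_vector_mul_assoc[symmetric] outer_mult_vec matrix_vector_mult_scaleR t_def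
          sym_dot[OF sym])
      then have eq': "Gi z ** outer ?Z ?Z ** Gi z = outer (t z) (t z)" by (simp add: matrix_eq)
      have "matrix_inv (G_block (Qv z)) = Gi z" by (simp add: Gi_def)
      then have "new_shape (Qv z) = (1 - s_block (Qv z)) *\<^sub>R (Gi z - (1 / beta (Qv z)) *\<^sub>R outer (t z) (t z))"
        by (simp only: new_shape_def Let_def eq')
      then show ?thesis by (simp add: e outer_def)
    qed
    show ?thesis unfolding scalar_def
      by (rule computable_mono[OF computable_cong[OF sc[unfolded scalar_def]]]) (simp_all add: eq[symmetric])
  qed
  then have stage4: "computable I ?e3 (\<lambda>z. entries (new_shape (Qv z))) (real CARD('n \<times> 'n) * 6)"
    by (rule computable_family)
  from computable_let[OF stage1 computable_let[OF stage2 computable_let[OF stage3 stage4]]]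
  show ?thesis by (rule computable_mono) (simp add: power2_eq_square)
qed

definition iterate :: "('m::finite, 'n::finite) solver \<Rightarrow> ('m \<Rightarrow> real^'n) \<Rightarrow> real^'n \<Rightarrow> nat \<Rightarrow> real^'n" where
  "iterate S a x k = ((\<lambda>y. new_center y (solver_point S a y)) ^^ k) x"

lemma iterate_simps [simp]:
  "iterate S a x 0 = x"
  "iterate S a x (Suc k) = new_center (iterate S a x k) (solver_point S a (iterate S a x k))"
  by (simp_all add: iterate_def)

text \<open>The loop is unrolled into a tree for each pair of \<open>N\<close> and
  \<open>\<eta>\<close>. The last step computes center and shape from one and the same solver
  output, whence \<open>N + 1\<close> solver calls and a single shape computation.\<close>

lemma process_program:
  fixes S :: "real \<Rightarrow> ('m::finite, 'n::finite) solver" and B :: "real \<Rightarrow> real"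
  assumes S: "khachiyan_guarantee S B"
  defines "c \<equiv> \<lambda>\<eta>. (real CARD('m) * (real CARD('n) + 1)) * (2 * real CARD('n) + 2) + B \<eta> + real CARD('n) * 4"
  obtains T :: "nat \<Rightarrow> real \<Rightarrow> ('m, 'n) process_prog" where
    "\<And>N \<eta> a x. 0 < \<eta> \<Longrightarrow> \<eta> \<le> 1 \<Longrightarrow> full_dim_polytope a \<Longrightarrow>
      (\<And>k. k \<le> N \<Longrightarrow> iterate (S \<eta>) a x k \<in> interior (polytope_of a)) \<Longrightarrow>
      process_center (T N \<eta>) a x = iterate (S \<eta>) a x (N + 1) \<and>
      process_shape (T N \<eta>) a x = new_shape (solver_point (S \<eta>) a (iterate (S \<eta>) a x N)) \<and>
      real (op_count (T N \<eta>) (process_input a x)) \<le> (real N + 1) * c \<eta>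
        + (5 * real CARD('n) ^ 3 + 8 * real CARD('n) ^ 2 + 2 * real CARD('n) + 2)"
proof -
  let ?s = "5 * real CARD('n) ^ 3 + 8 * real CARD('n) ^ 2 + 2 * real CARD('n) + 2"
  \<comment> \<open>The instances for which correctness can be promised, as the solver is guaranteed
    at interior points only. That the instances of interest belong here follows from
    \<open>solver_run\<close>.\<close>
  define I where "I N \<eta> = {(a :: 'm \<Rightarrow> real^'n, x). 0 < \<eta> \<and> \<eta> \<le> 1 \<and> full_dim_polytope a \<and>
    (\<forall>k\<le>N. iterate (S \<eta>) a x k \<in> interior (polytope_of a))}" for N \<eta>
  define X where "X \<eta> k z = iterate (S \<eta>) (fst z) (snd z) k" for \<eta> k and z :: "('m \<Rightarrow> real^'n) \<times> (real^'n)"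
  define Q where "Q \<eta> k z = solver_point (S \<eta>) (fst z) (X \<eta> k z)" for \<eta> k and z :: "('m \<Rightarrow> real^'n) \<times> (real^'n)"
  have "computable (I N \<eta>) (\<lambda>z. process_input (fst z) (snd z))
      (\<lambda>z. case_sum (\<lambda>k. X \<eta> (N + 1) z $ k) (entries (new_shape (Q \<eta> N z)))) ((real N + 1) * c \<eta> + ?s)" for N \<eta>
  proof (cases "0 < \<eta> \<and> \<eta> \<le> 1")
    case False
    then show ?thesis by (auto simp: I_def computable_def)
  next
    case True
    have int: "full_dim_polytope (fst z) \<and> X \<eta> k z \<in> interior (polytope_of (fst z))"
      if "z \<in> I N \<eta>" "k \<le> N" for z k
      using that by (auto simp: I_def X_def)
    let ?in = "\<lambda>k z. process_input (fst z) (X \<eta> k z)"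
    have solve: "computable (I N \<eta>) (?in k) (\<lambda>z. entries (Q \<eta> k z))
        (real CARD('m) * (real CARD('n) + 1) * (2 * real CARD('n) + 2) + B \<eta>)" if "k \<le> N" for k
      unfolding Q_def using True int that by (intro computable_solver_point[OF S]) auto
    have center: "computable (I N \<eta>) (\<lambda>z. case_sum (?in k z) (entries (Q \<eta> k z)))
        (\<lambda>z j. X \<eta> (Suc k) z $ j) (real CARD('n) * 4)" for k
      using computable_new_center[of "I N \<eta>" fst "X \<eta> k" "Q \<eta> k"] by (simp add: X_def Q_def)
    have step: "computable (I N \<eta>) (?in k) (?in (Suc k)) (c \<eta>)" if "k \<le> N" for k
    proof -
      let ?e = "\<lambda>z. case_sum (?in k z) (entries (Q \<eta> k z))"
      from computable_pair[OF computable_proj[of "I N \<eta>" ?e "\<lambda>j. Inl (Inl j)"] center]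
      have "computable (I N \<eta>) ?e (?in (Suc k)) (0 + real CARD('n) * 4)"
        by (rule computable_cong) (auto simp: process_input_def fun_eq_iff split: sum.split)
      from computable_let[OF solve[OF that] this] show ?thesis by (simp add: c_def add.assoc)
    qed
    have iter: "computable (I N \<eta>) (?in 0) (?in k) (k * c \<eta>)" if "k \<le> N" for k
      using that
    proof (induction k)
      case 0
      then show ?case using computable_proj[of "I N \<eta>" "?in 0" "\<lambda>j. j"] by simp
    next
      case (Suc k)
      from computable_comp[OF Suc.IH step] Suc.prems show ?case by (simp add: algebra_simps)
    qed
    have pd: "posdef (Q \<eta> N z)" if "z \<in> I N \<eta>" for z
      using S int[OF that order_refl] True
      by (auto simp: khachiyan_guarantee_def lifted_feasible_def Q_def)
    let ?e = "\<lambda>z. case_sum (?in N z) (entries (Q \<eta> N z))"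
    have "computable (I N \<eta>) ?e (\<lambda>z. entries (Q \<eta> N z)) 0"
      using computable_proj[of "I N \<eta>" ?e Inr] by simp
    from computable_comp[OF this computable_new_shape[OF pd]]
    have "computable (I N \<eta>) ?e (\<lambda>z. entries (new_shape (Q \<eta> N z))) (0 + ?s)" .
    from computable_comp[OF iter[OF order_refl] computable_let[OF solve[OF order_refl] computable_pair[OF center this]]]
    have "computable (I N \<eta>) (?in 0)
      (\<lambda>z. case_sum (\<lambda>k. X \<eta> (N + 1) z $ k) (entries (new_shape (Q \<eta> N z)))) ((real N + 1) * c \<eta> + ?s)"
      by (simp add: c_def algebra_simps)
    then show ?thesis by (simp add: X_def add.commute)
  qed
  then have "\<forall>N \<eta>. \<exists>T. \<forall>z\<in>I N \<eta>. prog_result T (process_input (fst z) (snd z))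
        = case_sum (\<lambda>k. X \<eta> (N + 1) z $ k) (entries (new_shape (Q \<eta> N z)))
      \<and> real (op_count T (process_input (fst z) (snd z))) \<le> (real N + 1) * c \<eta> + ?s"
    unfolding computable_def by blast
  then obtain T :: "nat \<Rightarrow> real \<Rightarrow> ('m, 'n) process_prog" where
    T: "\<And>N \<eta> z. z \<in> I N \<eta> \<Longrightarrow> prog_result (T N \<eta>) (process_input (fst z) (snd z))
        = case_sum (\<lambda>k. X \<eta> (N + 1) z $ k) (entries (new_shape (Q \<eta> N z)))
      \<and> real (op_count (T N \<eta>) (process_input (fst z) (snd z))) \<le> (real N + 1) * c \<eta> + ?s"
    unfolding choice_iff by blast
  show thesis
  proof (rule that)
    fix N \<eta> and a :: "'m \<Rightarrow> real^'n" and x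
    assume "0 < \<eta>" "\<eta> \<le> 1" "full_dim_polytope a"
      "\<And>k. k \<le> N \<Longrightarrow> iterate (S \<eta>) a x k \<in> interior (polytope_of a)"
    then have "(a, x) \<in> I N \<eta>" by (simp add: I_def)
    from T[OF this] show "process_center (T N \<eta>) a x = iterate (S \<eta>) a x (N + 1) \<and>
      process_shape (T N \<eta>) a x = new_shape (solver_point (S \<eta>) a (iterate (S \<eta>) a x N)) \<and>
      real (op_count (T N \<eta>) (process_input a x)) \<le> (real N + 1) * c \<eta> + ?s"
      by (simp add: process_center_def process_shape_def X_def Q_def vec_eq_iff add.commute)
  qed
qed

section \<open>Absorbing the overhead into the solver rates\<close>

lemma process_cost_le:
  fixes m n R C N :: real
  assumes n: "1 \<le> n" and m: "n + 1 \<le> m" and R: "m * n^2 / 2 \<le> R" and C: "0 < C" and N: "0 \<le> N"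
  shows "(N + 1) * (m * (n + 1) * (2 * n + 2) + C * R + n * 4) + (5 * n ^ 3 + 8 * n ^ 2 + 2 * n + 2)
    \<le> 10 ^ 6 * (C + 1) * ((N + 1) * R)"
proof -
  \<comment> \<open>The unit of account, with \<open>P \<le> 2 * R\<close>. Beyond the solver, a
    step costs at most \<open>8 P + 4 P\<close> and the final shape \<open>17 P\<close>, which gives
    the constant \<open>24 + 34 = 58\<close>.\<close>
  define P where "P = m * n^2"
  have m1: "1 \<le> m" using n m by linarith
  have n2: "1 \<le> n^2" using n by (simp add: one_le_power)
  have "n * 1 \<le> n * n" using n by (intro mult_left_mono) auto
  then have nn: "n \<le> n^2" by (simp add: power2_eq_square)
  have "1 * n^2 \<le> P" unfolding P_def using m1 by (intro mult_right_mono) auto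
  then have P: "n^2 \<le> P" "n \<le> P" "1 \<le> P" using nn n2 by auto
  have "n * n^2 \<le> P" unfolding P_def using m by (intro mult_right_mono) auto
  then have P3: "n^3 \<le> P" by (simp add: power3_eq_cube power2_eq_square mult.assoc)
  have "(n + 1) * (n + 1) \<le> (2 * n) * (2 * n)" using n by (intro mult_mono) auto
  then have "m * ((n + 1) * (n + 1)) \<le> m * ((2 * n) * (2 * n))" using m1 by (intro mult_left_mono) auto
  then have Pm: "m * (n + 1) * (2 * n + 2) \<le> 8 * P" by (simp add: P_def power2_eq_square algebra_simps)
  have PR: "P \<le> 2 * R" using R by (simp add: P_def)
  have R0: "0 \<le> R" using PR P by linarith
  have "(N + 1) * (m * (n + 1) * (2 * n + 2) + C * R + n * 4) \<le> (N + 1) * (24 * R + C * R)"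
    using Pm P PR N by (intro mult_left_mono) auto
  moreover have "5 * n ^ 3 + 8 * n ^ 2 + 2 * n + 2 \<le> 1 * (34 * R)" using P P3 PR by simp
  moreover have "1 * (34 * R) \<le> (N + 1) * (34 * R)" using N R0 by (intro mult_right_mono) auto
  ultimately have "(N + 1) * (m * (n + 1) * (2 * n + 2) + C * R + n * 4) + (5 * n ^ 3 + 8 * n ^ 2 + 2 * n + 2)
    \<le> (58 + C) * ((N + 1) * R)" by (simp add: algebra_simps)
  \<comment> \<open>\<open>10 ^ 6\<close> is merely a generous absolute constant above 58.\<close>
  also have "\<dots> \<le> (10 ^ 6 * (C + 1)) * ((N + 1) * R)" using C N R0 by (intro mult_right_mono) auto
  finally show ?thesis .
qed

text \<open>At \<open>m = 2\<close> the iterated logarithm is negative. The bound shows that it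
  takes away at most half of \<open>n / \<eta>\<close>, which is at least 1.\<close>

lemma ln_ln_ge:
  fixes m :: real
  assumes "2 \<le> m" shows "- (1 / 2) \<le> ln (ln m)"
proof -
  have "exp (- (1 / 2)) = 1 / exp (1 / 2 :: real)" by (simp add: exp_minus field_simps)
  also have "\<dots> \<le> 1 / (1 + 1 / 2)" using exp_ge_add_one_self[of "1/2"] by (intro divide_left_mono) auto
  also have "\<dots> \<le> ln 2" using ln2_ge_two_thirds by simp
  also have "\<dots> \<le> ln m" using assms by simp
  finally have "ln (exp (- (1 / 2))) \<le> ln (ln m)" by (intro ln_mono) auto
  then show ?thesis by simp
qed

lemma bcd_rate_ge:
  fixes m n \<eta> :: real
  assumes "1 \<le> n" "n + 1 \<le> m" "0 < \<eta>" "\<eta> \<le> 1"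
  shows "m * n^2 / 2 \<le> bcd_rate m n \<eta>"
proof -
  have "1 \<le> n / \<eta>" using assms by (simp add: field_simps)
  then have "1 / 2 \<le> n / \<eta> + ln (ln m)" using ln_ln_ge[of m] assms by linarith
  then have "m * n^2 * (1 / 2) \<le> m * n^2 * (n / \<eta> + ln (ln m))" using assms by (intro mult_left_mono) auto
  then show ?thesis by (simp add: bcd_rate_def)
qed

lemma newton_rate_ge:
  fixes m n \<eta> :: real
  assumes "1 \<le> n" "n + 1 \<le> m" "0 < \<eta>" "\<eta> \<le> 1"
  shows "m * n^2 / 2 \<le> newton_rate m \<eta>"
proof -
  have "m * n^2 \<le> m * m^2" using assms by (intro mult_left_mono power_mono) auto
  also have "\<dots> = m powr 3" using assms by (simp add: powr_numeral power3_eq_cube power2_eq_square)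
  also have "\<dots> \<le> m powr (7 / 2)" using assms by (intro powr_mono) auto
  finally have 1: "m * n^2 \<le> m powr (7 / 2)" .
  have "m * 1 \<le> m / \<eta>" using assms by (simp add: field_simps)
  then have "2 \<le> m / \<eta>" using assms by linarith
  then have "ln 2 \<le> ln (m / \<eta>)" by simp
  then have "1 / 2 \<le> ln (m / \<eta>)" using ln2_ge_two_thirds by linarith
  then have "m * n^2 * (1 / 2) \<le> m powr (7 / 2) * ln (m / \<eta>)" using 1 assms by (intro mult_mono) auto
  then show ?thesis by (simp add: newton_rate_def)
qed

text \<open>Common to both solvers: a rate enters only through its lower bound by half of
  \<open>m n^2\<close>, needed to dominate the overhead.\<close>

lemma polarity_process_program:
  fixes S :: "real \<Rightarrow> ('m::finite, 'n::finite) solver" and rate :: "real \<Rightarrow> real"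
  assumes S: "khachiyan_guarantee S (\<lambda>\<eta>. C * rate \<eta>)" and C: "0 < C"
    and rate: "\<And>\<eta>. 0 < \<eta> \<Longrightarrow> \<eta> \<le> 1 \<Longrightarrow> CARD('n) + 1 \<le> CARD('m) \<Longrightarrow> CARD('m) * (real CARD('n))^2 / 2 \<le> rate \<eta>"
  obtains T :: "nat \<Rightarrow> real \<Rightarrow> ('m, 'n) process_prog" where
    "\<And>(a :: 'm \<Rightarrow> real^'n) x0 \<gamma> q0 lam0 theta0 mu0 sigma0 beta0 rho0 Lctr Lvol r0 L0.
      polarity_constants a x0 q0 lam0 theta0 mu0 sigma0 beta0 rho0 Lctr Lvol r0 L0 \<Longrightarrow>
      0 < \<gamma> \<Longrightarrow> \<gamma> < 1 \<Longrightarrow>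
      (let \<epsilon> = tolerance CARD('m) \<gamma> q0 lam0 rho0 Lctr Lvol r0 L0;
           N = budget \<gamma> q0 (delta a x0); \<eta> = solver_accuracy \<epsilon>
       in runs_polarity_process (T N \<eta>) (S \<eta>) a x0 \<epsilon> N \<gamma> (10 ^ 6 * (C + 1) * ((real N + 1) * rate \<eta>)))"
proof -
  obtain T :: "nat \<Rightarrow> real \<Rightarrow> ('m, 'n) process_prog" where
    T: "\<And>N \<eta> a x. 0 < \<eta> \<Longrightarrow> \<eta> \<le> 1 \<Longrightarrow> full_dim_polytope a \<Longrightarrow>
      (\<And>k. k \<le> N \<Longrightarrow> iterate (S \<eta>) a x k \<in> interior (polytope_of a)) \<Longrightarrow>
      process_center (T N \<eta>) a x = iterate (S \<eta>) a x (N + 1) \<and>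
      process_shape (T N \<eta>) a x = new_shape (solver_point (S \<eta>) a (iterate (S \<eta>) a x N)) \<and>
      real (op_count (T N \<eta>) (process_input a x)) \<le> (real N + 1) * ((real CARD('m) * (real CARD('n) + 1)) * (2 * real CARD('n) + 2)
          + C * rate \<eta> + real CARD('n) * 4)
        + (5 * real CARD('n) ^ 3 + 8 * real CARD('n) ^ 2 + 2 * real CARD('n) + 2)"
    using process_program[OF S] by metis
  show thesis
  proof (rule that)
    fix a :: "'m \<Rightarrow> real^'n" and x0 and \<gamma> q0 lam0 theta0 mu0 sigma0 beta0 rho0 Lctr Lvol r0 L0 :: real
    assume pc: "polarity_constants a x0 q0 lam0 theta0 mu0 sigma0 beta0 rho0 Lctr Lvol r0 L0"
      and \<gamma>: "0 < \<gamma>" "\<gamma> < 1"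
    interpret polarity_constants a x0 q0 lam0 theta0 mu0 sigma0 beta0 rho0 Lctr Lvol r0 L0 by (rule pc)
    define N \<eta> where "N = budget \<gamma> q0 (delta a x0)" and "\<eta> = solver_accuracy (tol \<gamma>)"
    have \<eta>: "0 < \<eta>" "\<eta> \<le> 1" using tol_pos[OF \<gamma>] by (auto simp: \<eta>_def solver_accuracy_def)
    define xs where "xs = iterate (S \<eta>) a x0"
    have xs: "xs 0 = x0" "xs (Suc k) = new_center (xs k) (solver_point (S \<eta>) a (xs k))" for k
      by (simp_all add: xs_def)
    note run = solver_run[OF \<gamma> S, where xs=xs and N=N, folded \<eta>_def, OF xs]
    have TN: "process_center (T N \<eta>) a x0 = xs (N + 1)"
      "process_shape (T N \<eta>) a x0 = new_shape (solver_point (S \<eta>) a (xs N))"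
      "real (op_count (T N \<eta>) (process_input a x0)) \<le> (real N + 1) * ((real CARD('m) * (real CARD('n) + 1)) * (2 * real CARD('n) + 2)
          + C * rate \<eta> + real CARD('n) * 4)
        + (5 * real CARD('n) ^ 3 + 8 * real CARD('n) ^ 2 + 2 * real CARD('n) + 2)"
      using T[OF \<eta> polytope, of N x0] run(2) by (auto simp: xs_def add.commute)
    have card: "CARD('n) + 1 \<le> CARD('m)" by (rule card_constraints[OF polytope])
    have "(real N + 1) * (real CARD('m) * (real CARD('n) + 1) * (2 * real CARD('n) + 2) + C * rate \<eta> + real CARD('n) * 4)
        + (5 * real CARD('n) ^ 3 + 8 * real CARD('n) ^ 2 + 2 * real CARD('n) + 2)
      \<le> 10 ^ 6 * (C + 1) * ((real N + 1) * rate \<eta>)"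
      using card by (intro process_cost_le rate \<eta> C) (simp_all add: Suc_le_eq)
    then have cost: "op_count (T N \<eta>) (process_input a x0) \<le> 10 ^ 6 * (C + 1) * ((real N + 1) * rate \<eta>)"
      using TN(3) by (simp add: add.commute)
    have "runs_polarity_process (T N \<eta>) (S \<eta>) a x0 (tol \<gamma>) N \<gamma> (10 ^ 6 * (C + 1) * ((real N + 1) * rate \<eta>))"
      unfolding runs_polarity_process_def TN(1,2)
      using run(1) inexact_run_gamma_maximal[OF \<gamma> N_def run(1)] cost by blast
    then show "let \<epsilon> = tolerance CARD('m) \<gamma> q0 lam0 rho0 Lctr Lvol r0 L0;
           N = budget \<gamma> q0 (delta a x0); \<eta> = solver_accuracy \<epsilon>
       in runs_polarity_process (T N \<eta>) (S \<eta>) a x0 \<epsilon> N \<gamma> (10 ^ 6 * (C + 1) * ((real N + 1) * rate \<eta>))"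
      by (simp add: Let_def N_def \<eta>_def tol_def)
  qed
qed

text \<open>The order of quantifiers matters: since real literals are free, a program chosen after
  the polytope could have the answer built in. Here the programs depend on \<open>N\<close> and
  \<open>\<eta>\<close> alone.\<close>

theorem theorem4:
  fixes bcd newton :: "real \<Rightarrow> ('m::finite, 'n::finite) solver"
    and C_bcd C_newton :: real
  assumes "0 < C_bcd" and "0 < C_newton"
    and "khachiyan_guarantee bcd (\<lambda>\<eta>. C_bcd * bcd_rate CARD('m) CARD('n) \<eta>)"
    and "khachiyan_guarantee newton (\<lambda>\<eta>. C_newton * newton_rate CARD('m) \<eta>)"
  shows
    "\<exists>prog_bcd prog_newton :: nat \<Rightarrow> real \<Rightarrow> ('m, 'n) process_prog.
       \<forall>(a :: 'm \<Rightarrow> real^'n) x0 \<gamma> q0 lam0 theta0 mu0 sigma0 beta0 rho0 Lctr Lvol r0 L0.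
         polarity_constants a x0 q0 lam0 theta0 mu0 sigma0 beta0 rho0 Lctr Lvol r0 L0 \<longrightarrow>
         0 < \<gamma> \<longrightarrow> \<gamma> < 1 \<longrightarrow>
         (let \<epsilon> = tolerance CARD('m) \<gamma> q0 lam0 rho0 Lctr Lvol r0 L0;
              N = budget \<gamma> q0 (delta a x0);
              \<eta> = solver_accuracy \<epsilon>
          in (\<forall>xs Qs. inexact_polarity_run a x0 \<epsilon> N xs Qs \<longrightarrow>
                gamma_maximal a \<gamma> (xs (N + 1)) (new_shape (Qs N))) \<and>
             runs_polarity_process (prog_bcd N \<eta>) (bcd \<eta>) a x0 \<epsilon> N \<gamma>
               (10 ^ 6 * (C_bcd + 1) * ((real N + 1) * bcd_rate CARD('m) CARD('n) \<eta>)) \<and>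
             runs_polarity_process (prog_newton N \<eta>) (newton \<eta>) a x0 \<epsilon> N \<gamma>
               (10 ^ 6 * (C_newton + 1) * ((real N + 1) * newton_rate CARD('m) \<eta>)))"
proof -
  have n1: "1 \<le> real CARD('n)" by (simp add: Suc_le_eq)
  have bcd: "CARD('m) * (real CARD('n))^2 / 2 \<le> bcd_rate CARD('m) CARD('n) \<eta>"
    if "0 < \<eta>" "\<eta> \<le> 1" "CARD('n) + 1 \<le> CARD('m)" for \<eta>
    using that n1 by (intro bcd_rate_ge) auto
  have newton: "CARD('m) * (real CARD('n))^2 / 2 \<le> newton_rate CARD('m) \<eta>"
    if "0 < \<eta>" "\<eta> \<le> 1" "CARD('n) + 1 \<le> CARD('m)" for \<eta>
    using that n1 by (intro newton_rate_ge) auto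
  show ?thesis
    apply (rule polarity_process_program[OF assms(3,1) bcd]; assumption?)
    apply (rule polarity_process_program[OF assms(4,2) newton]; assumption?)
    subgoal for T T'
      apply (rule exI[of _ T], rule exI[of _ T'])
      unfolding Let_def
      by (metis polarity_constants.inexact_run_gamma_maximal polarity_constants.tol_def)
    done
qed

end
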